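(* Let $a<b$ be real numbers, $\Omega=(a,b)$, and $1\le p\le 4$. Let $a_0,b_0\in\mathbb{R}$, and for each $\epsilon>0$ let $a_\epsilon,b_\epsilon\in\mathbb{R}$ satisfy $a_\epsilon\to a_0$ and $b_\epsilon\to b_0$ as $\epsilon\to0^+$. For each $\epsilon>0$ define $G_\epsilon:L^p(\Omega)\to[-\infty,\infty]$ by $$G_\epsilon(u):=\begin{cases}\int_\Omega \epsilon^{-1}(u^2-1)^2+\epsilon^3|u''|^2\,dx, & u\in W^{2,p}(\Omega),\ u(a_+)=a_\epsilon,\ u(b_-)=b_\epsilon,\\ +\infty, & \text{otherwise.}\end{cases}$$ Let $(\epsilon_n)$ be a sequence of positive reals with $\epsilon_n\to0^+$. Then, with respect to strong convergence in $L^p(\Omega)$, the sequence $G_{\epsilon_n}$ Gamma-converges to the functional $$G(u)=\begin{cases}\alpha\,\operatorname{essVar}_\Omega u+\beta(-a_0\operatorname{sgn} u(a_+))+\beta(-b_0\operatorname{sgn}u(b_-)), & u\in BPV(\Omega;\{-1,1\}),\\ +\infty, & \text{otherwise.}\end{cases}$$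
   Context: For $u\in W^{2,p}$ of an interval, $u$ has a $C^1$ representative with absolutely continuous derivative; $u(a_+)$, $u(b_-)$, $u'(0_+)$ etc. denote the one-sided endpoint limits of this representative (resp. its derivative). For an interval $I$ and $v:I\to\mathbb{R}$, $\operatorname{Var}_I v:=\sup\{\sum_{i=1}^n|v(x_i)-v(x_{i-1})|: x_0<\dots<x_n \text{ in } I\}$. For $u\in L^1_{loc}(I)$, $\operatorname{essVar}_I u:=\inf\{\operatorname{Var}_I\tilde u:\tilde u\text{ a representative of }u\}$; this infimum is attained. $BPV(\Omega;\{-1,1\})$ denotes the set of $u\in L^p(\Omega)$ with $u\in\{-1,1\}$ a.e. and $\operatorname{essVar}_\Omega u<\infty$; for such $u$, $u(a_+)$ and $u(b_-)$ denote the one-sided endpoint limits of a representative of minimal pointwise variation (these lie in $\{-1,1\}$). Define, for $w\in W^{2,p}(0,1)$, $\Phi(w):=\left(\int_0^1(w^2-1)^2dy\right)^{3/4}\left(\int_0^1|w''|^2dy\right)^{1/4}$; $\mathscr{J}:=\{w\in W^{2,p}(0,1): w(0_+)=-1,\ w(1_-)=1,\ w'(0_+)=w'(1_-)=0\}$; for $t\in\mathbb{R}$, $\mathscr{J}'(t):=\{w\in W^{2,p}(0,1): w(0_+)=-1,\ w(1_-)=t,\ w'(0_+)=0\}$; $\alpha:=\frac{2}{3^{3/4}}\inf_{w\in\mathscr{J}}\Phi(w)$ and $\beta(t):=\frac{4}{3^{3/4}}\inf_{w\in\mathscr{J}'(t)}\Phi(w)$. Gamma convergence in a metric space $X$: $f_n$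 Gamma-converges to $f$ if for every $x\in X$, (1) $\liminf_n f_n(x_n)\ge f(x)$ for every sequence $x_n\to x$, and (2) $\limsup_n f_n(x_n)\le f(x)$ for some sequence $x_n\to x$. *)

theory Defs
  imports "HOL-Analysis.Analysis"
begin

section \<open>L^p on an open interval (functions; L^p classes are handled via a.e.-invariance)\<close>

definition Lp :: "real \<Rightarrow> real \<Rightarrow> real \<Rightarrow> (real \<Rightarrow> real) \<Rightarrow> bool" where
  "Lp p a b f \<longleftrightarrow> set_borel_measurable lborel {a<..<b} f \<and>
     (\<integral>\<^sup>+ x\<in>{a<..<b}. ennreal (\<bar>f x\<bar> powr p) \<partial>lborel) < \<infinity>"

definition Lp_conv :: "real \<Rightarrow> real \<Rightarrow> real \<Rightarrow> (nat \<Rightarrow> real \<Rightarrow> real) \<Rightarrow> (real \<Rightarrow> real) \<Rightarrow> bool" where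
  "Lp_conv p a b us u \<longleftrightarrow>
     (\<lambda>n. \<integral>\<^sup>+ x\<in>{a<..<b}. ennreal (\<bar>us n x - u x\<bar> powr p) \<partial>lborel) \<longlonglongrightarrow> 0"

definition Gamma_conv_Lp :: "real \<Rightarrow> real \<Rightarrow> real \<Rightarrow> (nat \<Rightarrow> (real \<Rightarrow> real) \<Rightarrow> ereal)
    \<Rightarrow> ((real \<Rightarrow> real) \<Rightarrow> ereal) \<Rightarrow> bool" where
  "Gamma_conv_Lp p a b F G \<longleftrightarrow> (\<forall>u. Lp p a b u \<longrightarrow>
     (\<forall>us. (\<forall>n. Lp p a b (us n)) \<and> Lp_conv p a b us u \<longrightarrow> liminf (\<lambda>n. F n (us n)) \<ge> G u) \<and>
     (\<exists>us. (\<forall>n. Lp p a b (us n)) \<and> Lp_conv p a b us u \<and> limsup (\<lambda>n. F n (us n)) \<le> G u))"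

text \<open>\<open>W2rep p a b u v dv ddv\<close>: u is in W^{2,p}(a,b), v is its C^1 representative on (a,b) with
  derivative dv, and dv is absolutely continuous with a.e. derivative ddv = u'' (in L^p).\<close>
definition W2rep :: "real \<Rightarrow> real \<Rightarrow> real \<Rightarrow> (real \<Rightarrow> real) \<Rightarrow> (real \<Rightarrow> real) \<Rightarrow> (real \<Rightarrow> real)
    \<Rightarrow> (real \<Rightarrow> real) \<Rightarrow> bool" where
  "W2rep p a b u v dv ddv \<longleftrightarrow>
     Lp p a b u \<and> Lp p a b v \<and> Lp p a b dv \<and> Lp p a b ddv \<and>
     (AE x in lborel. x \<in> {a<..<b} \<longrightarrow> u x = v x) \<and>
     (\<forall>x\<in>{a<..<b}. (v has_real_derivative dv x) (at x)) \<and>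
     (\<forall>x\<in>{a<..<b}. \<forall>y\<in>{a<..<b}. x \<le> y \<longrightarrow> (ddv has_integral (dv y - dv x)) {x..y})"

definition G_eps :: "real \<Rightarrow> real \<Rightarrow> real \<Rightarrow> real \<Rightarrow> real \<Rightarrow> real \<Rightarrow> (real \<Rightarrow> real) \<Rightarrow> ereal" where
  "G_eps p a b eps ae be u =
     (if (\<exists>v dv ddv. W2rep p a b u v dv ddv \<and> (v \<longlongrightarrow> ae) (at_right a) \<and> (v \<longlongrightarrow> be) (at_left b))
      then Inf {enn2ereal (\<integral>\<^sup>+ x\<in>{a<..<b}. ennreal ((u x ^ 2 - 1) ^ 2 / eps + eps ^ 3 * (ddv x) ^ 2) \<partial>lborel)
                | v dv ddv. W2rep p a b u v dv ddv \<and> (v \<longlongrightarrow> ae) (at_right a) \<and> (v \<longlongrightarrow> be) (at_left b)}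
      else \<infinity>)"

definition Phi :: "(real \<Rightarrow> real) \<Rightarrow> (real \<Rightarrow> real) \<Rightarrow> ereal" where
  "Phi w ddw =
    (let A = (\<integral>\<^sup>+ y\<in>{0<..<1}. ennreal ((w y ^ 2 - 1) ^ 2) \<partial>lborel);
         B = (\<integral>\<^sup>+ y\<in>{0<..<1}. ennreal ((ddw y) ^ 2) \<partial>lborel)
     in if A = \<infinity> \<or> B = \<infinity> then \<infinity>
        else ereal (enn2real A powr (3/4) * enn2real B powr (1/4)))"

definition alpha_const :: "real \<Rightarrow> ereal" where
  "alpha_const p = ereal (2 / 3 powr (3/4)) *
     Inf {Phi w ddw | w dw ddw. W2rep p 0 1 w w dw ddw \<and>
            (w \<longlongrightarrow> -1) (at_right 0) \<and> (w \<longlongrightarrow> 1) (at_left 1) \<and>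
            (dw \<longlongrightarrow> 0) (at_right 0) \<and> (dw \<longlongrightarrow> 0) (at_left 1)}"

definition beta_fun :: "real \<Rightarrow> real \<Rightarrow> ereal" where
  "beta_fun p t = ereal (4 / 3 powr (3/4)) *
     Inf {Phi w ddw | w dw ddw. W2rep p 0 1 w w dw ddw \<and>
            (w \<longlongrightarrow> -1) (at_right 0) \<and> (w \<longlongrightarrow> t) (at_left 1) \<and>
            (dw \<longlongrightarrow> 0) (at_right 0)}"

definition pvar :: "real set \<Rightarrow> (real \<Rightarrow> real) \<Rightarrow> ereal" where
  "pvar I v = (SUP nx \<in> {(n, x). (\<forall>i<n. x i < x (Suc i)) \<and> (\<forall>i\<le>n. x i \<in> I)}.
      ereal (\<Sum>i<fst nx. \<bar>v (snd nx (Suc i)) - v (snd nx i)\<bar>))"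

definition essVar :: "real set \<Rightarrow> (real \<Rightarrow> real) \<Rightarrow> ereal" where
  "essVar I u = (INF v \<in> {v. AE x in lborel. x \<in> I \<longrightarrow> u x = v x}. pvar I v)"

definition BPV :: "real \<Rightarrow> real \<Rightarrow> real \<Rightarrow> (real \<Rightarrow> real) \<Rightarrow> bool" where
  "BPV p a b u \<longleftrightarrow> Lp p a b u \<and> (AE x in lborel. x \<in> {a<..<b} \<longrightarrow> u x \<in> {-1, 1}) \<and>
     essVar {a<..<b} u < \<infinity>"

definition bpv_left :: "real \<Rightarrow> real \<Rightarrow> (real \<Rightarrow> real) \<Rightarrow> real" where
  "bpv_left a b u = (SOME t. \<exists>v. (AE x in lborel. x \<in> {a<..<b} \<longrightarrow> u x = v x) \<and>
      pvar {a<..<b} v = essVar {a<..<b} u \<and> (v \<longlongrightarrow> t) (at_right a))"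

definition bpv_right :: "real \<Rightarrow> real \<Rightarrow> (real \<Rightarrow> real) \<Rightarrow> real" where
  "bpv_right a b u = (SOME t. \<exists>v. (AE x in lborel. x \<in> {a<..<b} \<longrightarrow> u x = v x) \<and>
      pvar {a<..<b} v = essVar {a<..<b} u \<and> (v \<longlongrightarrow> t) (at_left b))"

definition G_lim :: "real \<Rightarrow> real \<Rightarrow> real \<Rightarrow> real \<Rightarrow> real \<Rightarrow> (real \<Rightarrow> real) \<Rightarrow> ereal" where
  "G_lim p a b a0 b0 u =
     (if BPV p a b u
      then alpha_const p * essVar {a<..<b} u
           + beta_fun p (- a0 * sgn (bpv_left a b u))
           + beta_fun p (- b0 * sgn (bpv_right a b u))
      else \<infinity>)"

end

theory Submission
  imports Defs
begin

text \<open>After blowing up by \<open>\<epsilon>\<close> the energy becomes \<open>\<integral> (w\<^sup>2 - 1)\<^sup>2 + w''\<^sup>2\<close> on an interval of length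
  \<open>(b - a) / \<epsilon>\<close>. Optimising over the length of the interval shows that \<open>2 \<alpha>\<close> and \<open>\<beta> t\<close> are the minimal energies of
  profiles, on intervals of arbitrary length, that run from rest at \<open>-1\<close> to rest at \<open>1\<close>, respectively from rest
  at \<open>-1\<close> to the value \<open>t\<close>.

  Lower bound: every sign change costs at least \<open>1/100\<close>, so a limit of bounded energy jumps only finitely often.
  Inside each interval where the limit is constant, a unit cell of small energy contains a point at which the
  rescaled function is almost at rest in the right well. Cutting at these points and correcting the
  boundary data by small cubic perturbations compares the pieces with \<open>2 \<alpha>\<close> and \<open>\<beta>\<close>.
  Upper bound: almost optimal profiles are glued by constants.\<close>

subsection \<open>Measurability and integrals on intervals\<close>

text \<open>L^p convergence controls neither values nor slopes at a given point, while the sharp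
  costs presuppose exact rest at a well. The blow-up supplies the missing control: a window where
  the limit is constant contains of order 1/eps unit cells, the energy stays bounded and the total
  p-distance is o(1/eps), so some cell is small in both respects, and there the energy bounds the
  oscillation of the slope. Correcting the data must not disturb the leading constant although
  profiles are not bounded a priori; hence the perturbation estimates carry a factor 1 + O(\<eta>)
  and an additive O(\<eta>) confined to a unit interval.

  The 2 in 2 \<alpha> is the height of a jump: N jumps between -1 and 1 have essential variation 2N.
  The number 4/3^(3/4) is the minimum of l A + B/l^3 over l > 0, divided by A^(3/4) B^(1/4). The
  outer slope in \<beta> is free because the boundary condition fixes values only; since these
  values merely converge, the upper bound needs boundary profiles for a whole neighbourhood of the
  limiting value, uniform in energy and length.\<close>

lemma continuous_on_has_integral_increments:
  fixes f F :: "real \<Rightarrow> real"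
  assumes "\<And>x y. c \<le> x \<Longrightarrow> x \<le> y \<Longrightarrow> y \<le> d \<Longrightarrow> (f has_integral (F y - F x)) {x..y}"
  shows "continuous_on {c..d} F"
proof (cases "c \<le> d")
  case True
  have "f integrable_on {c..d}" using assms[of c d] True by auto
  then have "continuous_on {c..d} (\<lambda>x. F c + integral {c..x} f)"
    by (intro continuous_intros indefinite_integral_continuous_1)
  moreover have "F c + integral {c..x} f = F x" if "x \<in> {c..d}" for x
    using integral_unique[OF assms[of c x]] that by auto
  ultimately show ?thesis by (metis (no_types, lifting) continuous_on_cong)
qed auto

lemma derivative_has_integral_increments:
  fixes f F :: "real \<Rightarrow> real"
  assumes "\<And>x y. c \<le> x \<Longrightarrow> x \<le> y \<Longrightarrow> y \<le> d \<Longrightarrow> (f has_integral (F y - F x)) {x..y}"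
    and "continuous_on {c..d} f" and x: "x \<in> {c..d}"
  shows "(F has_real_derivative f x) (at x within {c..d})"
proof -
  have "((\<lambda>x. F c + integral {c..x} f) has_real_derivative 0 + f x) (at x within {c..d})"
    by (intro DERIV_add DERIV_const integral_has_real_derivative assms)
  moreover have "F c + integral {c..x} f = F x" if "x \<in> {c..d}" for x
    using integral_unique[OF assms(1)[of c x]] that by auto
  ultimately show ?thesis
    using has_field_derivative_transform_within[of "\<lambda>x. F c + integral {c..x} f" "0 + f x" x "{c..d}" 1 F] x by simp
qed

lemma set_borel_measurable_cont:
  fixes f :: "real \<Rightarrow> real"
  assumes "continuous_on {c..d} f"
  shows "set_borel_measurable lborel {c<..<d} f"
proof -
  have "continuous_on {c<..<d} f" by (rule continuous_on_subset[OF assms]) auto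
  then show ?thesis unfolding set_borel_measurable_def
    using borel_measurable_continuous_on_indicator[of "{c<..<d}" f] by simp
qed

lemma set_borel_measurable_mono:
  fixes f :: "real \<Rightarrow> real"
  assumes "set_borel_measurable lborel {c<..<d} f" "c \<le> c'" "d' \<le> d"
  shows "set_borel_measurable lborel {c'<..<d'} f"
proof -
  have [measurable]: "(\<lambda>x. indicator {c<..<d} x * f x) \<in> borel_measurable lborel"
    using assms(1) by (simp add: set_borel_measurable_def)
  have "(\<lambda>x. indicator {c'<..<d'} x * (indicator {c<..<d} x * f x)) \<in> borel_measurable lborel"
    by measurable
  also have "(\<lambda>x. indicator {c'<..<d'} x * (indicator {c<..<d} x * f x)) = (\<lambda>x. indicator {c'<..<d'} x * f x)"
    using assms(2,3) by (auto simp: indicator_def fun_eq_iff)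
  finally show ?thesis by (simp add: set_borel_measurable_def)
qed

lemma set_borel_measurable_affine:
  fixes f :: "real \<Rightarrow> real"
  assumes "set_borel_measurable lborel {m*c+k<..<m*d+k} f" "m > 0"
  shows "set_borel_measurable lborel {c<..<d} (\<lambda>x. f (m*x+k))"
proof -
  have [measurable]: "(\<lambda>x. indicator {m*c+k<..<m*d+k} x * f x) \<in> borel_measurable borel"
    using assms(1) by (simp add: set_borel_measurable_def)
  have "(\<lambda>x. (\<lambda>x. indicator {m*c+k<..<m*d+k} x * f x) (m*x+k)) \<in> borel_measurable borel"
    by measurable
  also have "(\<lambda>x. (\<lambda>x. indicator {m*c+k<..<m*d+k} x * f x) (m*x+k)) = (\<lambda>x. indicator {c<..<d} x * f (m*x+k))"
    using assms(2) by (auto simp: indicator_def fun_eq_iff)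
  finally show ?thesis by (simp add: set_borel_measurable_def)
qed

lemma set_borel_measurable_reflect:
  fixes f :: "real \<Rightarrow> real"
  assumes "set_borel_measurable lborel {c<..<d} f"
  shows "set_borel_measurable lborel {-d<..<-c} (\<lambda>x. f (-x))"
proof -
  have [measurable]: "(\<lambda>x. indicator {c<..<d} x * f x) \<in> borel_measurable borel"
    using assms(1) by (simp add: set_borel_measurable_def)
  have "(\<lambda>x. (\<lambda>x. indicator {c<..<d} x * f x) (-x)) \<in> borel_measurable borel"
    by measurable
  also have "(\<lambda>x. (\<lambda>x. indicator {c<..<d} x * f x) (-x)) = (\<lambda>x. indicator {-d<..<-c} x * f (-x))"
    by (auto simp: indicator_def fun_eq_iff)
  finally show ?thesis by (simp add: set_borel_measurable_def)
qed

lemma set_borel_measurable_join: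
  fixes f g :: "real \<Rightarrow> real"
  assumes "set_borel_measurable lborel {c<..<m} f" "set_borel_measurable lborel {m<..<d} g"
    "c < m" "m < d"
  shows "set_borel_measurable lborel {c<..<d} (\<lambda>x. if x \<le> m then f x else g x)"
proof -
  have [measurable]: "(\<lambda>x. indicator {c<..<m} x * f x) \<in> borel_measurable borel"
     "(\<lambda>x. indicator {m<..<d} x * g x) \<in> borel_measurable borel"
    using assms(1,2) by (simp_all add: set_borel_measurable_def)
  have "(\<lambda>x. indicator {c<..<m} x * f x + indicator {m<..<d} x * g x + indicator {m} x * f m) \<in> borel_measurable borel"
    by measurable
  also have "(\<lambda>x. indicator {c<..<m} x * f x + indicator {m<..<d} x * g x + indicator {m} x * f m)
     = (\<lambda>x. indicator {c<..<d} x * (if x \<le> m then f x else g x))"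
    using assms(3,4) by (auto simp: indicator_def fun_eq_iff)
  finally show ?thesis by (simp add: set_borel_measurable_def)
qed

text \<open>\<open>f\<close> and \<open>g\<close> are measurable only after being cut off to the
  interval. \<open>H\<close> is therefore applied to the cut-off functions, and the outer indicator
  removes whatever value \<open>H\<close> takes at \<open>(0, 0)\<close>.\<close>

lemma measurable_density2:
  fixes f g :: "real \<Rightarrow> real" and H :: "real \<Rightarrow> real \<Rightarrow> real"
  assumes "set_borel_measurable lborel {c<..<d} f" "set_borel_measurable lborel {c<..<d} g"
   and H: "(\<lambda>(x,y). H x y) \<in> borel_measurable (borel \<Otimes>\<^sub>M borel)"
  shows "(\<lambda>x. ennreal (H (f x) (g x)) * indicator {c<..<d} x) \<in> borel_measurable lborel"
proof -
  have [measurable]: "(\<lambda>x. indicator {c<..<d} x * f x) \<in> borel_measurable lborel"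
     "(\<lambda>x. indicator {c<..<d} x * g x) \<in> borel_measurable lborel"
    using assms(1,2) by (simp_all add: set_borel_measurable_def)
  note [measurable] = H
  have "(\<lambda>x. ennreal ((\<lambda>(x,y). H x y) (indicator {c<..<d} x * f x, indicator {c<..<d} x * g x)) * indicator {c<..<d} x) \<in> borel_measurable lborel"
    by measurable
  also have "(\<lambda>x. ennreal ((\<lambda>(x,y). H x y) (indicator {c<..<d} x * f x, indicator {c<..<d} x * g x)) * indicator {c<..<d} x)
    = (\<lambda>x. ennreal (H (f x) (g x)) * indicator {c<..<d} x)"
    by (auto simp: indicator_def fun_eq_iff)
  finally show ?thesis .
qed

lemma measurable_density1:
  fixes f :: "real \<Rightarrow> real" and H :: "real \<Rightarrow> real"
  assumes "set_borel_measurable lborel {c<..<d} f"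
   and H: "H \<in> borel_measurable borel"
  shows "(\<lambda>x. ennreal (H (f x)) * indicator {c<..<d} x) \<in> borel_measurable lborel"
  by (rule measurable_density2[OF assms(1) assms(1), of "\<lambda>x y. H x"]) (use H in measurable)

lemma nn_interval_split:
  fixes g :: "real \<Rightarrow> ennreal"
  assumes "(\<lambda>x. g x * indicator {c<..<d} x) \<in> borel_measurable lborel" "c \<le> m" "m \<le> d"
  shows "(\<integral>\<^sup>+ x\<in>{c<..<d}. g x \<partial>lborel) = (\<integral>\<^sup>+ x\<in>{c<..<m}. g x \<partial>lborel) + (\<integral>\<^sup>+ x\<in>{m<..<d}. g x \<partial>lborel)"
proof -
  note [measurable] = assms(1)
  have 1: "(\<lambda>x. g x * indicator {c<..<m} x) = (\<lambda>x. (g x * indicator {c<..<d} x) * indicator {c<..<m} x)"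
    using assms(3) by (auto simp: indicator_def fun_eq_iff)
  have 2: "(\<lambda>x. g x * indicator {m<..<d} x) = (\<lambda>x. (g x * indicator {c<..<d} x) * indicator {m<..<d} x)"
    using assms(2) by (auto simp: indicator_def fun_eq_iff)
  have [measurable]: "(\<lambda>x. g x * indicator {c<..<m} x) \<in> borel_measurable lborel"
     "(\<lambda>x. g x * indicator {m<..<d} x) \<in> borel_measurable lborel"
    unfolding 1 2 by measurable
  have "(\<integral>\<^sup>+ x\<in>{c<..<d}. g x \<partial>lborel) = (\<integral>\<^sup>+ x. g x * indicator {c<..<m} x + g x * indicator {m<..<d} x \<partial>lborel)"
    by (rule nn_integral_cong_AE, rule AE_mp[OF AE_lborel_singleton[of m]], rule AE_I2)
       (use assms(2,3) in \<open>auto simp: indicator_def\<close>)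
  then show ?thesis by (simp add: nn_integral_add)
qed

lemma nn_interval_mono:
  fixes g h :: "real \<Rightarrow> ennreal"
  assumes "c' \<le> c" "d \<le> d'" "\<And>x. c < x \<Longrightarrow> x < d \<Longrightarrow> g x \<le> h x"
  shows "(\<integral>\<^sup>+ x\<in>{c<..<d}. g x \<partial>lborel) \<le> (\<integral>\<^sup>+ x\<in>{c'<..<d'}. h x \<partial>lborel)"
  using assms by (intro nn_integral_mono) (auto simp: indicator_def)

lemma nn_interval_affine:
  fixes g :: "real \<Rightarrow> ennreal"
  assumes "(\<lambda>x. g x * indicator {m*c+k<..<m*d+k} x) \<in> borel_measurable lborel" "m > 0"
  shows "(\<integral>\<^sup>+ x\<in>{m*c+k<..<m*d+k}. g x \<partial>lborel) = ennreal m * (\<integral>\<^sup>+ x\<in>{c<..<d}. g (m*x+k) \<partial>lborel)"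
proof -
  have "(\<integral>\<^sup>+ x\<in>{m*c+k<..<m*d+k}. g x \<partial>lborel)
     = ennreal m * (\<integral>\<^sup>+ x. g (k + m*x) * indicator {m*c+k<..<m*d+k} (k + m*x) \<partial>lborel)"
    using nn_integral_real_affine[of "\<lambda>x. g x * indicator {m*c+k<..<m*d+k} x" m k] assms by simp
  also have "(\<lambda>x. g (k + m*x) * indicator {m*c+k<..<m*d+k} (k + m*x)) = (\<lambda>x. g (m*x+k) * indicator {c<..<d} x)"
    using assms(2) by (auto simp: indicator_def fun_eq_iff add.commute)
  finally show ?thesis .
qed

lemma nn_interval_reflect:
  fixes g :: "real \<Rightarrow> ennreal"
  assumes "(\<lambda>x. g x * indicator {c<..<d} x) \<in> borel_measurable lborel"
  shows "(\<integral>\<^sup>+ x\<in>{-d<..<-c}. g (-x) \<partial>lborel) = (\<integral>\<^sup>+ x\<in>{c<..<d}. g x \<partial>lborel)"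
proof -
  have "(\<integral>\<^sup>+ x\<in>{c<..<d}. g x \<partial>lborel) = (\<integral>\<^sup>+ x. g (-x) * indicator {c<..<d} (-x) \<partial>lborel)"
    using nn_integral_real_affine[of "\<lambda>x. g x * indicator {c<..<d} x" "-1" 0] assms by simp
  also have "(\<lambda>x. g (-x) * indicator {c<..<d} (-x)) = (\<lambda>x. g (-x) * indicator {-d<..<-c} x)"
    by (auto simp: indicator_def fun_eq_iff)
  finally show ?thesis by simp
qed

lemma nn_interval_const: "c \<le> d \<Longrightarrow> (\<integral>\<^sup>+ x\<in>{c<..<d}. k \<partial>lborel) = k * ennreal (d - c)"
  by (simp add: nn_integral_cmult_indicator)

section \<open>The class L^p on an interval under dilation, sums and gluing\<close>

lemma Lp_cont:
  assumes "continuous_on {c..d} f" "p \<ge> 1"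
  shows "Lp p c d f"
proof (cases "c \<le> d")
  case True
  have "compact (f ` {c..d})" using assms(1) by (intro compact_continuous_image) auto
  then have "bounded (f ` {c..d})" by (rule compact_imp_bounded)
  then obtain M where M: "\<And>x. x \<in> {c..d} \<Longrightarrow> \<bar>f x\<bar> \<le> M" unfolding bounded_iff by fastforce
  have "(\<integral>\<^sup>+ x\<in>{c<..<d}. ennreal (\<bar>f x\<bar> powr p) \<partial>lborel) \<le> (\<integral>\<^sup>+ x\<in>{c<..<d}. ennreal (M powr p) \<partial>lborel)"
    using M assms(2) by (intro nn_interval_mono) (auto intro!: ennreal_leI powr_mono2)
  also have "\<dots> < \<infinity>" using True by (simp add: nn_interval_const ennreal_mult_less_top)
  finally show ?thesis using set_borel_measurable_cont[OF assms(1)] by (simp add: Lp_def)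
qed (simp add: Lp_def set_borel_measurable_def)

lemma Lp_restrict: "Lp p c d f \<Longrightarrow> c \<le> c' \<Longrightarrow> d' \<le> d \<Longrightarrow> Lp p c' d' f"
  unfolding Lp_def using set_borel_measurable_mono nn_interval_mono[of c c' d' d "\<lambda>x. ennreal (\<bar>f x\<bar> powr p)" "\<lambda>x. ennreal (\<bar>f x\<bar> powr p)"]
  by (auto intro: le_less_trans)

lemma Lp_density: "Lp p c d f \<Longrightarrow> (\<lambda>x. ennreal (\<bar>f x\<bar> powr p) * indicator {c<..<d} x) \<in> borel_measurable lborel"
  by (rule measurable_density1) (auto simp: Lp_def)

lemma Lp_affine:
  assumes "Lp p (m*c+k) (m*d+k) f" "m > 0"
  shows "Lp p c d (\<lambda>x. f (m*x+k))"
  using assms set_borel_measurable_affine[of m c k d f] nn_interval_affine[OF Lp_density[OF assms(1)] assms(2)]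
  by (auto simp: Lp_def ennreal_mult_less_top ennreal_mult_eq_top_iff top.not_eq_extremum[symmetric])

lemma Lp_reflect:
  assumes "Lp p c d f"
  shows "Lp p (-d) (-c) (\<lambda>x. f (-x))"
  using assms set_borel_measurable_reflect[of c d f] nn_interval_reflect[OF Lp_density[OF assms(1)]]
  by (auto simp: Lp_def)

lemma Lp_cmult:
  assumes "Lp p c d f"
  shows "Lp p c d (\<lambda>x. k * f x)"
proof -
  note [measurable] = Lp_density[OF assms]
  have "(\<integral>\<^sup>+ x\<in>{c<..<d}. ennreal (\<bar>k * f x\<bar> powr p) \<partial>lborel) = ennreal (\<bar>k\<bar> powr p) * (\<integral>\<^sup>+ x\<in>{c<..<d}. ennreal (\<bar>f x\<bar> powr p) \<partial>lborel)"
    by (subst nn_integral_cmult[symmetric]) (auto simp: abs_mult powr_mult ennreal_mult mult.assoc)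
  also have "\<dots> < \<infinity>" using assms by (simp add: Lp_def ennreal_mult_less_top)
  finally have fin: "(\<integral>\<^sup>+ x\<in>{c<..<d}. ennreal (\<bar>k * f x\<bar> powr p) \<partial>lborel) < \<infinity>" .
  have [measurable]: "(\<lambda>x. indicator {c<..<d} x * f x) \<in> borel_measurable lborel"
    using assms by (simp add: Lp_def set_borel_measurable_def)
  have "(\<lambda>x. k * (indicator {c<..<d} x * f x)) \<in> borel_measurable lborel"
    by measurable
  then have "set_borel_measurable lborel {c<..<d} (\<lambda>x. k * f x)"
    by (simp add: set_borel_measurable_def mult.left_commute)
  with fin show ?thesis by (simp add: Lp_def)
qed

lemma Lp_add:
  assumes "Lp p c d f" "Lp p c d g" "p \<ge> 1"
  shows "Lp p c d (\<lambda>x. f x + g x)"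
proof -
  note [measurable] = Lp_density[OF assms(1)] Lp_density[OF assms(2)]
  \<comment> \<open>The crude bound |x + y| \<le> 2 max(|x|, |y|) replaces Minkowski's inequality,
    since only finiteness is wanted.\<close>
  have le: "\<bar>x + y\<bar> powr p \<le> 2 powr p * (\<bar>x\<bar> powr p + \<bar>y\<bar> powr p)" for x y :: real
  proof -
    have "\<bar>x + y\<bar> powr p \<le> (2 * max \<bar>x\<bar> \<bar>y\<bar>) powr p" using assms(3) by (intro powr_mono2) auto
    also have "\<dots> = 2 powr p * (max \<bar>x\<bar> \<bar>y\<bar>) powr p" by (simp add: powr_mult)
    also have "\<dots> \<le> 2 powr p * (\<bar>x\<bar> powr p + \<bar>y\<bar> powr p)" by (auto simp: max_def)
    finally show ?thesis .
  qed
  have "(\<integral>\<^sup>+ x\<in>{c<..<d}. ennreal (\<bar>f x + g x\<bar> powr p) \<partial>lborel)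
     \<le> (\<integral>\<^sup>+ x. ennreal (2 powr p) * (ennreal (\<bar>f x\<bar> powr p) * indicator {c<..<d} x + ennreal (\<bar>g x\<bar> powr p) * indicator {c<..<d} x) \<partial>lborel)"
    using le by (intro nn_integral_mono)
      (auto simp: indicator_def ennreal_mult[symmetric] ennreal_plus[symmetric] intro!: ennreal_leI simp del: ennreal_plus)
  also have "\<dots> = ennreal (2 powr p) * ((\<integral>\<^sup>+ x\<in>{c<..<d}. ennreal (\<bar>f x\<bar> powr p) \<partial>lborel) + (\<integral>\<^sup>+ x\<in>{c<..<d}. ennreal (\<bar>g x\<bar> powr p) \<partial>lborel))"
    by (subst nn_integral_cmult, measurable, subst nn_integral_add) auto
  also have "\<dots> < \<infinity>" using assms by (simp add: Lp_def ennreal_mult_less_top)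
  finally have fin: "(\<integral>\<^sup>+ x\<in>{c<..<d}. ennreal (\<bar>f x + g x\<bar> powr p) \<partial>lborel) < \<infinity>" .
  have "(\<lambda>x. (indicator {c<..<d} x * f x) + (indicator {c<..<d} x * g x)) \<in> borel_measurable lborel"
    using assms by (intro borel_measurable_add) (auto simp: Lp_def set_borel_measurable_def)
  then have "set_borel_measurable lborel {c<..<d} (\<lambda>x. f x + g x)"
    by (simp add: set_borel_measurable_def distrib_left)
  with fin show ?thesis by (simp add: Lp_def)
qed

lemma Lp_join:
  assumes "Lp p c m f" "Lp p m d g" "c < m" "m < d"
  shows "Lp p c d (\<lambda>x. if x \<le> m then f x else g x)" (is "Lp p c d ?h")
proof -
  have m: "set_borel_measurable lborel {c<..<d} ?h"
    using assms by (intro set_borel_measurable_join) (auto simp: Lp_def)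
  then have "(\<integral>\<^sup>+ x\<in>{c<..<d}. ennreal (\<bar>?h x\<bar> powr p) \<partial>lborel) =
     (\<integral>\<^sup>+ x\<in>{c<..<m}. ennreal (\<bar>?h x\<bar> powr p) \<partial>lborel) + (\<integral>\<^sup>+ x\<in>{m<..<d}. ennreal (\<bar>?h x\<bar> powr p) \<partial>lborel)"
    using assms by (intro nn_interval_split measurable_density1[of _ _ ?h "\<lambda>y. \<bar>y\<bar> powr p"]) auto
  also have "\<dots> \<le> (\<integral>\<^sup>+ x\<in>{c<..<m}. ennreal (\<bar>f x\<bar> powr p) \<partial>lborel) + (\<integral>\<^sup>+ x\<in>{m<..<d}. ennreal (\<bar>g x\<bar> powr p) \<partial>lborel)"
    by (intro add_mono nn_interval_mono) auto
  also have "\<dots> < \<infinity>" using assms by (simp add: Lp_def)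
  finally show ?thesis using m by (simp add: Lp_def)
qed

subsection \<open>Profiles and their energy\<close>

text \<open>This is W^{2,p} on a closed interval, written through integrals of increments rather
  than derivatives. \<open>w\<close> and \<open>w1\<close> are then continuous up to both ends, so
  boundary data are plain values, and dilation, reflection, addition and gluing reduce to rules for
  \<open>has_integral\<close>.\<close>

definition prof :: "real \<Rightarrow> real \<Rightarrow> real \<Rightarrow> (real \<Rightarrow> real) \<Rightarrow> (real \<Rightarrow> real) \<Rightarrow> (real \<Rightarrow> real) \<Rightarrow> bool" where
  "prof p c d w w1 w2 \<longleftrightarrow> c < d \<and> Lp p c d w2 \<and>
     (\<forall>x y. c \<le> x \<longrightarrow> x \<le> y \<longrightarrow> y \<le> d \<longrightarrow> (w2 has_integral (w1 y - w1 x)) {x..y}) \<and>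
     (\<forall>x y. c \<le> x \<longrightarrow> x \<le> y \<longrightarrow> y \<le> d \<longrightarrow> (w1 has_integral (w y - w x)) {x..y})"

definition en :: "real \<Rightarrow> real \<Rightarrow> (real \<Rightarrow> real) \<Rightarrow> (real \<Rightarrow> real) \<Rightarrow> ennreal" where
  "en c d w w2 = (\<integral>\<^sup>+ x\<in>{c<..<d}. ennreal ((w x ^ 2 - 1) ^ 2 + (w2 x) ^ 2) \<partial>lborel)"

lemma profD:
  assumes "prof p c d w w1 w2"
  shows "c < d" "Lp p c d w2"
    "c \<le> x \<Longrightarrow> x \<le> y \<Longrightarrow> y \<le> d \<Longrightarrow> (w2 has_integral (w1 y - w1 x)) {x..y}"
    "c \<le> x \<Longrightarrow> x \<le> y \<Longrightarrow> y \<le> d \<Longrightarrow> (w1 has_integral (w y - w x)) {x..y}"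
  using assms unfolding prof_def by auto

lemma prof_continuous:
  assumes "prof p c d w w1 w2"
  shows "continuous_on {c..d} w" "continuous_on {c..d} w1"
  using continuous_on_has_integral_increments[OF profD(3)[OF assms]]
    continuous_on_has_integral_increments[OF profD(4)[OF assms]] by auto

lemma prof_deriv:
  assumes "prof p c d w w1 w2" "x \<in> {c..d}"
  shows "(w has_real_derivative w1 x) (at x within {c..d})"
  using derivative_has_integral_increments[OF profD(4)[OF assms(1)] prof_continuous(2)[OF assms(1)] assms(2)]
  by auto

lemma prof_restrict: "prof p c d w w1 w2 \<Longrightarrow> c \<le> c' \<Longrightarrow> c' < d' \<Longrightarrow> d' \<le> d \<Longrightarrow> prof p c' d' w w1 w2"
  unfolding prof_def using Lp_restrict by auto

lemma prof_affine:
  assumes "prof p (m*c+k) (m*d+k) w w1 w2" "m > 0"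
  shows "prof p c d (\<lambda>x. w (m*x+k)) (\<lambda>x. m * w1 (m*x+k)) (\<lambda>x. m^2 * w2 (m*x+k))"
proof -
  have int: "((\<lambda>z. m * f (m*z+k)) has_integral I) {x..y}" if "(f has_integral I) {m*x+k..m*y+k}" "x \<le> y" for f I x y
  proof -
    have "((\<lambda>z. f (m*z+k)) has_integral I / m) {x..y}"
      using has_integral_affinity'[of f I "m*x+k" "m*y+k" m k] that assms(2)
      by (simp add: divide_simps)
    from has_integral_mult_right[OF this, of m] show ?thesis using assms(2) by simp
  qed
  have mono: "m*x+k \<le> m*y+k \<longleftrightarrow> x \<le> y" "m*x+k < m*y+k \<longleftrightarrow> x < y" for x y using assms(2) by auto
  have "((\<lambda>z. m^2 * w2 (m*z+k)) has_integral (m * w1 (m*y+k) - m * w1 (m*x+k))) {x..y}"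
    if "c \<le> x" "x \<le> y" "y \<le> d" for x y
  proof -
    have "((\<lambda>z. m * w2 (m*z+k)) has_integral (w1 (m*y+k) - w1 (m*x+k))) {x..y}"
      using that assms(2) by (intro int profD(3)[OF assms(1)]) (auto intro: mult_left_mono)
    from has_integral_mult_right[OF this, of m] show ?thesis by (simp add: power2_eq_square algebra_simps)
  qed
  moreover have "((\<lambda>z. m * w1 (m*z+k)) has_integral (w (m*y+k) - w (m*x+k))) {x..y}"
    if "c \<le> x" "x \<le> y" "y \<le> d" for x y
    using that assms(2) by (intro int profD(4)[OF assms(1)]) (auto intro: mult_left_mono)
  moreover have "Lp p c d (\<lambda>x. m^2 * w2 (m*x+k))"
    by (intro Lp_cmult Lp_affine profD(2)[OF assms(1)] assms)
  ultimately show ?thesis using profD(1)[OF assms(1)] unfolding prof_def mono by auto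
qed

lemma prof_reflect:
  assumes "prof p c d w w1 w2"
  shows "prof p (-d) (-c) (\<lambda>x. w (-x)) (\<lambda>x. - w1 (-x)) (\<lambda>x. w2 (-x))"
proof -
  have "((\<lambda>z. w2 (-z)) has_integral (- w1 (-y) - - w1 (-x))) {x..y}"
    if "-d \<le> x" "x \<le> y" "y \<le> -c" for x y
    using profD(3)[OF assms, of "-y" "-x"] that has_integral_reflect_real[of w2 "- w1 (-y) - - w1 (-x)" "-x" "-y"] by simp
  moreover have "((\<lambda>z. - w1 (-z)) has_integral (w (-y) - w (-x))) {x..y}"
    if "-d \<le> x" "x \<le> y" "y \<le> -c" for x y
    using has_integral_neg[OF profD(4)[OF assms, of "-y" "-x"]] that
     has_integral_reflect_real[of "\<lambda>x. - w1 x" "w (-y) - w (-x)" "-x" "-y"] by simp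
  ultimately show ?thesis using profD(1,2)[OF assms] Lp_reflect[of p c d w2] unfolding prof_def by auto
qed

lemma prof_cmult:
  assumes "prof p c d w w1 w2"
  shows "prof p c d (\<lambda>x. k * w x) (\<lambda>x. k * w1 x) (\<lambda>x. k * w2 x)"
  using profD[OF assms] Lp_cmult unfolding prof_def
  by (auto simp: right_diff_distrib[symmetric] intro!: has_integral_mult_right)

lemma prof_add:
  assumes "prof p c d w w1 w2" "prof p c d v v1 v2" "p \<ge> 1"
  shows "prof p c d (\<lambda>x. w x + v x) (\<lambda>x. w1 x + v1 x) (\<lambda>x. w2 x + v2 x)"
proof -
  have eq: "(A + B) - (C + D) = (A - C) + (B - D)" for A B C D :: real by simp
  show ?thesis unfolding prof_def eq
    using profD[OF assms(1)] profD[OF assms(2)] assms(3) by (auto intro!: has_integral_add Lp_add)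
qed

lemma prof_const: "c < d \<Longrightarrow> p \<ge> 1 \<Longrightarrow> prof p c d (\<lambda>x. k) (\<lambda>x. 0) (\<lambda>x. 0)"
  unfolding prof_def by (auto intro!: Lp_cont)

lemma prof_cubic:
  assumes "c < d" "p \<ge> 1"
  shows "prof p c d (\<lambda>x. A*x^2 + B*x^3) (\<lambda>x. 2*A*x + 3*B*x^2) (\<lambda>x. 2*A + 6*B*x)"
proof -
  have "((\<lambda>z. 2*A + 6*B*z) has_integral ((2*A*y + 3*B*y^2) - (2*A*x + 3*B*x^2))) {x..y}" if "x \<le> y" for x y
    using that by (intro fundamental_theorem_of_calculus)
     (auto intro!: derivative_eq_intros simp: has_real_derivative_iff_has_vector_derivative[symmetric])
  moreover have "((\<lambda>z. 2*A*z + 3*B*z^2) has_integral ((A*y^2 + B*y^3) - (A*x^2 + B*x^3))) {x..y}" if "x \<le> y" for x y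
    using that by (intro fundamental_theorem_of_calculus)
     (auto intro!: derivative_eq_intros simp: has_real_derivative_iff_has_vector_derivative[symmetric])
  moreover have "Lp p c d (\<lambda>x. 2*A + 6*B*x)" by (intro Lp_cont continuous_intros assms)
  ultimately show ?thesis unfolding prof_def using assms by auto
qed

lemma has_integral_increments_join:
  fixes f g F G :: "real \<Rightarrow> real"
  assumes f: "\<And>x y. c \<le> x \<Longrightarrow> x \<le> y \<Longrightarrow> y \<le> m \<Longrightarrow> (f has_integral (F y - F x)) {x..y}"
    and g: "\<And>x y. m \<le> x \<Longrightarrow> x \<le> y \<Longrightarrow> y \<le> d \<Longrightarrow> (g has_integral (G y - G x)) {x..y}"
    and eq: "F m = G m" and xy: "c \<le> x" "x \<le> y" "y \<le> d"
  shows "((\<lambda>z. if z \<le> m then f z else g z) has_integral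
     ((if y \<le> m then F y else G y) - (if x \<le> m then F x else G x))) {x..y}"
proof -
  let ?h = "\<lambda>z. if z \<le> m then f z else g z"
  have f': "(?h has_integral (F y - F x)) {x..y}" if "c \<le> x" "x \<le> y" "y \<le> m" for x y
    using f[OF that] that by (elim has_integral_eq[rotated]) auto
  \<comment> \<open>At \<open>m\<close> the first branch applies even when the interval starts
    there; a single point does not change the integral.\<close>
  have g': "(?h has_integral (G y - G x)) {x..y}" if "m \<le> x" "x \<le> y" "y \<le> d" for x y
    by (rule has_integral_spike_finite[OF _ _ g[OF that], of "{m}"]) (use that in auto)
  consider "y \<le> m" | "m < x" | "x \<le> m" "m < y" by linarith
  then show ?thesis
  proof cases
    case 3
    have "(?h has_integral ((F m - F x) + (G y - G m))) {x..y}"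
      by (rule has_integral_combine[of x m y]) (use 3 xy f'[of x m] g'[of m y] in auto)
    then show ?thesis using 3 eq by simp
  qed (use f'[OF xy(1,2)] g'[of x y] xy in auto)
qed

text \<open>Matching value and slope suffices: the second derivative is merely in L^p, so a jump of
  it at \<open>m\<close> is harmless.\<close>

lemma prof_join:
  assumes "prof p c m w w1 w2" "prof p m d v v1 v2" "w m = v m" "w1 m = v1 m"
  shows "prof p c d (\<lambda>x. if x \<le> m then w x else v x) (\<lambda>x. if x \<le> m then w1 x else v1 x)
      (\<lambda>x. if x \<le> m then w2 x else v2 x)"
  unfolding prof_def
  using Lp_join[OF profD(2)[OF assms(1)] profD(2)[OF assms(2)]] profD(1)[OF assms(1)] profD(1)[OF assms(2)]
   has_integral_increments_join[of c m w2 w1 d v2 v1, OF profD(3)[OF assms(1)] profD(3)[OF assms(2)] assms(4)]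
   has_integral_increments_join[of c m w1 w d v1 v, OF profD(4)[OF assms(1)] profD(4)[OF assms(2)] assms(3)]
  by auto

lemma prof_measurable:
  assumes "prof p c d w w1 w2"
  shows "set_borel_measurable lborel {c<..<d} w" "set_borel_measurable lborel {c<..<d} w2"
  using set_borel_measurable_cont[OF prof_continuous(1)[OF assms]] profD(2)[OF assms] by (auto simp: Lp_def)

lemma en_density_measurable:
  assumes "prof p c d w w1 w2"
  shows "(\<lambda>x. ennreal ((w x ^ 2 - 1) ^ 2 + (w2 x) ^ 2) * indicator {c<..<d} x) \<in> borel_measurable lborel"
  by (rule measurable_density2[OF prof_measurable[OF assms], of "\<lambda>x y. (x^2-1)^2 + y^2"]) measurable

lemma dist_density_measurable:
  assumes "prof p c d w w1 w2"
  shows "(\<lambda>x. ennreal (\<bar>w x - t\<bar> powr p) * indicator {c<..<d} x) \<in> borel_measurable lborel"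
  by (rule measurable_density1[OF prof_measurable(1)[OF assms], of "\<lambda>x. \<bar>x - t\<bar> powr p"]) measurable

lemma en_split: "prof p c d w w1 w2 \<Longrightarrow> c \<le> m \<Longrightarrow> m \<le> d \<Longrightarrow> en c d w w2 = en c m w w2 + en m d w w2"
  unfolding en_def by (rule nn_interval_split[OF en_density_measurable])

lemma en_mono: "c' \<le> c \<Longrightarrow> d \<le> d' \<Longrightarrow> en c d w w2 \<le> en c' d' w w2"
  unfolding en_def by (rule nn_interval_mono) auto

lemma en_cong: "(\<And>x. c < x \<Longrightarrow> x < d \<Longrightarrow> w x = v x \<and> w2 x = v2 x) \<Longrightarrow> en c d w w2 = en c d v v2"
  unfolding en_def by (rule nn_integral_cong) (auto simp: indicator_def)

lemma en_reflect: "prof p c d w w1 w2 \<Longrightarrow> en (-d) (-c) (\<lambda>x. w (-x)) (\<lambda>x. w2 (-x)) = en c d w w2"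
  unfolding en_def by (rule nn_interval_reflect[OF en_density_measurable])

lemma en_sign: "s^2 = 1 \<Longrightarrow> en c d (\<lambda>x. s * w x) (\<lambda>x. s * w2 x) = en c d w w2"
  unfolding en_def by (simp add: power_mult_distrib)

lemma en_const: "s^2 = 1 \<Longrightarrow> en c d (\<lambda>x. s) (\<lambda>x. 0) = 0"
  unfolding en_def by simp

lemma en_shift:
  assumes "prof p (c+k) (d+k) w w1 w2"
  shows "en c d (\<lambda>x. w (x+k)) (\<lambda>x. w2 (x+k)) = en (c+k) (d+k) w w2"
  unfolding en_def
  using nn_interval_affine[of "\<lambda>x. ennreal ((w x ^ 2 - 1) ^ 2 + (w2 x) ^ 2)" 1 c k d] en_density_measurable[OF assms]
  by simp

lemma en_join:
  assumes "prof p c m w w1 w2" "prof p m d v v1 v2" "w m = v m" "w1 m = v1 m"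
  shows "en c d (\<lambda>x. if x \<le> m then w x else v x) (\<lambda>x. if x \<le> m then w2 x else v2 x) = en c m w w2 + en m d v v2"
  using en_split[OF prof_join[OF assms], of m] profD(1)[OF assms(1)] profD(1)[OF assms(2)]
   en_cong[of c m w "\<lambda>x. if x \<le> m then w x else v x" w2 "\<lambda>x. if x \<le> m then w2 x else v2 x"]
   en_cong[of m d v "\<lambda>x. if x \<le> m then w x else v x" v2 "\<lambda>x. if x \<le> m then w2 x else v2 x"] by simp

section \<open>Passage between \<open>W2rep\<close> and \<open>prof\<close>: endpoint limits and
  endpoint values\<close>

lemma continuous_on_Icc_limits:
  assumes "continuous_on {c..d} f" "c < (d::real)"
  shows "(f \<longlongrightarrow> f c) (at_right c)" "(f \<longlongrightarrow> f d) (at_left d)"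
proof -
  have "(f \<longlongrightarrow> f c) (at c within {c..d})" "(f \<longlongrightarrow> f d) (at d within {c..d})" using assms unfolding continuous_on by auto
  then show "(f \<longlongrightarrow> f c) (at_right c)" "(f \<longlongrightarrow> f d) (at_left d)"
   using assms(2) by (simp_all add: at_within_Icc_at_right at_within_Icc_at_left)
qed

lemma W2rep_of_prof:
  assumes "prof p c d w w1 w2" "p \<ge> 1"
  shows "W2rep p c d w w w1 w2"
    "(w \<longlongrightarrow> w c) (at_right c)" "(w \<longlongrightarrow> w d) (at_left d)"
    "(w1 \<longlongrightarrow> w1 c) (at_right c)" "(w1 \<longlongrightarrow> w1 d) (at_left d)"
proof -
  note c = prof_continuous[OF assms(1)] profD(1)[OF assms(1)]
  show "(w \<longlongrightarrow> w c) (at_right c)" "(w \<longlongrightarrow> w d) (at_left d)"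
    "(w1 \<longlongrightarrow> w1 c) (at_right c)" "(w1 \<longlongrightarrow> w1 d) (at_left d)"
    using continuous_on_Icc_limits c by blast+
  have "(w has_real_derivative w1 x) (at x)" if "x \<in> {c<..<d}" for x
    using prof_deriv[OF assms(1), of x] that by (simp add: at_within_Icc_at)
  then show "W2rep p c d w w w1 w2" unfolding W2rep_def
    using c assms(2) profD[OF assms(1)] by (auto intro!: Lp_cont)
qed

lemma Lp_integrable:
  assumes "Lp p c d f" "p \<ge> 1"
  shows "integrable lborel (\<lambda>x. indicator {c<..<d} x * f x)"
proof -
  note [measurable] = Lp_density[OF assms(1)]
  have m: "(\<lambda>x. indicator {c<..<d} x * f x) \<in> borel_measurable lborel"
    using assms(1) by (simp add: Lp_def set_borel_measurable_def)
  \<comment> \<open>On a bounded interval this elementary inequality gives the inclusion of L^p in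
    L^1.\<close>
  have le: "x \<le> 1 + x powr p" if "x \<ge> 0" for x :: real
    using that powr_mono[OF assms(2), of x] by (cases "x \<le> 1") (auto intro: add_increasing2)
  have "(\<integral>\<^sup>+ x. ennreal (norm (indicator {c<..<d} x * f x)) \<partial>lborel) \<le>
     (\<integral>\<^sup>+ x. 1 * indicator {c<..<d} x + ennreal (\<bar>f x\<bar> powr p) * indicator {c<..<d} x \<partial>lborel)"
  proof (rule nn_integral_mono)
    fix x
    have "ennreal \<bar>f x\<bar> \<le> 1 + ennreal (\<bar>f x\<bar> powr p)"
      using le[of "\<bar>f x\<bar>"] by (metis abs_ge_zero ennreal_1 ennreal_leI ennreal_plus powr_ge_zero zero_le_one)
    then show "ennreal (norm (indicator {c<..<d} x * f x)) \<le> 1 * indicator {c<..<d} x + ennreal (\<bar>f x\<bar> powr p) * indicator {c<..<d} x"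
      by (auto simp: indicator_def)
  qed
  also have "\<dots> = emeasure lborel {c<..<d} + (\<integral>\<^sup>+ x\<in>{c<..<d}. ennreal (\<bar>f x\<bar> powr p) \<partial>lborel)"
    by (subst nn_integral_add) auto
  also have "\<dots> < \<infinity>" using assms(1) by (cases "c \<le> d") (auto simp: Lp_def)
  finally show ?thesis
    using m by (simp add: integrable_iff_bounded)
qed

lemma Lp_absolutely_integrable:
  assumes "Lp p c d f" "p \<ge> 1"
  shows "f absolutely_integrable_on {c..d}"
proof -
  have "set_integrable lebesgue {c<..<d} f"
    unfolding set_integrable_def using Lp_integrable[OF assms] by (simp add: integrable_completion)
  then show ?thesis
    by (rule absolutely_integrable_spike_set) (rule negligible_subset[of "{c,d}"], auto)+
qed

text \<open>Links the gauge integral used for increments in \<open>W2rep\<close> and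
  \<open>prof\<close> with the Lebesgue integral used for energies. Membership in L^p makes the
  integrand Lebesgue integrable, so the two integrals agree by uniqueness.\<close>

lemma Lp_integral_bound:
  assumes "Lp p c d f" "p \<ge> 1" "(f has_integral I) {c..d}"
  shows "ennreal \<bar>I\<bar> \<le> (\<integral>\<^sup>+ x\<in>{c<..<d}. ennreal \<bar>f x\<bar> \<partial>lborel)"
proof -
  let ?g = "\<lambda>x. indicator {c<..<d} x * f x"
  have "(?g has_integral (integral\<^sup>L lborel ?g)) UNIV"
    by (rule has_integral_integral_lborel[OF Lp_integrable[OF assms(1,2)]])
  moreover have "?g = (\<lambda>x. if x \<in> {c<..<d} then f x else 0)" by (auto simp: indicator_def)
  ultimately have "(f has_integral (integral\<^sup>L lborel ?g)) {c<..<d}"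
    by (simp only: has_integral_restrict_UNIV)
  then have "(f has_integral (integral\<^sup>L lborel ?g)) {c..d}"
    by (simp add: has_integral_Icc_iff_Ioo)
  then have "I = integral\<^sup>L lborel ?g" using assms(3) has_integral_unique by blast
  then have "ennreal \<bar>I\<bar> \<le> (\<integral>\<^sup>+ x. ennreal (norm (?g x)) \<partial>lborel)"
    using integral_norm_bound_ennreal[OF Lp_integrable[OF assms(1,2)]] by simp
  also have "\<dots> = (\<integral>\<^sup>+ x\<in>{c<..<d}. ennreal \<bar>f x\<bar> \<partial>lborel)"
    by (rule nn_integral_cong) (auto simp: indicator_def)
  finally show ?thesis .
qed

text \<open>\<open>W2rep\<close> speaks of the open interval only. Integrating \<open>ddv\<close>
  twice from the left end gives functions on the closed interval; the constants are fixed so that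
  they agree with \<open>dv\<close> and \<open>v\<close> at the midpoint, and uniqueness of
  integrals carries the agreement to the whole open interval.\<close>

lemma prof_of_W2rep:
  assumes W: "W2rep p c d u v dv ddv" and "p \<ge> 1" "c < d"
  obtains w w1 where "prof p c d w w1 ddv" "\<And>x. x \<in> {c<..<d} \<Longrightarrow> w x = v x"
    "\<And>x. x \<in> {c<..<d} \<Longrightarrow> w1 x = dv x"
proof -
  let ?m = "(c+d)/2"
  have m: "?m \<in> {c<..<d}" using assms(3) by auto
  have L: "Lp p c d ddv" and D: "\<And>x. x\<in>{c<..<d} \<Longrightarrow> (v has_real_derivative dv x) (at x)"
    and I: "\<And>x y. x\<in>{c<..<d} \<Longrightarrow> y\<in>{c<..<d} \<Longrightarrow> x \<le> y \<Longrightarrow> (ddv has_integral (dv y - dv x)) {x..y}"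
    using W unfolding W2rep_def by auto
  have int: "ddv integrable_on {c..d}"
    using Lp_absolutely_integrable[OF L assms(2)] set_lebesgue_integral_eq_integral(1) by blast
  define w1 where "w1 x = dv ?m - integral {c..?m} ddv + integral {c..x} ddv" for x
  have w1: "(ddv has_integral (w1 y - w1 x)) {x..y}" if "c \<le> x" "x \<le> y" "y \<le> d" for x y
  proof -
    have "integral {c..x} ddv + integral {x..y} ddv = integral {c..y} ddv"
      by (rule Henstock_Kurzweil_Integration.integral_combine) (use that int in \<open>auto intro: integrable_subinterval_real\<close>)
    moreover have "(ddv has_integral integral {x..y} ddv) {x..y}"
      by (rule integrable_integral) (use that int in \<open>auto intro: integrable_subinterval_real\<close>)
    ultimately show ?thesis unfolding w1_def by (metis add_diff_add add_diff_cancel_left' diff_self add_0)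
  qed
  have w1_eq: "w1 x = dv x" if "x \<in> {c<..<d}" for x
  proof -
    have wm: "w1 ?m = dv ?m" by (simp add: w1_def)
    show ?thesis
    proof (cases "x \<le> ?m")
      case True
      then show ?thesis using has_integral_unique[OF w1[of x ?m] I[OF that m True]] that m wm by auto
    next
      case False
      then show ?thesis using has_integral_unique[OF w1[of ?m x] I[OF m that]] that m wm by auto
    qed
  qed
  have cw1: "continuous_on {c..d} w1" by (rule continuous_on_has_integral_increments[OF w1])
  have int1: "w1 integrable_on {c..d}" by (rule integrable_continuous_real[OF cw1])
  define w where "w x = v ?m - integral {c..?m} w1 + integral {c..x} w1" for x
  have w: "(w1 has_integral (w y - w x)) {x..y}" if "c \<le> x" "x \<le> y" "y \<le> d" for x y
  proof -
    have "integral {c..x} w1 + integral {x..y} w1 = integral {c..y} w1"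
      by (rule Henstock_Kurzweil_Integration.integral_combine) (use that int1 in \<open>auto intro: integrable_subinterval_real\<close>)
    moreover have "(w1 has_integral integral {x..y} w1) {x..y}"
      by (rule integrable_integral) (use that int1 in \<open>auto intro: integrable_subinterval_real\<close>)
    ultimately show ?thesis unfolding w_def by (metis add_diff_add add_diff_cancel_left' diff_self add_0)
  qed
  have V: "(w1 has_integral (v y - v x)) {x..y}" if "x\<in>{c<..<d}" "y\<in>{c<..<d}" "x \<le> y" for x y
  proof (rule has_integral_eq)
    show "(dv has_integral (v y - v x)) {x..y}"
    proof (rule fundamental_theorem_of_calculus[OF that(3)])
      fix z assume "z \<in> {x..y}"
      then have "z \<in> {c<..<d}" using that by auto
      from D[OF this] show "(v has_vector_derivative dv z) (at z within {x..y})"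
        by (metis has_field_derivative_at_within has_real_derivative_iff_has_vector_derivative)
    qed
  qed (use w1_eq that in auto)
  have w_eq: "w x = v x" if "x \<in> {c<..<d}" for x
  proof -
    have wm: "w ?m = v ?m" by (simp add: w_def)
    show ?thesis
    proof (cases "x \<le> ?m")
      case True
      then show ?thesis using has_integral_unique[OF w[of x ?m] V[OF that m True]] that m wm by auto
    next
      case False
      then show ?thesis using has_integral_unique[OF w[of ?m x] V[OF m that]] that m wm by auto
    qed
  qed
  show ?thesis
    by (rule that[of w w1]) (use w w1 w_eq w1_eq L assms(3) in \<open>auto simp: prof_def\<close>)
qed

subsection \<open>Scaling and the optimal transition costs\<close>

lemma scaling_lower_bound:
  fixes A B l :: real
  assumes "A \<ge> 0" "B \<ge> 0" "l > 0"
  shows "4 / 3 powr (3/4) * (A powr (3/4) * B powr (1/4)) \<le> l * A + B / l^3"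
proof (cases "A = 0 \<or> B = 0")
  case True
  then show ?thesis using assms by auto
next
  case False
  then have AB: "A > 0" "B > 0" using assms by auto
  \<comment> \<open>Weighted AM-GM with weights 3/4 and 1/4. The arguments are chosen so that the
    weighted sum is l A + B/l^3 while the powers of l cancel in the product.\<close>
  have "(4*l*A/3) powr (3/4) * (4*B/l^3) powr (1/4) \<le> (3/4)*(4*l*A/3) + (1/4)*(4*B/l^3)"
    using AB assms by (intro Youngs_inequality_0) auto
  moreover have "(4*l*A/3) powr (3/4) * (4*B/l^3) powr (1/4) = 4 / 3 powr (3/4) * (A powr (3/4) * B powr (1/4))"
  proof -
    have "(l^3) powr (1/4) = l powr (3/4)" using assms(3)
      by (simp add: powr_powr flip: powr_numeral)
    moreover have "4 powr (3/4) * 4 powr (1/4) = (4::real)" by (simp flip: powr_add)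
    ultimately show ?thesis using AB assms by (simp add: powr_divide powr_mult field_simps)
  qed
  ultimately show ?thesis using assms by (simp add: algebra_simps)
qed

text \<open>Equality in the preceding bound holds at l^4 = 3B/A. If A or B vanishes, the infimum is
  0 and in general only approached, as l tends to infinity or to 0; this is why a slack \<delta> is
  allowed.\<close>

lemma scaling_optimal:
  fixes A B \<delta> :: real
  assumes "A \<ge> 0" "B \<ge> 0" "\<delta> > 0"
  shows "\<exists>l>0. l * A + B / l^3 \<le> 4 / 3 powr (3/4) * (A powr (3/4) * B powr (1/4)) + \<delta>"
proof -
  consider "A = 0" | "A > 0" "B = 0" | "A > 0" "B > 0" using assms by linarith
  then show ?thesis
  proof cases
    case 1
    \<comment> \<open>l \<ge> 1 gives l \<le> l^3, so B \<le> \<delta> l already yields B/l^3 \<le>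
      \<delta>.\<close>
    define l where "l = max 1 (B/\<delta>)"
    have l: "l \<ge> 1" "B \<le> \<delta> * l" using assms by (auto simp: l_def max_def field_simps)
    have "l * 1 \<le> l * l^2" using l by (intro mult_left_mono) auto
    then have "l \<le> l^3" by (simp add: power3_eq_cube power2_eq_square)
    then have "\<delta> * l \<le> \<delta> * l^3" using assms by (intro mult_left_mono) auto
    then have "B \<le> \<delta> * l^3" using l by linarith
    then have "B / l^3 \<le> \<delta>" using l by (simp add: pos_divide_le_eq)
    then show ?thesis using 1 l by (intro exI[of _ l]) auto
  next
    case 2
    then show ?thesis using assms by (intro exI[of _ "\<delta>/A"]) auto
  next
    case 3
    define l where "l = (3*B/A) powr (1/4)"
    have l: "l > 0" using 3 by (simp add: l_def)
    have "l * A = 3 powr (1/4) * B powr (1/4) * (A / A powr (1/4))"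
      using 3 by (simp add: l_def powr_divide powr_mult)
    also have "A / A powr (1/4) = A powr (3/4)" using 3 powr_diff[of A 1 "1/4"] by simp
    finally have 1: "l * A = 3 powr (1/4) * (A powr (3/4) * B powr (1/4))" by simp
    have "l^3 = (3*B/A) powr (3/4)" using 3 by (simp add: l_def powr_powr flip: powr_numeral)
    then have "B / l^3 = (B / B powr (3/4)) * A powr (3/4) / 3 powr (3/4)"
      using 3 by (simp add: powr_divide powr_mult)
    also have "B / B powr (3/4) = B powr (1/4)" using 3 powr_diff[of B 1 "3/4"] by simp
    finally have 2: "B / l^3 = 1 / 3 powr (3/4) * (A powr (3/4) * B powr (1/4))" by simp
    have "3 powr (1/4) * 3 powr (3/4) = (3::real)" by (simp flip: powr_add)
    then have "3 powr (1/4) + 1 / 3 powr (3/4) = 4 / (3::real) powr (3/4)" by (simp add: field_simps)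
    then have "l * A + B / l^3 = 4 / 3 powr (3/4) * (A powr (3/4) * B powr (1/4))"
      unfolding 1 2 distrib_right[symmetric] by simp
    then show ?thesis using l assms by (intro exI[of _ l]) auto
  qed
qed

section \<open>Potential and bending energy under dilation\<close>

definition potE :: "real \<Rightarrow> real \<Rightarrow> (real \<Rightarrow> real) \<Rightarrow> ennreal" where
  "potE c d w = (\<integral>\<^sup>+ x\<in>{c<..<d}. ennreal ((w x ^ 2 - 1) ^ 2) \<partial>lborel)"

definition bendE :: "real \<Rightarrow> real \<Rightarrow> (real \<Rightarrow> real) \<Rightarrow> ennreal" where
  "bendE c d w2 = (\<integral>\<^sup>+ x\<in>{c<..<d}. ennreal ((w2 x) ^ 2) \<partial>lborel)"

lemma potE_measurable:
  "prof p c d w w1 w2 \<Longrightarrow> (\<lambda>x. ennreal ((w x ^ 2 - 1) ^ 2) * indicator {c<..<d} x) \<in> borel_measurable lborel"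
  by (rule measurable_density1[OF prof_measurable(1), of _ _ _ _ _ _ "\<lambda>x. (x^2-1)^2"]) measurable

lemma bendE_measurable:
  "prof p c d w w1 w2 \<Longrightarrow> (\<lambda>x. ennreal ((w2 x) ^ 2) * indicator {c<..<d} x) \<in> borel_measurable lborel"
  by (rule measurable_density1[OF prof_measurable(2), of _ _ _ _ _ _ "\<lambda>x. x^2"]) measurable

lemma en_eq:
  assumes "prof p c d w w1 w2"
  shows "en c d w w2 = potE c d w + bendE c d w2"
proof -
  note [measurable] = potE_measurable[OF assms] bendE_measurable[OF assms]
  show ?thesis unfolding en_def potE_def bendE_def
    by (subst nn_integral_add[symmetric]) (auto simp: distrib_right)
qed

lemma potE_affine:
  assumes "prof p (m*c+k) (m*d+k) w w1 w2" "m > 0"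
  shows "potE (m*c+k) (m*d+k) w = ennreal m * potE c d (\<lambda>x. w (m*x+k))"
  unfolding potE_def by (rule nn_interval_affine[OF potE_measurable[OF assms(1)] assms(2)])

text \<open>Four factors m come from the squared second derivative and one is lost to the length
  element, hence m^3.\<close>

lemma bendE_affine:
  assumes "prof p (m*c+k) (m*d+k) w w1 w2" "m > 0"
  shows "bendE c d (\<lambda>x. m^2 * w2 (m*x+k)) = ennreal (m^3) * bendE (m*c+k) (m*d+k) w2"
proof -
  have m: "m^2 > 0" using assms by simp
  note [measurable] = bendE_measurable[OF prof_affine[OF assms]]
  have mm: "ennreal ((w2 (m*x+k))^2) = ennreal (1/m^4) * ennreal ((m^2 * w2 (m*x+k))^2)" for x
    using assms(2) by (subst ennreal_mult[symmetric]) (auto simp: power_mult_distrib)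
  have "bendE (m*c+k) (m*d+k) w2 = ennreal m * bendE c d (\<lambda>x. w2 (m*x+k))"
    unfolding bendE_def by (rule nn_interval_affine[OF bendE_measurable[OF assms(1)] assms(2)])
  also have "bendE c d (\<lambda>x. w2 (m*x+k)) = ennreal (1/m^4) * bendE c d (\<lambda>x. m^2 * w2 (m*x+k))"
    unfolding bendE_def mm mult.assoc by (rule nn_integral_cmult) measurable
  finally have "bendE (m*c+k) (m*d+k) w2 = ennreal (m * (1/m^4)) * bendE c d (\<lambda>x. m^2 * w2 (m*x+k))"
    using assms(2) by (subst ennreal_mult) (auto simp: mult.assoc)
  then have "ennreal (m^3) * bendE (m*c+k) (m*d+k) w2 = ennreal (m^3 * (m * (1/m^4))) * bendE c d (\<lambda>x. m^2 * w2 (m*x+k))"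
    using assms(2) by (subst ennreal_mult) (auto simp: mult.assoc)
  also have "m^3 * (m * (1/m^4)) = 1" using assms(2) by (simp add: power_numeral_reduce)
  finally show ?thesis by simp
qed

lemma Phi_cong:
  assumes "\<And>x. x \<in> {0<..<1} \<Longrightarrow> w x = v x"
  shows "Phi w w2 = Phi v w2"
proof -
  have "(\<integral>\<^sup>+ y\<in>{0<..<1}. ennreal ((w y ^ 2 - 1) ^ 2) \<partial>lborel) = (\<integral>\<^sup>+ y\<in>{0<..<1}. ennreal ((v y ^ 2 - 1) ^ 2) \<partial>lborel)"
    using assms by (intro nn_integral_cong) (auto simp: indicator_def)
  then show ?thesis unfolding Phi_def by simp
qed

lemma Phi_potE_bendE: "Phi w w2 = (if potE 0 1 w = \<infinity> \<or> bendE 0 1 w2 = \<infinity> then \<infinity>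
   else ereal (enn2real (potE 0 1 w) powr (3/4) * enn2real (bendE 0 1 w2) powr (1/4)))"
  by (simp add: Phi_def potE_def bendE_def Let_def)

text \<open>\<open>Q\<close> prescribes the values and slopes at both ends. Slopes are only ever required to vanish,
  which makes \<open>Q\<close> invariant under dilations.\<close>

definition optimal_energy :: "real \<Rightarrow> (real \<Rightarrow> real \<Rightarrow> real \<Rightarrow> real \<Rightarrow> bool) \<Rightarrow> real \<Rightarrow> bool" where
  "optimal_energy p Q K \<longleftrightarrow> K \<ge> 0 \<and>
    (\<forall>c d w w1 w2. prof p c d w w1 w2 \<longrightarrow> Q (w c) (w1 c) (w d) (w1 d) \<longrightarrow> ennreal K \<le> en c d w w2) \<and>
    (\<forall>\<delta>>0. \<exists>L w w1 w2. prof p 0 L w w1 w2 \<and> Q (w 0) (w1 0) (w L) (w1 L) \<and> en 0 L w w2 \<le> ennreal (K + \<delta>))"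

lemma optimal_energyD:
  assumes "optimal_energy p Q K"
  shows "K \<ge> 0" "prof p c d w w1 w2 \<Longrightarrow> Q (w c) (w1 c) (w d) (w1 d) \<Longrightarrow> ennreal K \<le> en c d w w2"
    "\<delta> > 0 \<Longrightarrow> \<exists>L w w1 w2. prof p 0 L w w1 w2 \<and> Q (w 0) (w1 0) (w L) (w1 L) \<and> en 0 L w w2 \<le> ennreal (K + \<delta>)"
  using assms unfolding optimal_energy_def by blast+

text \<open>Stretched to length l, a profile on the unit interval with potential integral A and
  bending integral B has energy l A + B/l^3; the infimum of this over l is \<open>Phi\<close> times
  4/3^(3/4). So the scaled infimum of \<open>Phi\<close> is the least energy over intervals of all
  lengths. The competitor \<open>v\<close> of finite energy makes the infimum a real number.\<close>

lemma optimal_cost: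
  fixes Q :: "real \<Rightarrow> real \<Rightarrow> real \<Rightarrow> real \<Rightarrow> bool"
  assumes inv: "\<And>x0 d0 x1 d1 m. m > 0 \<Longrightarrow> Q x0 d0 x1 d1 \<Longrightarrow> Q x0 (m*d0) x1 (m*d1)"
    and ne: "prof p 0 1 v v1 v2" "Q (v 0) (v1 0) (v 1) (v1 1)" "en 0 1 v v2 < \<infinity>"
  obtains K where "optimal_energy p Q K"
    "ereal (4 / 3 powr (3/4)) * Inf {Phi w w2 | w w1 w2. prof p 0 1 w w1 w2 \<and> Q (w 0) (w1 0) (w 1) (w1 1)} = ereal K"
proof -
  define cst where "cst = 4 / 3 powr (3/4 :: real)"
  have cst: "cst > 0" by (simp add: cst_def)
  define S where "S = {Phi w w2 | w w1 w2. prof p 0 1 w w1 w2 \<and> Q (w 0) (w1 0) (w 1) (w1 1)}"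
  have nonneg: "s \<ge> 0" if "s \<in> S" for s
    using that by (auto simp: S_def Phi_potE_bendE)
  then have "Inf S \<ge> 0" by (intro Inf_greatest)
  moreover have "Phi v v2 \<in> S" using ne by (auto simp: S_def)
  then have "Inf S \<le> Phi v v2" by (rule Inf_lower)
  moreover have "Phi v v2 < \<infinity>" using ne(3) unfolding en_eq[OF ne(1)] by (auto simp: Phi_potE_bendE)
  ultimately obtain i where i: "Inf S = ereal i" "i \<ge> 0"
    by (cases "Inf S") auto
  have "optimal_energy p Q (cst * i)"
    unfolding optimal_energy_def
  proof (intro conjI allI impI)
    show "0 \<le> cst * i" using cst i by simp
  next
    fix c d w w1 w2
    assume P: "prof p c d w w1 w2" and Qw: "Q (w c) (w1 c) (w d) (w1 d)"
    show "ennreal (cst * i) \<le> en c d w w2"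
    proof (cases "en c d w w2 = \<infinity>")
      case False
      \<comment> \<open>Here A and B belong to the given interval of length l; the pullback to the
        unit interval has potential integral A/l and bending integral l^3 B.\<close>
      define l where "l = d - c"
      have l: "l > 0" using profD(1)[OF P] by (simp add: l_def)
      have P': "prof p (l*0+c) (l*1+c) w w1 w2" using P by (simp add: l_def)
      have "potE c d w < \<infinity>" "bendE c d w2 < \<infinity>" using False unfolding en_eq[OF P] by (auto simp: less_top)
      then obtain A B where A: "potE c d w = ennreal A" "A \<ge> 0" and B: "bendE c d w2 = ennreal B" "B \<ge> 0"
        by (metis ennreal_cases infinity_ennreal_def less_irrefl)
      have "ennreal A = ennreal l * potE 0 1 (\<lambda>x. w (l*x+c))"
        using potE_affine[OF P' l] by (simp add: A l_def)
      then have "ennreal (1/l) * ennreal A = ennreal (1/l * l) * potE 0 1 (\<lambda>x. w (l*x+c))"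
        using l by (subst ennreal_mult) (auto simp: mult.assoc)
      then have A': "potE 0 1 (\<lambda>x. w (l*x+c)) = ennreal (A/l)"
        using l A(2) by (simp add: ennreal_mult[symmetric])
      have B': "bendE 0 1 (\<lambda>x. l^2 * w2 (l*x+c)) = ennreal (l^3*B)"
        using bendE_affine[OF P' l] l B by (simp add: l_def ennreal_mult)
      have "Phi (\<lambda>x. w (l*x+c)) (\<lambda>x. l^2 * w2 (l*x+c)) \<in> S"
        unfolding S_def
        by (insert prof_affine[OF P' l] inv[OF l Qw], rule CollectI, rule exI[of _ "\<lambda>x. w (l*x+c)"], rule exI[of _ "\<lambda>x. l * w1 (l*x+c)"],
           rule exI[of _ "\<lambda>x. l^2 * w2 (l*x+c)"]) (auto simp: l_def)
      then have "ereal i \<le> Phi (\<lambda>x. w (l*x+c)) (\<lambda>x. l^2 * w2 (l*x+c))"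
        unfolding i(1)[symmetric] by (rule Inf_lower)
      then have "i \<le> (A/l) powr (3/4) * (l^3*B) powr (1/4)"
        using A B l by (simp add: Phi_potE_bendE A' B')
      then have "cst * i \<le> cst * ((A/l) powr (3/4) * (l^3*B) powr (1/4))"
        using cst by simp
      also have "\<dots> \<le> l * (A/l) + (l^3*B)/l^3"
        unfolding cst_def using A B l by (intro scaling_lower_bound) auto
      also have "\<dots> = A + B" using l by simp
      finally show ?thesis unfolding en_eq[OF P] A B using A B by (metis ennreal_leI ennreal_plus)
    qed simp
  next
    fix \<delta> :: real assume \<delta>: "\<delta> > 0"
    \<comment> \<open>Half of \<delta> pays for a nearly optimal profile, the other half for a
      nearly optimal length.\<close>
    have "Inf S < ereal (i + \<delta>/(2*cst))" using i cst \<delta> by simp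
    then obtain s where s: "s \<in> S" "s < ereal (i + \<delta>/(2*cst))" by (auto simp: Inf_less_iff)
    then obtain w w1 w2 where P: "prof p 0 1 w w1 w2" and Qw: "Q (w 0) (w1 0) (w 1) (w1 1)" and
      lt: "Phi w w2 < ereal (i + \<delta>/(2*cst))" by (auto simp: S_def)
    then have "potE 0 1 w \<noteq> \<infinity>" "bendE 0 1 w2 \<noteq> \<infinity>" by (auto simp: Phi_potE_bendE split: if_splits)
    then obtain A B where A: "potE 0 1 w = ennreal A" "A \<ge> 0" and B: "bendE 0 1 w2 = ennreal B" "B \<ge> 0"
        by (metis ennreal_cases infinity_ennreal_def)
    have "A powr (3/4) * B powr (1/4) < i + \<delta>/(2*cst)" using lt A B by (simp add: Phi_potE_bendE)
    then have le: "cst * (A powr (3/4) * B powr (1/4)) \<le> cst * i + \<delta>/2"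
      using cst by (simp add: field_simps)
    obtain l where l: "l > 0" "l * A + B / l^3 \<le> cst * (A powr (3/4) * B powr (1/4)) + \<delta>/2"
      using scaling_optimal[of A B "\<delta>/2"] A B \<delta> unfolding cst_def by auto
    let ?m = "1/l"
    have m: "?m > 0" using l by simp
    have P': "prof p (?m*0+0) (?m*l+0) w w1 w2" using P l by simp
    note P'' = prof_affine[OF P' m]
    have "ennreal l * potE 0 1 w = ennreal (l * ?m) * potE 0 l (\<lambda>x. w (?m*x+0))"
      using potE_affine[OF P' m] l by (subst ennreal_mult) (auto simp: mult.assoc)
    then have A': "potE 0 l (\<lambda>x. w (?m*x+0)) = ennreal (l*A)"
      using l A by (simp add: ennreal_mult)
    have B': "bendE 0 l (\<lambda>x. ?m^2 * w2 (?m*x+0)) = ennreal (?m^3*B)"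
      using bendE_affine[OF P' m] B l by (simp add: ennreal_mult)
    have "en 0 l (\<lambda>x. w (?m*x+0)) (\<lambda>x. ?m^2 * w2 (?m*x+0)) = ennreal (l*A + B/l^3)"
      unfolding en_eq[OF P''] A' B' using A B l by (simp add: power_divide flip: ennreal_plus)
    also have "\<dots> \<le> ennreal (cst * i + \<delta>)" using l le by (intro ennreal_leI) linarith
    finally have fin: "en 0 l (\<lambda>x. w (?m*x+0)) (\<lambda>x. ?m^2 * w2 (?m*x+0)) \<le> ennreal (cst * i + \<delta>)" .
    show "\<exists>L w w1 w2. prof p 0 L w w1 w2 \<and> Q (w 0) (w1 0) (w L) (w1 L) \<and> en 0 L w w2 \<le> ennreal (cst * i + \<delta>)"
      by (insert fin P'' inv[OF m Qw] l, rule exI[of _ l], rule exI[of _ "\<lambda>x. w (?m*x+0)"], rule exI[of _ "\<lambda>x. ?m * w1 (?m*x+0)"],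
          rule exI[of _ "\<lambda>x. ?m^2 * w2 (?m*x+0)"]) auto
  qed
  moreover have "ereal (4 / 3 powr (3/4)) * Inf {Phi w w2 | w w1 w2. prof p 0 1 w w1 w2 \<and> Q (w 0) (w1 0) (w 1) (w1 1)} = ereal (cst * i)"
    using i(1) unfolding S_def[symmetric] by (simp add: cst_def)
  ultimately show ?thesis by (rule that)
qed

subsection \<open>Perturbation of boundary data\<close>

declare ennreal_plus [simp del]

lemma nn_integral_linear_combination:
  fixes F :: "real \<Rightarrow> ennreal"
  assumes "F \<in> borel_measurable lborel" "c \<le> d"
  shows "(\<integral>\<^sup>+ x. \<alpha> * F x + \<beta> * indicator {c<..<d} x \<partial>lborel) = \<alpha> * (\<integral>\<^sup>+ x. F x \<partial>lborel) + \<beta> * ennreal (d - c)"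
  using assms by (subst nn_integral_add) (auto simp: nn_integral_cmult nn_integral_cmult_indicator)

text \<open>Sharp constants require the coefficient of x^2 to stay close to 1; the price is the
  large factor 1 + 1/\<eta> on the small term y.\<close>

lemma square_add_le:
  fixes x y \<eta> :: real
  assumes "\<eta> > 0"
  shows "(x + y)^2 \<le> (1 + \<eta>) * x^2 + (1 + 1/\<eta>) * y^2"
proof -
  have "0 \<le> (\<eta> * x - y)^2 / \<eta>" using assms by simp
  also have "(\<eta> * x - y)^2 / \<eta> = \<eta> * x^2 - 2*x*y + y^2/\<eta>"
    using assms by (simp add: power2_eq_square field_simps)
  finally show ?thesis by (simp add: power2_eq_square algebra_simps)
qed

lemma double_well_perturb:
  fixes w h \<eta> :: real
  assumes "0 < \<eta>" "\<eta> \<le> 1" "\<bar>h\<bar> \<le> \<eta>"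
  shows "((w + h)^2 - 1)^2 \<le> (1 + 9*\<eta>) * (w^2 - 1)^2 + 28*\<eta>"
proof -
  define X where "X = (w^2 - 1)^2"
  \<comment> \<open>\<open>w\<close> is unbounded, so terms with w^2 have to be absorbed into the
    well: (w^2 - 2)^2 \<ge> 0 says exactly 2 w^2 \<le> (w^2 - 1)^2 + 3.\<close>
  have "0 \<le> (w^2 - 2)^2" by simp
  then have w2: "2 * w^2 \<le> X + 3" unfolding X_def by (simp add: power2_eq_square algebra_simps)
  have h2: "h^2 \<le> \<eta>^2" using assms by (metis abs_le_square_iff abs_of_pos)
  have X0: "X \<ge> 0" by (simp add: X_def)
  have "(2*w*h + h^2)^2 = h^2 * (2*w + h)^2" by (simp add: power2_eq_square algebra_simps)
  also have "\<dots> \<le> \<eta>^2 * (2*w + h)^2" using h2 by (intro mult_right_mono) auto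
  also have "(2*w+h)^2 \<le> (1+1) * (2*w)^2 + (1+1/1) * h^2" by (rule square_add_le) simp
  also have "\<dots> = 8 * w^2 + 2*h^2" by (simp add: power_mult_distrib)
  also have "\<dots> \<le> 4 * X + 14"
  proof -
    have "\<eta>^2 \<le> 1" using assms by (simp add: power_le_one)
    then show ?thesis using w2 h2 by linarith
  qed
  finally have y: "(2*w*h + h^2)^2 \<le> \<eta>^2 * (4 * X + 14)" using assms by (simp add: mult_left_mono)
  have "((w + h)^2 - 1)^2 = ((w^2 - 1) + (2*w*h + h^2))^2" by (simp add: power2_eq_square algebra_simps)
  also have "\<dots> \<le> (1 + \<eta>) * X + (1 + 1/\<eta>) * (2*w*h + h^2)^2" unfolding X_def by (rule square_add_le) fact
  also have "(1 + 1/\<eta>) * (2*w*h + h^2)^2 \<le> (1 + 1/\<eta>) * (\<eta>^2 * (4*X + 14))"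
    using y assms by (intro mult_left_mono) auto
  also have "(1 + 1/\<eta>) * (\<eta>^2 * (4*X + 14)) = (\<eta>^2 + \<eta>) * (4*X + 14)"
    using assms by (simp add: field_simps power2_eq_square)
  also have "\<dots> \<le> (2*\<eta>) * (4*X + 14)"
    using assms X0 by (intro mult_right_mono) (auto simp: power2_eq_square mult_left_le)
  finally show ?thesis unfolding X_def[symmetric] by (simp add: algebra_simps)
qed

lemma square_perturb:
  fixes w k \<eta> :: real
  assumes "0 < \<eta>" "\<eta> \<le> 1" "\<bar>k\<bar> \<le> 2*\<eta>"
  shows "(w + k)^2 \<le> (1 + 9*\<eta>) * w^2 + 8*\<eta>"
proof -
  have "k^2 \<le> (2*\<eta>)^2" using assms by (metis abs_le_square_iff abs_of_pos mult_pos_pos zero_less_numeral)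
  then have "(1 + 1/\<eta>) * k^2 \<le> (1 + 1/\<eta>) * (4*\<eta>^2)" using assms by (intro mult_left_mono) (auto simp: power_mult_distrib)
  also have "(1 + 1/\<eta>) * (4*\<eta>^2) = 4 * \<eta>^2 + 4*\<eta>" using assms by (simp add: field_simps power2_eq_square)
  also have "\<dots> \<le> 8 * \<eta>" using assms by (simp add: power2_eq_square mult_left_le)
  finally have "(1 + 1/\<eta>) * k^2 \<le> 8 * \<eta>" .
  moreover have "(1 + \<eta>) * w^2 \<le> (1 + 9*\<eta>) * w^2" using assms by (intro mult_right_mono) auto
  ultimately show ?thesis using square_add_le[OF assms(1), of w k] by linarith
qed

text \<open>A cubic living on the last unit interval is added; it vanishes to first order at its
  left end, so it can be extended by zero. The additive error is thereby charged to an interval of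
  length 1, whatever the length of \<open>{c..d}\<close>.\<close>

lemma adjust_right:
  assumes P: "prof p c d w w1 w2" and "p \<ge> 1" and cd: "c + 1 < d" and \<eta>: "0 < \<eta>" "\<eta> \<le> 1"
    and \<delta>: "\<bar>\<delta>0\<bar> \<le> \<eta>/13" "\<bar>\<delta>1\<bar> \<le> \<eta>/13"
  obtains v v1 v2 where "prof p c d v v1 v2" "v c = w c" "v1 c = w1 c" "v d = w d + \<delta>0" "v1 d = w1 d + \<delta>1"
    "en c d v v2 \<le> ennreal (1 + 9*\<eta>) * en c d w w2 + ennreal (36*\<eta>)"
    "\<And>x. c \<le> x \<Longrightarrow> x \<le> d \<Longrightarrow> \<bar>v x - w x\<bar> \<le> \<eta>"
proof -
  \<comment> \<open>Hermite interpolation: A t^2 + B t^3 has value \<delta>0 and slope \<delta>1 at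
    t = 1.\<close>
  define A where "A = 3*\<delta>0 - \<delta>1"
  define B where "B = \<delta>1 - 2*\<delta>0"
  \<comment> \<open>The 13 is tuned to the second derivative: |2A| + |6B| \<le> (8 + 18) \<eta>/13 =
    2 \<eta>, as \<open>square_perturb\<close> requires.\<close>
  have AB: "\<bar>A\<bar> \<le> 4*\<eta>/13" "\<bar>B\<bar> \<le> 3*\<eta>/13" using \<delta> unfolding A_def B_def by linarith+
  let ?k = "1 - d"
  let ?h = "\<lambda>x. if x \<le> d-1 then 0 else A*(1*x+?k)^2 + B*(1*x+?k)^3"
  let ?h1 = "\<lambda>x. if x \<le> d-1 then 0 else 1*(2*A*(1*x+?k) + 3*B*(1*x+?k)^2)"
  let ?h2 = "\<lambda>x. if x \<le> d-1 then 0 else 1^2*(2*A + 6*B*(1*x+?k))"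
  have "prof p (1*(d-1)+?k) (1*d+?k) (\<lambda>x. A*x^2 + B*x^3) (\<lambda>x. 2*A*x + 3*B*x^2) (\<lambda>x. 2*A + 6*B*x)"
    using prof_cubic[of 0 1 p A B] assms(2) by simp
  from prof_affine[OF this]
  have Ph: "prof p c d ?h ?h1 ?h2"
    by (intro prof_join) (use cd assms(2) prof_const in auto)
  define h where "h = ?h"
  have h_def: "h x = (if x \<le> d-1 then 0 else A*(x+?k)^2 + B*(x+?k)^3)" for x by (simp add: h_def)
  note Pv = prof_add[OF P Ph[folded \<open>h = ?h\<close>] assms(2)]
  have hb: "\<bar>h x\<bar> \<le> \<eta>" if "x \<le> d" for x
  proof (cases "d - 1 < x")
    case True
    let ?t = "x + ?k"
    have t: "0 \<le> ?t" "?t \<le> 1" using True that by auto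
    have "\<bar>A*?t^2\<bar> \<le> \<bar>A\<bar>" "\<bar>B*?t^3\<bar> \<le> \<bar>B\<bar>" using t by (auto simp: abs_mult power_le_one mult_left_le)
    then show ?thesis using True AB by (auto simp: h_def)
  qed (use \<eta> in \<open>auto simp: h_def\<close>)
  have h2b: "\<bar>?h2 x\<bar> \<le> 2*\<eta>" if "x < d" for x
  proof (cases "d - 1 < x")
    case True
    let ?t = "x + ?k"
    have t: "0 \<le> ?t" "?t \<le> 1" using True that by auto
    have "\<bar>B*?t\<bar> \<le> \<bar>B\<bar>" using t by (auto simp: abs_mult mult_left_le)
    then show ?thesis using True AB by auto
  qed (use \<eta> in auto)
  have pt: "((w x + h x)^2 - 1)^2 + (w2 x + ?h2 x)^2 \<le>
     (1 + 9*\<eta>) * ((w x^2-1)^2 + (w2 x)^2) + 36*\<eta> * indicator {d-1<..<d} x" if "x < d" for x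
  proof (cases "d - 1 < x")
    case True
    then show ?thesis
      using double_well_perturb[OF \<eta> hb[OF less_imp_le[OF that]], of "w x"] square_perturb[OF \<eta> h2b[OF that], of "w2 x"] that
      by (simp add: distrib_left)
  next
    case False
    have "1 * ((w x^2-1)^2 + (w2 x)^2) \<le> (1 + 9*\<eta>) * ((w x^2-1)^2 + (w2 x)^2)"
      using \<eta> by (intro mult_right_mono) auto
    then show ?thesis using False by (simp add: h_def)
  qed
  note [measurable] = en_density_measurable[OF P]
  have "en c d (\<lambda>x. w x + h x) (\<lambda>x. w2 x + ?h2 x) \<le>
     (\<integral>\<^sup>+ x. ennreal (1 + 9*\<eta>) * (ennreal ((w x^2-1)^2 + (w2 x)^2) * indicator {c<..<d} x) + ennreal (36*\<eta>) * indicator {d-1<..<d} x \<partial>lborel)"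
    unfolding en_def
  proof (rule nn_integral_mono)
    fix x
    show "ennreal (((w x + h x)^2 - 1)^2 + (w2 x + ?h2 x)^2) * indicator {c<..<d} x
       \<le> ennreal (1 + 9*\<eta>) * (ennreal ((w x^2-1)^2 + (w2 x)^2) * indicator {c<..<d} x) + ennreal (36*\<eta>) * indicator {d-1<..<d} x"
    proof (cases "x \<in> {c<..<d}")
      case True
      then have "ennreal (((w x + h x)^2 - 1)^2 + (w2 x + ?h2 x)^2) \<le> ennreal ((1 + 9*\<eta>) * ((w x^2-1)^2 + (w2 x)^2) + 36*\<eta> * indicator {d-1<..<d} x)"
        using pt by (intro ennreal_leI) auto
      also have "\<dots> = ennreal (1 + 9*\<eta>) * ennreal ((w x^2-1)^2 + (w2 x)^2) + ennreal (36*\<eta>) * indicator {d-1<..<d} x"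
        using \<eta> by (subst ennreal_plus) (auto simp: ennreal_mult' indicator_def)
      finally show ?thesis using True by simp
    qed simp
  qed
  also have "\<dots> = ennreal (1 + 9*\<eta>) * en c d w w2 + ennreal (36*\<eta>)"
    unfolding en_def
    by (subst nn_integral_linear_combination[OF en_density_measurable[OF P]]) auto
  finally show ?thesis using Pv cd hb
    by (intro that[of "\<lambda>x. w x + h x" "\<lambda>x. w1 x + ?h1 x" "\<lambda>x. w2 x + ?h2 x"])
      (auto simp: h_def A_def B_def)
qed

text \<open>Reflection of \<open>adjust_right\<close>; slopes change sign, hence the
  \<open>-\<delta>1\<close> passed to it.\<close>

lemma adjust_left:
  assumes P: "prof p c d w w1 w2" and "p \<ge> 1" and cd: "c + 1 < d" and \<eta>: "0 < \<eta>" "\<eta> \<le> 1"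
    and \<delta>: "\<bar>\<delta>0\<bar> \<le> \<eta>/13" "\<bar>\<delta>1\<bar> \<le> \<eta>/13"
  obtains v v1 v2 where "prof p c d v v1 v2" "v d = w d" "v1 d = w1 d" "v c = w c + \<delta>0" "v1 c = w1 c + \<delta>1"
    "en c d v v2 \<le> ennreal (1 + 9*\<eta>) * en c d w w2 + ennreal (36*\<eta>)"
    "\<And>x. c \<le> x \<Longrightarrow> x \<le> d \<Longrightarrow> \<bar>v x - w x\<bar> \<le> \<eta>"
proof -
  obtain v v1 v2 where v: "prof p (-d) (-c) v v1 v2" "v (-d) = w d" "v1 (-d) = - w1 d"
      "v (-c) = w c + \<delta>0" "v1 (-c) = - w1 c + (-\<delta>1)"
    "en (-d) (-c) v v2 \<le> ennreal (1 + 9*\<eta>) * en (-d) (-c) (\<lambda>x. w (-x)) (\<lambda>x. w2 (-x)) + ennreal (36*\<eta>)"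
    "\<And>x. -d \<le> x \<Longrightarrow> x \<le> -c \<Longrightarrow> \<bar>v x - w (-x)\<bar> \<le> \<eta>"
    using adjust_right[OF prof_reflect[OF P] assms(2) _ \<eta>, of \<delta>0 "-\<delta>1"] cd \<delta> by auto
  show ?thesis
    by (rule that[of "\<lambda>x. v (-x)" "\<lambda>x. - v1 (-x)" "\<lambda>x. v2 (-x)"])
      (use v v(7)[of "- x" for x] prof_reflect[OF v(1)] en_reflect[OF v(1)] en_reflect[OF P] in auto)
qed

text \<open>The sign \<open>s\<close> moves the profile to the normalised wells, one correction at
  each end makes the data exact, and then \<open>K\<close> bounds the energy. The bound
  \<open>M\<close> turns the factor (1 + 9 \<eta>)^2 into an additive error.\<close>

lemma lower_bound_perturbed:
  fixes K M \<eta> :: real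
  assumes K: "optimal_energy p Q K"
    and P: "prof p c d w w1 w2" and p: "p \<ge> 1" and cd: "c + 1 < d" and \<eta>: "0 < \<eta>" "\<eta> \<le> 1"
    and s: "s \<in> {1, -1}" and Q: "Q x0 d0 x1 d1"
    and near: "\<bar>s * w c - x0\<bar> \<le> \<eta>/13" "\<bar>s * w1 c - d0\<bar> \<le> \<eta>/13" "\<bar>s * w d - x1\<bar> \<le> \<eta>/13" "\<bar>s * w1 d - d1\<bar> \<le> \<eta>/13"
    and M: "en c d w w2 \<le> ennreal M" "M \<ge> 0"
  shows "ennreal K \<le> en c d w w2 + ennreal (\<eta> * (99*M + 396))"
proof -
  have near': "\<bar>x1 - s * w d\<bar> \<le> \<eta>/13" "\<bar>d1 - s * w1 d\<bar> \<le> \<eta>/13"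
    "\<bar>x0 - s * w c\<bar> \<le> \<eta>/13" "\<bar>d0 - s * w1 c\<bar> \<le> \<eta>/13"
    using near by linarith+
  obtain u u1 u2 where "prof p c d u u1 u2" "u c = s * w c" "u1 c = s * w1 c" "u d = s * w d + (x1 - s * w d)"
    "u1 d = s * w1 d + (d1 - s * w1 d)"
    "en c d u u2 \<le> ennreal (1 + 9*\<eta>) * en c d (\<lambda>x. s * w x) (\<lambda>x. s * w2 x) + ennreal (36*\<eta>)"
    by (rule adjust_right[OF prof_cmult[OF P, of s] p cd \<eta> near'(1,2)])
  then have u: "prof p c d u u1 u2" "u c = s * w c" "u1 c = s * w1 c" "u d = x1" "u1 d = d1"
    "en c d u u2 \<le> ennreal (1 + 9*\<eta>) * en c d (\<lambda>x. s * w x) (\<lambda>x. s * w2 x) + ennreal (36*\<eta>)" by auto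
  obtain v v1 v2 where "prof p c d v v1 v2" "v d = u d" "v1 d = u1 d" "v c = u c + (x0 - s * w c)"
    "v1 c = u1 c + (d0 - s * w1 c)"
    "en c d v v2 \<le> ennreal (1 + 9*\<eta>) * en c d u u2 + ennreal (36*\<eta>)"
    by (rule adjust_left[OF u(1) p cd \<eta> near'(3,4)])
  then have v: "prof p c d v v1 v2" "v d = u d" "v1 d = u1 d" "v c = x0" "v1 c = d0"
    "en c d v v2 \<le> ennreal (1 + 9*\<eta>) * en c d u u2 + ennreal (36*\<eta>)" using u by auto
  have "s^2 = 1" using s by auto
  then have eq: "en c d (\<lambda>x. s * w x) (\<lambda>x. s * w2 x) = en c d w w2" by (rule en_sign)
  obtain E where E: "en c d w w2 = ennreal E" "E \<ge> 0" using M(1)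
    by (cases "en c d w w2") (auto simp: top_unique)
  have EM: "E \<le> M" using M E by (simp add: ennreal_le_iff)
  have "ennreal K \<le> en c d v v2" using optimal_energyD(2)[OF K v(1)] Q v u by simp
  also have "\<dots> \<le> ennreal (1 + 9*\<eta>) * en c d u u2 + ennreal (36*\<eta>)" by fact
  also have "\<dots> \<le> ennreal (1 + 9*\<eta>) * (ennreal (1 + 9*\<eta>) * ennreal E + ennreal (36*\<eta>)) + ennreal (36*\<eta>)"
    using u(6) unfolding eq E by (intro add_right_mono mult_left_mono) auto
  also have "\<dots> = ennreal ((1 + 9*\<eta>) * ((1 + 9*\<eta>) * E + 36*\<eta>) + 36*\<eta>)"
    using \<eta> E by (simp add: ennreal_mult' ennreal_plus)
  \<comment> \<open>Expanding and using \<eta>^2 \<le> \<eta> produces the coefficients 99 = 18 + 81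
    and 396 = 72 + 324.\<close>
  also have "(1 + 9*\<eta>) * ((1 + 9*\<eta>) * E + 36*\<eta>) + 36*\<eta> \<le> E + \<eta> * (99*M + 396)"
  proof -
    have "\<eta> * \<eta> \<le> \<eta> * 1" using \<eta> by (intro mult_left_mono) auto
    then have "(\<eta>*\<eta>) * E \<le> \<eta> * E" using E by (intro mult_right_mono) auto
    moreover have "\<eta> * E \<le> \<eta> * M" using EM \<eta> by (intro mult_left_mono) auto
    moreover note \<open>\<eta> * \<eta> \<le> \<eta> * 1\<close>
    moreover have "(1 + 9*\<eta>) * ((1 + 9*\<eta>) * E + 36*\<eta>) + 36*\<eta> = E + 18*(\<eta>*E) + 81*((\<eta>*\<eta>)*E) + 72*\<eta> + 324*(\<eta>*\<eta>)"
      by (simp add: algebra_simps)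
    ultimately show ?thesis by (simp add: algebra_simps)
  qed
  finally show ?thesis using E \<eta> M by (simp add: ennreal_plus ennreal_leI)
qed

section \<open>Oscillation of the slope and the cost of a zero\<close>

lemma prof_slope_variation:
  assumes P: "prof p c d w w1 w2" and p: "p \<ge> 1" and xy: "c \<le> x" "x \<le> y" "y \<le> d" "y - x \<le> 1"
    and E: "en x y w w2 \<le> ennreal E" "E > 0"
  shows "\<bar>w1 y - w1 x\<bar> \<le> sqrt E"
proof (cases "x = y")
  case False
  then have xy': "x < y" using xy by simp
  note P' = prof_restrict[OF P xy(1) xy' xy(3)]
  define l where "l = sqrt E"
  have l: "l > 0" "l^2 = E" using E by (auto simp: l_def)
  have "ennreal \<bar>w1 y - w1 x\<bar> \<le> (\<integral>\<^sup>+ z\<in>{x<..<y}. ennreal \<bar>w2 z\<bar> \<partial>lborel)"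
    using profD(3)[OF P'] xy' by (intro Lp_integral_bound[OF profD(2)[OF P'] p]) auto
  also have "\<dots> \<le> (\<integral>\<^sup>+ z. ennreal (1/(2*l)) * (ennreal ((w z^2-1)^2 + (w2 z)^2) * indicator {x<..<y} z)
     + ennreal (l/2) * indicator {x<..<y} z \<partial>lborel)"
  proof (rule nn_integral_mono)
    fix z
    \<comment> \<open>Cauchy-Schwarz in pointwise form: |w2| \<le> w2^2/(2l) + l/2 with l = sqrt E
      integrates to at most E/(2l) + l/2 = sqrt E over a length of at most 1.\<close>
    have "0 \<le> (\<bar>w2 z\<bar> - l)^2 / (2*l)" using l by simp
    also have "\<dots> = (1/(2*l)) * (w2 z)^2 - \<bar>w2 z\<bar> + l/2" using l by (simp add: power2_eq_square field_simps)
    also have "(1/(2*l)) * (w2 z)^2 \<le> (1/(2*l)) * ((w z^2-1)^2 + (w2 z)^2)" using l by (intro mult_left_mono) auto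
    finally have "\<bar>w2 z\<bar> \<le> (1/(2*l)) * ((w z^2-1)^2 + (w2 z)^2) + l/2" by simp
    then have "ennreal \<bar>w2 z\<bar> \<le> ennreal ((1/(2*l)) * ((w z^2-1)^2 + (w2 z)^2) + l/2)" by (rule ennreal_leI)
    also have "\<dots> = ennreal (1/(2*l)) * ennreal ((w z^2-1)^2 + (w2 z)^2) + ennreal (l/2)"
      using l by (subst ennreal_plus) (auto simp: ennreal_mult'[symmetric])
    finally show "ennreal \<bar>w2 z\<bar> * indicator {x<..<y} z \<le> ennreal (1/(2*l)) * (ennreal ((w z^2-1)^2 + (w2 z)^2) * indicator {x<..<y} z)
     + ennreal (l/2) * indicator {x<..<y} z" by (auto simp: indicator_def)
  qed
  also have "\<dots> = ennreal (1/(2*l)) * en x y w w2 + ennreal (l/2) * ennreal (y - x)"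
    unfolding en_def using xy'
    by (subst nn_integral_linear_combination[OF en_density_measurable[OF P']]) auto
  also have "\<dots> \<le> ennreal (1/(2*l)) * ennreal E + ennreal (l/2) * ennreal 1"
    using E xy by (intro add_mono mult_left_mono ennreal_leI) auto
  also have "\<dots> = ennreal (E/(2*l) + l/2)" using l E by (simp add: ennreal_mult'[symmetric] ennreal_plus)
  also have "E/(2*l) + l/2 = l" using l by (simp add: l(2)[symmetric] power2_eq_square)
  finally show ?thesis using l by (simp add: l_def[symmetric] ennreal_le_iff)
qed (use E in simp)

lemma prof_mvt:
  assumes P: "prof p c d w w1 w2" and xy: "c \<le> x" "x < y" "y \<le> d"
  obtains z where "x < z" "z < y" "w y - w x = (y - x) * w1 z"
proof -
  have "continuous_on {x..y} w" using prof_continuous(1)[OF P] xy by (auto intro: continuous_on_subset)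
  moreover have "(w has_derivative (\<lambda>h. w1 z * h)) (at z)" if "x < z" "z < y" for z
  proof -
    have "z \<in> {c..d}" "c < z" "z < d" using that xy by auto
    then have "(w has_real_derivative w1 z) (at z)" using prof_deriv[OF P, of z] by (simp add: at_within_Icc_at)
    then show ?thesis by (simp add: has_field_derivative_def)
  qed
  ultimately obtain z where "x < z" "z < y" "w y - w x = w1 z * (y - x)" by (rule mvt[OF xy(2)]) blast+
  then show ?thesis using that by (simp add: mult.commute)
qed

lemma nn_interval_ge_const:
  fixes g :: "real \<Rightarrow> ennreal"
  assumes "c \<le> d" "\<And>x. c < x \<Longrightarrow> x < d \<Longrightarrow> k \<le> g x"
  shows "k * ennreal (d - c) \<le> (\<integral>\<^sup>+ x\<in>{c<..<d}. g x \<partial>lborel)"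
  using nn_interval_mono[of c c d d "\<lambda>_. k" g] assms by (simp add: nn_interval_const)

text \<open>Energy below 1/100 lets the slope vary by at most 1/10 over a unit length, so beyond the
  zero the profile is nearly a line. A moderate slope keeps |w| \<le> 5/8 on a length 1/8, costing
  at least 1/4 * 1/8 = 1/32; a steep one gives |w| \<ge> 2 on the last quarter, costing at least
  1/16.\<close>

lemma zero_costs_right:
  assumes P: "prof p c d w w1 w2" and p: "p \<ge> 1" and z: "c \<le> z" "z + 1 \<le> d" "w z = 0"
  shows "en c d w w2 \<ge> ennreal (1/100)"
proof (rule ccontr)
  assume "\<not> ?thesis"
  then have small: "en c d w w2 < ennreal (1/100)" by simp
  have sq: "sqrt (1/100) = 1/10" by (simp add: real_sqrt_divide)
  have le: "en x y w w2 \<le> ennreal (1/100)" if "c \<le> x" "y \<le> d" for x y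
    using small en_mono[of c x y d w w2] that by (meson le_less_trans less_imp_le)
  have var: "\<bar>w1 x - w1 z\<bar> \<le> 1/10" if "z \<le> x" "x \<le> z+1" for x
    using prof_slope_variation[OF P p, of z x "1/100"] le[of z x] that z sq by auto
  have lin: "\<exists>m. w x = (x - z) * m \<and> \<bar>m - w1 z\<bar> \<le> 1/10" if "z < x" "x \<le> z+1" for x
    using prof_mvt[OF P z(1) that(1)] that z var by (metis (no_types, lifting) add_le_cancel_left diff_zero less_imp_le order.trans)
  show False
  proof (cases "\<bar>w1 z\<bar> \<le> 4")
    case True
    have "ennreal (1/4) * ennreal (z+1/8 - z) \<le> en z (z+1/8) w w2" unfolding en_def
    proof (rule nn_interval_ge_const)
      fix x assume x: "z < x" "x < z+1/8"
      then obtain m where m: "w x = (x - z) * m" "\<bar>m - w1 z\<bar> \<le> 1/10" using lin[of x] by auto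
      have "\<bar>m\<bar> \<le> 5" using m True by linarith
      then have "\<bar>x - z\<bar> * \<bar>m\<bar> \<le> (1/8) * 5" using x by (intro mult_mono) auto
      then have "\<bar>w x\<bar> \<le> 5/8" using m by (simp add: abs_mult)
      then have "(w x)^2 \<le> (5/8)^2" by (metis abs_ge_zero power2_abs power_mono)
      then have "1/2 \<le> 1 - (w x)^2" by (simp add: power_divide)
      then have "(1/2)^2 \<le> (1 - (w x)^2)^2" by (intro power_mono) auto
      then have "1/4 \<le> ((w x)^2 - 1)^2 + (w2 x)^2" by (simp add: power2_commute power_divide add_increasing2)
      then show "ennreal (1/4) \<le> ennreal (((w x)^2 - 1)^2 + (w2 x)^2)" by (rule ennreal_leI)
    qed simp
    also have "\<dots> \<le> ennreal (1/100)" using le z by auto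
    finally show False by (simp add: ennreal_mult'[symmetric])
  next
    case False
    have "ennreal (1/4) * ennreal (z+1 - (z+3/4)) \<le> en (z+3/4) (z+1) w w2" unfolding en_def
    proof (rule nn_interval_ge_const)
      fix x assume x: "z+3/4 < x" "x < z+1"
      then obtain m where m: "w x = (x - z) * m" "\<bar>m - w1 z\<bar> \<le> 1/10" using lin[of x] by auto
      have "\<bar>m\<bar> \<ge> 3" using m False by linarith
      then have "\<bar>x - z\<bar> * \<bar>m\<bar> \<ge> (3/4) * 3" using x by (intro mult_mono) auto
      then have "\<bar>w x\<bar> \<ge> 2" using m by (simp add: abs_mult)
      then have "(w x)^2 \<ge> 2^2" by (metis power2_abs power_mono zero_le_numeral)
      then have "1/2 \<le> (w x)^2 - 1" by simp
      then have "(1/2)^2 \<le> ((w x)^2 - 1)^2" by (intro power_mono) auto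
      then have "1/4 \<le> ((w x)^2 - 1)^2 + (w2 x)^2" by (simp add: power_divide add_increasing2)
      then show "ennreal (1/4) \<le> ennreal (((w x)^2 - 1)^2 + (w2 x)^2)" by (rule ennreal_leI)
    qed simp
    also have "\<dots> \<le> ennreal (1/100)" using le z by auto
    finally show False by (simp add: ennreal_mult'[symmetric])
  qed
qed

text \<open>Length 2 guarantees unit room on one side of the zero, possibly after
  reflection.\<close>

lemma zero_costs:
  assumes P: "prof p c d w w1 w2" and p: "p \<ge> 1" and z: "z \<in> {c..d}" "w z = 0" "c + 2 \<le> d"
  shows "en c d w w2 \<ge> ennreal (1/100)"
proof (cases "z + 1 \<le> d")
  case True
  then show ?thesis using zero_costs_right[OF P p, of z] z by auto
next
  case False
  then show ?thesis using zero_costs_right[OF prof_reflect[OF P] p, of "-z"] z en_reflect[OF P] by auto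
qed

section \<open>Pigeonhole search for points almost at rest\<close>

lemma small_integral_point:
  fixes g :: "real \<Rightarrow> real"
  assumes "(\<integral>\<^sup>+ x\<in>{c<..<d}. ennreal (g x) \<partial>lborel) < ennreal (k * (d - c))" "c < d" "k \<ge> 0"
  obtains x where "c < x" "x < d" "g x < k"
proof -
  have "\<exists>x. c < x \<and> x < d \<and> g x < k"
  proof (rule ccontr)
    assume "\<not> ?thesis"
    then have "k \<le> g x" if "c < x" "x < d" for x using that by force
    then have "ennreal k * ennreal (d - c) \<le> (\<integral>\<^sup>+ x\<in>{c<..<d}. ennreal (g x) \<partial>lborel)"
      using assms(2) by (intro nn_interval_ge_const ennreal_leI) auto
    then show False using assms by (simp add: ennreal_mult'[symmetric])
  qed
  then show ?thesis using that by blast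
qed

text \<open>Each of the outer thirds contains a point within \<kappa>/12 of \<open>t\<close>. The
  two are more than 1/3 apart, so by the mean value theorem the slope is at most \<kappa>/2
  somewhere between; energy below \<kappa>^2/4 lets it change by at most \<kappa>/2 on the way back
  to the first point.\<close>

lemma good_point_cell:
  assumes P: "prof p c d w w1 w2" and p: "p \<ge> 1" and z: "c \<le> z" "z + 1 \<le> d" and \<kappa>: "\<kappa> > 0"
    and en: "en z (z+1) w w2 < ennreal (\<kappa>^2/4)"
    and dist: "(\<integral>\<^sup>+ x\<in>{z<..<z+1}. ennreal (\<bar>w x - t\<bar> powr p) \<partial>lborel) < ennreal ((\<kappa>/12) powr p / 3)"
  obtains g where "z \<le> g" "g \<le> z+1" "\<bar>w g - t\<bar> \<le> \<kappa>" "\<bar>w1 g\<bar> \<le> \<kappa>"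
proof -
  have pt: "\<exists>y. x < y \<and> y < x + 1/3 \<and> \<bar>w y - t\<bar> \<le> \<kappa>/12" if "z \<le> x" "x + 1/3 \<le> z + 1" for x
  proof -
    have "(\<integral>\<^sup>+ y\<in>{x<..<x+1/3}. ennreal (\<bar>w y - t\<bar> powr p) \<partial>lborel) \<le> (\<integral>\<^sup>+ y\<in>{z<..<z+1}. ennreal (\<bar>w y - t\<bar> powr p) \<partial>lborel)"
      by (rule nn_interval_mono) (use that in auto)
    then have "(\<integral>\<^sup>+ y\<in>{x<..<x+1/3}. ennreal (\<bar>w y - t\<bar> powr p) \<partial>lborel) < ennreal ((\<kappa>/12) powr p * (x+1/3 - x))"
      using dist by simp
    then obtain y where "x < y" "y < x+1/3" "\<bar>w y - t\<bar> powr p < (\<kappa>/12) powr p"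
      using small_integral_point[of "\<lambda>x. \<bar>w x - t\<bar> powr p" x "x+1/3" "(\<kappa>/12) powr p"] \<kappa> by auto
    moreover then have "\<bar>w y - t\<bar> \<le> \<kappa>/12" using p \<kappa> powr_mono2[of p "\<kappa>/12" "\<bar>w y - t\<bar>"] by (intro leI) auto
    ultimately show ?thesis by auto
  qed
  obtain x where x: "z < x" "x < z + 1/3" "\<bar>w x - t\<bar> \<le> \<kappa>/12" using pt[of z] by auto
  obtain y where y: "z + 2/3 < y" "y < z + 1" "\<bar>w y - t\<bar> \<le> \<kappa>/12" using pt[of "z+2/3"] by auto
  obtain v where v: "x < v" "v < y" "w y - w x = (y - x) * w1 v"
    using prof_mvt[OF P, of x y] x y z by auto
  have "(1/3) * \<bar>w1 v\<bar> \<le> \<bar>y - x\<bar> * \<bar>w1 v\<bar>" using x y by (intro mult_right_mono) auto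
  also have "\<dots> = \<bar>w y - w x\<bar>" using v by (simp add: abs_mult)
  also have "\<dots> \<le> \<kappa>/6" using x y by linarith
  finally have wv: "\<bar>w1 v\<bar> \<le> \<kappa>/2" by simp
  have "en x v w w2 \<le> ennreal (\<kappa>^2/4)" using en_mono[of z x v "z+1" w w2] en x y v by (meson le_less_trans less_imp_le less_trans)
  then have "\<bar>w1 v - w1 x\<bar> \<le> sqrt (\<kappa>^2/4)" using x y v z \<kappa> by (intro prof_slope_variation[OF P p]) auto
  also have "sqrt (\<kappa>^2/4) = \<kappa>/2" using \<kappa> by (simp add: real_sqrt_divide)
  finally have "\<bar>w1 x\<bar> \<le> \<kappa>" using wv by linarith
  then show ?thesis using x \<kappa> by (intro that[of x]) auto
qed

text \<open>Pigeonhole over the \<open>K\<close> consecutive unit cells starting at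
  \<open>c\<close>.\<close>

lemma small_cell:
  fixes J :: "real \<Rightarrow> real \<Rightarrow> ennreal"
  assumes add: "\<And>u v w. c \<le> u \<Longrightarrow> u \<le> v \<Longrightarrow> v \<le> w \<Longrightarrow> w \<le> d \<Longrightarrow> J u w = J u v + J v w"
    and J: "J c (c + real K) < of_nat K * \<eta>" "c + real K \<le> d"
  obtains z where "c \<le> z" "z + 1 \<le> c + real K" "J z (z+1) < \<eta>"
proof -
  have "\<exists>z. c \<le> z \<and> z + 1 \<le> c + real K \<and> J z (z+1) < \<eta>"
  proof (rule ccontr)
    assume "\<not> ?thesis"
    then have ge: "\<eta> \<le> J z (z+1)" if "c \<le> z" "z + 1 \<le> c + real K" for z using that by force
    have "of_nat k * \<eta> \<le> J c (c + real k)" if "k \<le> K" for k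
      using that
    proof (induction k)
      case (Suc k)
      then have "of_nat k * \<eta> + \<eta> \<le> J c (c + real k) + J (c + real k) (c + real k + 1)"
        using ge[of "c + real k"] by (intro add_mono) auto
      also have "\<dots> = J c (c + real k + 1)" using Suc.prems J by (subst add[of c "c+real k"]) auto
      finally show ?case by (simp add: algebra_simps)
    qed simp
    from this[of K] J show False by simp
  qed
  then show ?thesis using that by blast
qed

lemma good_point:
  assumes P: "prof p c d w w1 w2" and p: "p \<ge> 1" and xy: "c \<le> x" "x + real K \<le> d" and \<kappa>: "\<kappa> > 0"
    and small: "en x (x + real K) w w2 + (\<integral>\<^sup>+ z\<in>{x<..<x+real K}. ennreal (\<bar>w z - t\<bar> powr p) \<partial>lborel)
      < of_nat K * ennreal (min (\<kappa>^2/4) ((\<kappa>/12) powr p / 3))"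
  obtains g where "x \<le> g" "g \<le> x + real K" "\<bar>w g - t\<bar> \<le> \<kappa>" "\<bar>w1 g\<bar> \<le> \<kappa>"
proof -
  let ?D = "\<lambda>x y. (\<integral>\<^sup>+ z\<in>{x<..<y}. ennreal (\<bar>w z - t\<bar> powr p) \<partial>lborel)"
  \<comment> \<open>Energy and distance are added into one interval function, so that a single unit
    cell is found on which both are small.\<close>
  let ?J = "\<lambda>x y. en x y w w2 + ?D x y"
  have add: "?J u r = ?J u v + ?J v r" if "x \<le> u" "u \<le> v" "v \<le> r" "r \<le> d" for u v r
  proof (cases "u < r")
    case True
    have P': "prof p u r w w1 w2" using prof_restrict[OF P] that xy True by auto
    show ?thesis using en_split[OF P' that(2,3)] nn_interval_split[OF dist_density_measurable[OF P'] that(2,3)]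
      by (simp add: ac_simps)
  qed (use that in \<open>simp add: en_def\<close>)
  obtain z where z: "x \<le> z" "z + 1 \<le> x + real K" "?J z (z+1) < ennreal (min (\<kappa>^2/4) ((\<kappa>/12) powr p / 3))"
    using small_cell[of x d ?J K, OF add small xy(2)] by auto
  have "en z (z+1) w w2 < ennreal (\<kappa>^2/4)" "?D z (z+1) < ennreal ((\<kappa>/12) powr p / 3)"
    using z(3) by (auto intro: le_less_trans[OF _ less_le_trans[OF z(3) ennreal_leI]])
  from good_point_cell[OF P p _ _ \<kappa> this] obtain g where "z \<le> g" "g \<le> z+1" "\<bar>w g - t\<bar> \<le> \<kappa>" "\<bar>w1 g\<bar> \<le> \<kappa>"
    using z xy by auto
  then show ?thesis using z by (intro that[of g]) auto
qed

subsection \<open>Piecewise constant functions and their essential variation\<close>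

text \<open>First value, last value and number of jumps are recorded, since the limit functional
  depends on nothing else; the positions of the jumps stay hidden in the derivation. Pieces are
  appended on the right because both energy bounds accumulate from left to right.\<close>

inductive steps :: "(real \<Rightarrow> real) \<Rightarrow> real \<Rightarrow> real \<Rightarrow> nat \<Rightarrow> real \<Rightarrow> real \<Rightarrow> bool" for u s x where
  steps_one: "x < y \<Longrightarrow> s \<in> {1,-1} \<Longrightarrow> (AE z in lborel. z \<in> {x<..<y} \<longrightarrow> u z = s) \<Longrightarrow> steps u s x 0 s y"
| steps_snoc: "steps u s x N t y \<Longrightarrow> y < z \<Longrightarrow> (AE r in lborel. r \<in> {y<..<z} \<longrightarrow> u r = - t) \<Longrightarrow>
    steps u s x (Suc N) (- t) z"

text \<open>The pointwise counterpart of \<open>steps\<close>. Such chains bound the number of jumps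
  from below, both through the variation of a representative and through the energy of approximating
  profiles. \<open>E\<close> plays the role of a full-measure set of points at which the value of
  \<open>u\<close> is meaningful.\<close>

inductive alternation :: "(real \<Rightarrow> real) \<Rightarrow> real set \<Rightarrow> nat \<Rightarrow> real \<Rightarrow> real \<Rightarrow> bool" for u E where
  alternation_0: "g \<in> E \<Longrightarrow> u g = t \<Longrightarrow> alternation u E 0 t g"
| alternation_Suc: "alternation u E N t g \<Longrightarrow> h \<in> E \<Longrightarrow> g < h \<Longrightarrow> u h = - t \<Longrightarrow> alternation u E (Suc N) (- t) h"

lemma AE_interval_witness:
  assumes "AE z in lborel. z \<in> {x<..<y::real} \<longrightarrow> P z" "x < y"
  obtains z where "x < z" "z < y" "P z"
proof -
  have "\<exists>z. x < z \<and> z < y \<and> P z"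
  proof (rule ccontr)
    assume "\<nexists>z. x < z \<and> z < y \<and> P z"
    with assms(1) have "AE z in lborel. z \<notin> {x<..<y}" by (auto elim: eventually_mono)
    then have "emeasure lborel {x<..<y} = 0" using AE_iff_null_sets[of "{x<..<y}" lborel] by auto
    then show False using assms(2) by simp
  qed
  then show ?thesis using that by blast
qed

lemma AE_interval_join:
  assumes "AE r in lborel. r \<in> {x<..<y::real} \<longrightarrow> P r" "AE r in lborel. r \<in> {y<..<z} \<longrightarrow> P r"
  shows "AE r in lborel. r \<in> {x<..<z} \<longrightarrow> P r"
  using assms AE_lborel_singleton[of y] by eventually_elim auto

lemma AE_interval_mono:
  assumes "AE r in lborel. r \<in> {x<..<y::real} \<longrightarrow> P r" "x \<le> x'" "y' \<le> y"
  shows "AE r in lborel. r \<in> {x'<..<y'} \<longrightarrow> P r"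
  using assms(1) by eventually_elim (use assms in auto)

lemma steps_basic:
  assumes "steps u s x N t y"
  shows "x < y" "s \<in> {1,-1}" "t \<in> {1,-1}" "AE r in lborel. r \<in> {x<..<y} \<longrightarrow> u r \<in> {1,-1}"
proof -
  have "x < y \<and> s \<in> {1,-1} \<and> t \<in> {1,-1} \<and> (AE r in lborel. r \<in> {x<..<y} \<longrightarrow> u r \<in> {1,-1})"
    using assms
  proof induction
    case (steps_one y)
    have "AE r in lborel. r \<in> {x<..<y} \<longrightarrow> u r \<in> {1,-1}"
      using steps_one(3) by eventually_elim (use steps_one(2) in auto)
    then show ?case using steps_one by auto
  next
    case (steps_snoc N t y z)
    have "AE r in lborel. r \<in> {y<..<z} \<longrightarrow> u r \<in> {1,-1}"
      using steps_snoc(3) by eventually_elim (use steps_snoc in auto)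
    then have "AE r in lborel. r \<in> {x<..<z} \<longrightarrow> u r \<in> {1,-1}"
      using steps_snoc(4) by (elim conjE) (rule AE_interval_join[of x y])
    then show ?case using steps_snoc by auto
  qed
  then show "x < y" "s \<in> {1,-1}" "t \<in> {1,-1}" "AE r in lborel. r \<in> {x<..<y} \<longrightarrow> u r \<in> {1,-1}" by auto
qed

lemma steps_merge:
  assumes "steps u s x N t y" "y < z" "AE r in lborel. r \<in> {y<..<z} \<longrightarrow> u r = t"
  shows "steps u s x N t z"
  using assms(1)
proof cases
  case steps_one
  then show ?thesis using assms AE_interval_join[of x y "\<lambda>r. u r = s" z] by (auto intro: steps.steps_one)
next
  case (steps_snoc N' t' y')
  then show ?thesis using assms AE_interval_join[of y' y "\<lambda>r. u r = - t'" z] by (auto intro: steps.steps_snoc)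
qed

lemma steps_first:
  assumes "steps u s x N t y"
  obtains m where "x < m" "AE r in lborel. r \<in> {x<..<m} \<longrightarrow> u r = s"
  using assms
proof (induction arbitrary: thesis)
  case (steps_one y)
  then show ?case by blast
next
  case (steps_snoc N t y z)
  show ?case by (rule steps_snoc.IH) (rule steps_snoc.prems)
qed

lemma steps_last:
  assumes "steps u s x N t y"
  obtains m where "m < y" "AE r in lborel. r \<in> {m<..<y} \<longrightarrow> u r = t"
  using assms by cases (use that in blast)+

lemma alternation_end:
  assumes "alternation u E N t g" shows "g \<in> E" "u g = t"
  using assms by (induction) auto

text \<open>Induction on a length that no alternation reaches before \<open>c\<close>. Beyond the
  infimum \<open>m\<close> the function is constantly \<open>t\<close> on \<open>E\<close>. An
  alternation of the previous length ending before \<open>m\<close> could be prolonged: by a sign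
  change before \<open>c\<close> if it ends in \<open>t\<close>, by a point beyond \<open>m\<close>
  otherwise. So the induction hypothesis applies up to \<open>m\<close>.\<close>

lemma steps_exist:
  assumes E: "\<And>z. z \<in> E \<Longrightarrow> u z \<in> {1,-1}" "E \<subseteq> {a<..<b}" and AE: "AE z in lborel. z \<in> {a<..<b} \<longrightarrow> z \<in> E"
  shows "a < c \<Longrightarrow> c \<le> b \<Longrightarrow> (\<And>t g. g < c \<Longrightarrow> \<not> alternation u E N t g) \<Longrightarrow> \<exists>s M t. steps u s a M t c"
proof (induction N arbitrary: c)
  case 0
  \<comment> \<open>Alternations of length 0 always exist, so the premise is contradictory.\<close>
  obtain z where "a < z" "z < c" "z \<in> E"
    using AE_interval_witness[OF AE_interval_mono[OF AE, of a c]] 0 by auto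
  then show ?case using 0(3)[of z "u z"] alternation_0 by blast
next
  case (Suc N)
  show ?case
  proof (cases "\<exists>t g. g < c \<and> alternation u E N t g")
    case False
    then show ?thesis using Suc by blast
  next
    case True
    then obtain t g where g: "g < c" "alternation u E N t g" by auto
    have gE: "g \<in> E" "u g = t" using alternation_end[OF g(2)] .
    have tt: "t \<in> {1,-1}" using E(1)[OF gE(1)] gE by simp
    define S where "S = {z. a \<le> z \<and> z < c \<and> (\<forall>h\<in>E. z < h \<longrightarrow> h < c \<longrightarrow> u h = t)}"
    have gS: "g \<in> S"
    proof -
      have "u h = t" if "h \<in> E" "g < h" "h < c" for h
      proof (rule ccontr)
        assume "u h \<noteq> t"
        then have "u h = - t" using E(1)[OF that(1)] tt by auto
        then show False using Suc.prems(3)[of h] alternation_Suc[OF g(2) that(1,2)] that by blast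
      qed
      then show ?thesis using gE E(2) g by (auto simp: S_def)
    qed
    define m where "m = Inf S"
    have bdd: "bdd_below S" by (rule bdd_belowI[of _ a]) (auto simp: S_def)
    have m: "a \<le> m" "m \<le> g" unfolding m_def
      using gS bdd by (auto intro!: cInf_greatest cInf_lower) (auto simp: S_def)
    have ut: "u h = t" if "h \<in> E" "m < h" "h < c" for h
    proof -
      obtain z where "z \<in> S" "z < h" using \<open>m < h\<close> gS bdd unfolding m_def by (metis cInf_less_iff empty_iff)
      then show ?thesis using that by (auto simp: S_def)
    qed
    have AEm: "AE r in lborel. r \<in> {m<..<c} \<longrightarrow> u r = t"
      using AE by eventually_elim (use ut m Suc.prems in auto)
    show ?thesis
    proof (cases "m = a")
      case True
      then show ?thesis using steps_one[of a c t u] Suc.prems tt AEm by auto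
    next
      case False
      then have am: "a < m" using m by simp
      have "\<not> alternation u E N t' h" if h: "h < m" for t' h
      proof
        assume A: "alternation u E N t' h"
        have hE: "h \<in> E" "u h = t'" using alternation_end[OF A] .
        have t': "t' \<in> {1,-1}" using E(1)[OF hE(1)] hE by simp
        show False
        proof (cases "t' = t")
          case True
          have "h \<notin> S" using h bdd unfolding m_def by (meson cInf_lower not_le)
          then obtain z where z: "z \<in> E" "h < z" "z < c" "u z \<noteq> t"
            using hE E(2) h m g by (auto simp: S_def)
          then have "u z = - t'" using E(1)[OF z(1)] tt True by auto
          then show False using Suc.prems(3)[of z] alternation_Suc[OF A z(1,2)] z by blast
        next
          case False
          obtain z where z: "m < z" "z < c" "z \<in> E"
            using AE_interval_witness[OF AE_interval_mono[OF AE, of m c]] m g Suc.prems by auto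
          then have "u z = - t'" using ut[of z] t' tt False by auto
          then show False using Suc.prems(3)[of z] alternation_Suc[OF A z(3)] z h by auto
        qed
      qed
      then obtain s M t'' where st: "steps u s a M t'' m" using Suc.IH[OF am] m g Suc.prems by auto
      have "t'' \<in> {1,-1}" using steps_basic[OF st] by simp
      \<comment> \<open>The pieces before \<open>m\<close> may end with the same value, in which
        case no new jump is counted.\<close>
      then consider "t'' = t" | "t = - t''" using tt by auto
      then show ?thesis
      proof cases
        case 1
        then show ?thesis using steps_merge[OF st, of c] AEm m g by auto
      next
        case 2
        then show ?thesis using steps_snoc[OF st, of c] AEm m g by auto
      qed
    qed
  qed
qed

lemma steps_alternation:
  assumes "steps u s x N t y" "AE z in lborel. z \<in> {x<..<y} \<longrightarrow> z \<in> E"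
  shows "\<exists>g. g < y \<and> alternation u E N t g"
  using assms
proof induction
  case (steps_one y)
  have "AE z in lborel. z \<in> {x<..<y} \<longrightarrow> (u z = s \<and> z \<in> E)"
    using steps_one(3,4) by eventually_elim auto
  then obtain g where "x < g" "g < y" "u g = s \<and> g \<in> E" by (rule AE_interval_witness[OF _ steps_one(1)])
  then show ?case using alternation_0[of g E u s] by auto
next
  case (steps_snoc N t y z)
  have xy: "x < y" using steps_basic(1)[OF steps_snoc(1)] .
  have "AE r in lborel. r \<in> {y<..<z} \<longrightarrow> (u r = - t \<and> r \<in> E)"
    using steps_snoc(3,5) by eventually_elim (use xy in auto)
  then obtain h where h: "y < h" "h < z" "u h = - t \<and> h \<in> E" by (rule AE_interval_witness[OF _ steps_snoc(2)])
  obtain g where "g < y" "alternation u E N t g"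
    using steps_snoc.IH AE_interval_mono[OF steps_snoc(5)] steps_snoc(2) by auto
  then show ?case using h alternation_Suc[of u E N t g h] by auto
qed

section \<open>The essential variation counts the jumps\<close>

lemma alternation_chain:
  assumes "alternation u E N t g" "\<And>z. z \<in> E \<Longrightarrow> v z = u z \<and> u z \<in> {1,-1}"
  shows "\<exists>x. x N = g \<and> (\<forall>i<N. x i < x (Suc i)) \<and> (\<forall>i\<le>N. x i \<in> E) \<and>
     (\<Sum>i<N. \<bar>v (x (Suc i)) - v (x i)\<bar>) = 2 * real N"
  using assms(1)
proof induction
  case (alternation_0 g t)
  then show ?case by (intro exI[of _ "\<lambda>_. g"]) auto
next
  case (alternation_Suc N t g h)
  then obtain x where x: "x N = g" "\<forall>i<N. x i < x (Suc i)" "\<forall>i\<le>N. x i \<in> E"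
     "(\<Sum>i<N. \<bar>v (x (Suc i)) - v (x i)\<bar>) = 2 * real N" by auto
  let ?x = "x(Suc N := h)"
  have "(\<Sum>i<N. \<bar>v (?x (Suc i)) - v (?x i)\<bar>) = (\<Sum>i<N. \<bar>v (x (Suc i)) - v (x i)\<bar>)"
    by (rule sum.cong) auto
  moreover have "\<bar>v h - v g\<bar> = 2"
    using alternation_end[OF alternation_Suc(1)] assms(2)[of h] assms(2)[of g] alternation_Suc by auto
  ultimately have "(\<Sum>i<Suc N. \<bar>v (?x (Suc i)) - v (?x i)\<bar>) = 2 * real (Suc N)"
    using x by simp
  then show ?case using x alternation_Suc by (intro exI[of _ ?x]) (auto simp: less_Suc_eq le_Suc_eq)
qed

lemma pvar_ge_alternation:
  assumes "alternation u E N t g" "\<And>z. z \<in> E \<Longrightarrow> v z = u z \<and> u z \<in> {1,-1}" "E \<subseteq> I"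
  shows "ereal (2 * real N) \<le> pvar I v"
proof -
  obtain x where x: "\<forall>i<N. x i < x (Suc i)" "\<forall>i\<le>N. x i \<in> E" "(\<Sum>i<N. \<bar>v (x (Suc i)) - v (x i)\<bar>) = 2 * real N"
    using alternation_chain[OF assms(1,2)] by auto
  have "ereal (\<Sum>i<fst (N,x). \<bar>v (snd (N,x) (Suc i)) - v (snd (N,x) i)\<bar>) \<le> pvar I v"
    unfolding pvar_def by (rule SUP_upper) (use x assms(3) in auto)
  then show ?thesis using x(3) by simp
qed

text \<open>\<open>F\<close> is a bounded nondecreasing function dominating the increments of
  \<open>v\<close>, so that the variation of \<open>v\<close> telescopes. The bounds |v| \<le> 1 and
  F \<le> 2N are what the induction needs in order to add one jump of size at most 2.\<close>

lemma steps_representative: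
  assumes "steps u s x N t y"
  shows "\<exists>v F. (AE z in lborel. z \<in> {x<..<y} \<longrightarrow> u z = v z) \<and> (\<forall>z. \<bar>v z\<bar> \<le> 1) \<and> (\<forall>z. 0 \<le> F z \<and> F z \<le> 2 * real N) \<and>
    (\<forall>r q. r \<le> q \<longrightarrow> \<bar>v q - v r\<bar> \<le> F q - F r) \<and> (\<exists>m>x. \<forall>z<m. v z = s) \<and> (\<exists>m<y. \<forall>z>m. v z = t)"
  using assms
proof induction
  case (steps_one y)
  have "AE z in lborel. z \<in> {x<..<y} \<longrightarrow> u z = s" by fact
  then show ?case using steps_one
    by (intro exI[of _ "\<lambda>_. s"] exI[of _ "\<lambda>_. 0"]) (auto intro: exI[of _ y] exI[of _ x])
next
  case (steps_snoc N t y z)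
  then obtain v F m where v: "AE z in lborel. z \<in> {x<..<y} \<longrightarrow> u z = v z" "\<forall>z. \<bar>v z\<bar> \<le> 1"
    and F: "\<forall>z. 0 \<le> F z \<and> F z \<le> 2 * real N" "\<forall>r q. r \<le> q \<longrightarrow> \<bar>v q - v r\<bar> \<le> F q - F r"
    and m: "m > x" "\<forall>z<m. v z = s" by auto
  have xy: "x < y" and t: "t \<in> {1,-1}" using steps_basic[OF steps_snoc(1)] by auto
  let ?v = "\<lambda>r. if r \<le> y then v r else - t"
  let ?F = "\<lambda>r. if r \<le> y then F r else 2 * real (Suc N)"
  have f1: "AE r in lborel. r \<in> {x<..<z} \<longrightarrow> u r = ?v r"
    using v(1) steps_snoc(3) AE_lborel_singleton[of y] by eventually_elim auto
  have f2: "\<forall>r. \<bar>?v r\<bar> \<le> 1" using v t by auto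
  have f3: "\<forall>r. 0 \<le> ?F r \<and> ?F r \<le> 2 * real (Suc N)" using F(1) by (auto intro: order_trans)
  have f4: "\<forall>r q. r \<le> q \<longrightarrow> \<bar>?v q - ?v r\<bar> \<le> ?F q - ?F r"
  proof (intro allI impI)
    fix r q :: real assume that: "r \<le> q"
    consider "q \<le> y" | "r \<le> y" "q > y" | "r > y" using that by linarith
    then show "\<bar>?v q - ?v r\<bar> \<le> ?F q - ?F r"
    proof cases
      case 2
      have "F r \<le> 2 * real N" "\<bar>v r\<bar> \<le> 1" using F v by auto
      then show ?thesis using 2 t by (auto simp: abs_le_iff)
    qed (use F that in auto)
  qed
  have f5: "\<exists>m>x. \<forall>r<m. ?v r = s" using m xy by (intro exI[of _ "min m y"]) auto
  have f6: "\<exists>m<z. \<forall>r>m. ?v r = - t" using steps_snoc(2) by (intro exI[of _ y]) auto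
  show ?case by (rule exI[of _ ?v], rule exI[of _ ?F], intro conjI f1 f2 f3 f4 f5 f6)
qed

text \<open>Ensures that the choice in \<open>bpv_left\<close> is determined: a limit at
  \<open>a\<close> of any representative must be the constant taken almost everywhere near
  \<open>a\<close>.\<close>

lemma AE_limit_unique_right:
  fixes a :: real
  assumes "AE z in lborel. z \<in> {a<..<m} \<longrightarrow> v z = s" "a < m" "(v \<longlongrightarrow> t) (at_right a)"
  shows "t = (s::real)"
proof (rule ccontr)
  assume "t \<noteq> s"
  then have "\<forall>\<^sub>F z in at_right a. dist (v z) t < dist s t" using assms(3) tendstoD by (metis zero_less_dist_iff)
  then obtain m' where m': "m' > a" "\<And>z. a < z \<Longrightarrow> z < m' \<Longrightarrow> dist (v z) t < dist s t"
    unfolding eventually_at_right_field by auto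
  obtain z where "a < z" "z < min m m'" "v z = s"
    using AE_interval_witness[OF AE_interval_mono[OF assms(1), of a "min m m'"]] assms(2) m' by auto
  then show False using m'(2)[of z] by auto
qed

lemma AE_limit_unique_left:
  fixes b :: real
  assumes "AE z in lborel. z \<in> {m<..<b} \<longrightarrow> v z = s" "m < b" "(v \<longlongrightarrow> t) (at_left b)"
  shows "t = (s::real)"
proof (rule ccontr)
  assume "t \<noteq> s"
  then have "\<forall>\<^sub>F z in at_left b. dist (v z) t < dist s t" using assms(3) tendstoD by (metis zero_less_dist_iff)
  then obtain m' where m': "m' < b" "\<And>z. m' < z \<Longrightarrow> z < b \<Longrightarrow> dist (v z) t < dist s t"
    unfolding eventually_at_left_field by auto
  obtain z where "max m m' < z" "z < b" "v z = s"
    using AE_interval_witness[OF AE_interval_mono[OF assms(1), of "max m m'" b]] assms(2) m' by auto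
  then show False using m'(2)[of z] by auto
qed

text \<open>The representative from \<open>steps_representative\<close> has variation at most 2N,
  and every representative agrees with \<open>u\<close> on a full-measure set, which still contains
  an alternation with N sign changes. The end values defined by \<open>SOME\<close> exist by the
  former and are unique because \<open>u\<close> is constant almost everywhere near each
  end.\<close>

lemma steps_essVar:
  assumes S: "steps u s a N t b"
  shows "essVar {a<..<b} u = ereal (2 * real N)" "bpv_left a b u = s" "bpv_right a b u = t"
proof -
  obtain v F m m' where v: "AE z in lborel. z \<in> {a<..<b} \<longrightarrow> u z = v z"
    and F: "\<And>z. 0 \<le> F z \<and> F z \<le> 2 * real N" "\<And>r q. r \<le> q \<Longrightarrow> \<bar>v q - v r\<bar> \<le> F q - F r"
    and m: "m > a" "\<And>z. z < m \<Longrightarrow> v z = s" and m': "m' < b" "\<And>z. z > m' \<Longrightarrow> v z = t"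
    using steps_representative[OF S] by blast
  have up: "pvar {a<..<b} v \<le> ereal (2 * real N)"
    unfolding pvar_def
  proof (rule SUP_least, clarsimp)
    fix n :: nat and x :: "nat \<Rightarrow> real" assume x: "\<forall>i<n. x i < x (Suc i)"
    have "(\<Sum>i<n. \<bar>v (x (Suc i)) - v (x i)\<bar>) \<le> (\<Sum>i<n. F (x (Suc i)) - F (x i))"
      using x by (intro sum_mono F(2)) (auto intro: less_imp_le)
    also have "\<dots> = F (x n) - F (x 0)" by (rule sum_lessThan_telescope)
    also have "\<dots> \<le> 2 * real N" using F(1)[of "x n"] F(1)[of "x 0"] by linarith
    finally show "(\<Sum>i<n. \<bar>v (x (Suc i)) - v (x i)\<bar>) \<le> 2 * real N" .
  qed
  have low: "ereal (2 * real N) \<le> pvar {a<..<b} w" if "AE x in lborel. x \<in> {a<..<b} \<longrightarrow> u x = w x" for w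
  proof -
    let ?E = "{z. z \<in> {a<..<b} \<and> w z = u z \<and> u z \<in> {1,-1}}"
    have "AE z in lborel. z \<in> {a<..<b} \<longrightarrow> z \<in> ?E"
      using that steps_basic(4)[OF S] by eventually_elim auto
    then obtain g where "alternation u ?E N t g" using steps_alternation[OF S] by blast
    then show ?thesis by (rule pvar_ge_alternation) auto
  qed
  show ess: "essVar {a<..<b} u = ereal (2 * real N)"
    unfolding essVar_def
    by (rule antisym) (use up v low in \<open>auto intro!: INF_greatest intro: INF_lower2\<close>)
  have pv: "pvar {a<..<b} v = essVar {a<..<b} u" unfolding ess using up low[OF v] by simp
  have "(v \<longlongrightarrow> s) (at_right a)"
    using m by (intro tendsto_eventually) (auto simp: eventually_at_right_field intro: exI[of _ m])
  moreover have "t' = s" if w: "AE x in lborel. x \<in> {a<..<b} \<longrightarrow> u x = w x" "(w \<longlongrightarrow> t') (at_right a)" for t' w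
  proof -
    obtain n where n: "a < n" "AE r in lborel. r \<in> {a<..<n} \<longrightarrow> u r = s" using steps_first[OF S] .
    have "AE r in lborel. r \<in> {a<..<min b n} \<longrightarrow> w r = s" using n(2) w(1) by eventually_elim auto
    then show ?thesis using AE_limit_unique_right[OF _ _ w(2)] n steps_basic(1)[OF S] by (meson min_less_iff_conj)
  qed
  ultimately show "bpv_left a b u = s" unfolding bpv_left_def using v pv by (intro some_equality) blast+
  have "(v \<longlongrightarrow> t) (at_left b)"
    using m' by (intro tendsto_eventually) (auto simp: eventually_at_left_field intro: exI[of _ m'])
  moreover have "t' = t" if w: "AE x in lborel. x \<in> {a<..<b} \<longrightarrow> u x = w x" "(w \<longlongrightarrow> t') (at_left b)" for t' w
  proof -
    obtain n where n: "n < b" "AE r in lborel. r \<in> {n<..<b} \<longrightarrow> u r = t" using steps_last[OF S] .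
    have "AE r in lborel. r \<in> {max a n<..<b} \<longrightarrow> w r = t" using n(2) w(1) by eventually_elim auto
    then show ?thesis using AE_limit_unique_left[OF _ _ w(2)] n steps_basic(1)[OF S] by (meson max_less_iff_conj)
  qed
  ultimately show "bpv_right a b u = t" unfolding bpv_right_def using v pv by (intro some_equality) blast+
qed

text \<open>Finite variation caps the length of alternations on the full-measure set where
  \<open>v\<close> agrees with \<open>u\<close> and takes the values 1 and -1;
  \<open>steps_exist\<close> then yields finitely many pieces.\<close>

lemma BPV_steps:
  assumes "BPV p a b u" "a < b"
  shows "\<exists>s N t. steps u s a N t b"
proof -
  have "essVar {a<..<b} u < \<infinity>" using assms(1) unfolding BPV_def by simp
  then have "\<exists>v \<in> {v. AE x in lborel. x \<in> {a<..<b} \<longrightarrow> u x = v x}. pvar {a<..<b} v < \<infinity>"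
    unfolding essVar_def INF_less_iff .
  then obtain v where v: "AE x in lborel. x \<in> {a<..<b} \<longrightarrow> u x = v x" "pvar {a<..<b} v < \<infinity>"
    by (blast elim: bexE)
  let ?E = "{z. z \<in> {a<..<b} \<and> v z = u z \<and> u z \<in> {1,-1}}"
  have AE: "AE z in lborel. z \<in> {a<..<b} \<longrightarrow> z \<in> ?E"
    using v(1) assms(1)[unfolded BPV_def, THEN conjunct2, THEN conjunct1] by eventually_elim auto
  obtain N :: nat where N: "pvar {a<..<b} v < ereal (2 * real N)"
  proof -
    obtain r where "pvar {a<..<b} v \<le> ereal r" using v(2) by (cases "pvar {a<..<b} v") auto
    moreover obtain N where "r < real N" using reals_Archimedean2 by blast
    then have "ereal r < ereal (2 * real N)" by simp
    ultimately show ?thesis using that le_less_trans by blast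
  qed
  have "\<not> alternation u ?E N t g" for t g
  proof
    assume "alternation u ?E N t g"
    then have "ereal (2 * real N) \<le> pvar {a<..<b} v" by (rule pvar_ge_alternation) auto
    then show False using N by simp
  qed
  moreover have "u z \<in> {1,-1}" if "z \<in> ?E" for z using that by simp
  moreover have "?E \<subseteq> {a<..<b}" by auto
  ultimately show ?thesis using steps_exist[of ?E u a b b N] AE assms(2) by blast
qed

lemma steps_BPV:
  assumes "steps u s a N t b" "Lp p a b u"
  shows "BPV p a b u"
  using steps_basic(4)[OF assms(1)] assms(2)
  unfolding BPV_def steps_essVar(1)[OF assms(1)] by (simp add: insert_commute)

subsection \<open>The lower bound\<close>

abbreviation Lp_dist :: "real \<Rightarrow> real \<Rightarrow> real \<Rightarrow> (real \<Rightarrow> real) \<Rightarrow> (real \<Rightarrow> real) \<Rightarrow> ennreal" where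
  "Lp_dist p c d f g \<equiv> (\<integral>\<^sup>+ x\<in>{c<..<d}. ennreal (\<bar>f x - g x\<bar> powr p) \<partial>lborel)"

abbreviation eps_energy :: "real \<Rightarrow> real \<Rightarrow> real \<Rightarrow> (real \<Rightarrow> real) \<Rightarrow> (real \<Rightarrow> real) \<Rightarrow> ennreal" where
  "eps_energy a b e w w2 \<equiv> (\<integral>\<^sup>+ x\<in>{a<..<b}. ennreal ((w x ^ 2 - 1) ^ 2 / e + e ^ 3 * (w2 x) ^ 2) \<partial>lborel)"

lemma limit_agree_right:
  fixes f g :: "real \<Rightarrow> real"
  assumes "(f \<longlongrightarrow> l) (at_right c)" "\<And>x. x \<in> {c<..<d} \<Longrightarrow> g x = f x" "continuous_on {c..d} g" "c < d"
  shows "g c = l"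
proof -
  have "\<forall>\<^sub>F x in at_right c. g x = f x"
    unfolding eventually_at_right_field using assms(2,4) by (intro exI[of _ d]) auto
  then have "(g \<longlongrightarrow> l) (at_right c)" using assms(1) tendsto_cong by blast
  then show ?thesis using continuous_on_Icc_limits(1)[OF assms(3,4)] tendsto_unique trivial_limit_at_right_real by blast
qed

lemma limit_agree_left:
  fixes f g :: "real \<Rightarrow> real"
  assumes "(f \<longlongrightarrow> l) (at_left d)" "\<And>x. x \<in> {c<..<d} \<Longrightarrow> g x = f x" "continuous_on {c..d} g" "c < d"
  shows "g d = l"
proof -
  have "\<forall>\<^sub>F x in at_left d. g x = f x"
    unfolding eventually_at_left_field using assms(2,4) by (intro exI[of _ c]) auto
  then have "(g \<longlongrightarrow> l) (at_left d)" using assms(1) tendsto_cong by blast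
  then show ?thesis using continuous_on_Icc_limits(2)[OF assms(3,4)] tendsto_unique trivial_limit_at_left_real by blast
qed

definition jump_data :: "real \<Rightarrow> real \<Rightarrow> real \<Rightarrow> real \<Rightarrow> bool" where
  "jump_data x0 d0 x1 d1 \<longleftrightarrow> x0 = -1 \<and> d0 = 0 \<and> x1 = 1 \<and> d1 = 0"

text \<open>The outer slope is free because \<open>G_eps\<close> prescribes values, not slopes, at
  the ends of the interval.\<close>

definition boundary_data :: "real \<Rightarrow> real \<Rightarrow> real \<Rightarrow> real \<Rightarrow> real \<Rightarrow> bool" where
  "boundary_data t x0 d0 x1 d1 \<longleftrightarrow> x0 = -1 \<and> d0 = 0 \<and> x1 = t"

section \<open>The two constants as optimal energies\<close>

lemma alpha_const_prof:
  assumes "p \<ge> 1"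
  shows "alpha_const p = ereal (2 / 3 powr (3/4)) *
     Inf {Phi w w2 | w w1 w2. prof p 0 1 w w1 w2 \<and> jump_data (w 0) (w1 0) (w 1) (w1 1)}"
proof -
  have "{Phi w ddw | w dw ddw. W2rep p 0 1 w w dw ddw \<and>
            (w \<longlongrightarrow> -1) (at_right 0) \<and> (w \<longlongrightarrow> 1) (at_left 1) \<and>
            (dw \<longlongrightarrow> 0) (at_right 0) \<and> (dw \<longlongrightarrow> 0) (at_left 1)}
      = {Phi w w2 | w w1 w2. prof p 0 1 w w1 w2 \<and> jump_data (w 0) (w1 0) (w 1) (w1 1)}" (is "?L = ?R")
  proof (intro equalityI subsetI)
    fix q assume "q \<in> ?L"
    then obtain w dw ddw where q: "q = Phi w ddw" and W: "W2rep p 0 1 w w dw ddw"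
      and l: "(w \<longlongrightarrow> -1) (at_right 0)" "(w \<longlongrightarrow> 1) (at_left 1)" "(dw \<longlongrightarrow> 0) (at_right 0)" "(dw \<longlongrightarrow> 0) (at_left 1)" by auto
    obtain v v1 where v: "prof p 0 1 v v1 ddw" "\<And>x. x \<in> {0<..<1} \<Longrightarrow> v x = w x" "\<And>x. x \<in> {0<..<1} \<Longrightarrow> v1 x = dw x"
      using prof_of_W2rep[OF W assms] by auto
    have "jump_data (v 0) (v1 0) (v 1) (v1 1)"
      using limit_agree_right[of w "-1" 0 1 v] limit_agree_left[of w 1 1 0 v] limit_agree_right[of dw 0 0 1 v1]
        limit_agree_left[of dw 0 1 0 v1] l v prof_continuous[OF v(1)] by (simp add: jump_data_def)
    moreover have "q = Phi v ddw" unfolding q using v(2) by (intro Phi_cong) auto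
    ultimately show "q \<in> ?R" using v(1) by blast
  next
    fix q assume "q \<in> ?R"
    then obtain w w1 w2 where q: "q = Phi w w2" "prof p 0 1 w w1 w2" "jump_data (w 0) (w1 0) (w 1) (w1 1)" by blast
    then show "q \<in> ?L" using W2rep_of_prof[OF q(2) assms] unfolding jump_data_def by auto
  qed
  then show ?thesis unfolding alpha_const_def by simp
qed

lemma beta_fun_prof:
  assumes "p \<ge> 1"
  shows "beta_fun p t = ereal (4 / 3 powr (3/4)) *
     Inf {Phi w w2 | w w1 w2. prof p 0 1 w w1 w2 \<and> boundary_data t (w 0) (w1 0) (w 1) (w1 1)}"
proof -
  have "{Phi w ddw | w dw ddw. W2rep p 0 1 w w dw ddw \<and>
            (w \<longlongrightarrow> -1) (at_right 0) \<and> (w \<longlongrightarrow> t) (at_left 1) \<and> (dw \<longlongrightarrow> 0) (at_right 0)}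
      = {Phi w w2 | w w1 w2. prof p 0 1 w w1 w2 \<and> boundary_data t (w 0) (w1 0) (w 1) (w1 1)}" (is "?L = ?R")
  proof (intro equalityI subsetI)
    fix q assume "q \<in> ?L"
    then obtain w dw ddw where q: "q = Phi w ddw" and W: "W2rep p 0 1 w w dw ddw"
      and l: "(w \<longlongrightarrow> -1) (at_right 0)" "(w \<longlongrightarrow> t) (at_left 1)" "(dw \<longlongrightarrow> 0) (at_right 0)" by auto
    obtain v v1 where v: "prof p 0 1 v v1 ddw" "\<And>x. x \<in> {0<..<1} \<Longrightarrow> v x = w x" "\<And>x. x \<in> {0<..<1} \<Longrightarrow> v1 x = dw x"
      using prof_of_W2rep[OF W assms] by auto
    have "boundary_data t (v 0) (v1 0) (v 1) (v1 1)"
      using limit_agree_right[of w "-1" 0 1 v] limit_agree_left[of w t 1 0 v] limit_agree_right[of dw 0 0 1 v1]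
        l v prof_continuous[OF v(1)] by (simp add: boundary_data_def)
    moreover have "q = Phi v ddw" unfolding q using v(2) by (intro Phi_cong) auto
    ultimately show "q \<in> ?R" using v(1) by blast
  next
    fix q assume "q \<in> ?R"
    then obtain w w1 w2 where q: "q = Phi w w2" "prof p 0 1 w w1 w2" "boundary_data t (w 0) (w1 0) (w 1) (w1 1)" by blast
    then show "q \<in> ?L" using W2rep_of_prof[OF q(2) assms] unfolding boundary_data_def by auto
  qed
  then show ?thesis unfolding beta_fun_def by simp
qed

lemma en_finite:
  assumes "continuous_on {c..d} w" "continuous_on {c..d} w2"
  shows "en c d w w2 < \<infinity>"
proof -
  have "Lp 1 c d (\<lambda>x. (w x ^ 2 - 1) ^ 2 + (w2 x) ^ 2)"
    by (intro Lp_cont continuous_intros assms) simp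
  then show ?thesis by (simp add: Lp_def en_def)
qed

lemma alpha_optimal:
  assumes "p \<ge> 1"
  obtains K where "optimal_energy p jump_data K" "alpha_const p = ereal (K/2)"
proof -
  let ?I = "Inf {Phi w w2 | w w1 w2. prof p 0 1 w w1 w2 \<and> jump_data (w 0) (w1 0) (w 1) (w1 1)}"
  \<comment> \<open>Any profile of finite energy will do; this is the cubic step from -1 to 1 with
    vanishing slope at 0 and 1.\<close>
  have v: "prof p 0 1 (\<lambda>x. -1 + (6*x^2 + (-4)*x^3)) (\<lambda>x. 0 + (2*6*x + 3*(-4)*x^2)) (\<lambda>x. 0 + (2*6 + 6*(-4)*x))"
    by (intro prof_add prof_const prof_cubic) (use assms in auto)
  have fin: "en 0 1 (\<lambda>x. -1 + (6*x^2 + (-4)*x^3)) (\<lambda>x. 0 + (2*6 + 6*(-4)*x)) < \<infinity>"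
    by (intro en_finite continuous_intros)
  obtain K where K: "optimal_energy p jump_data K" "ereal (4 / 3 powr (3/4)) * ?I = ereal K"
    by (rule optimal_cost[OF _ v _ fin, of jump_data]) (auto simp: jump_data_def)
  \<comment> \<open>\<alpha> is normalised per unit of variation and a jump has height 2, so it is
    half of the cost \<open>K\<close> of one transition.\<close>
  have "ereal (2 / 3 powr (3/4)) * ?I = ereal (1/2) * (ereal (4 / 3 powr (3/4)) * ?I)"
    by (simp add: mult.assoc[symmetric])
  then have "alpha_const p = ereal (K/2)" unfolding alpha_const_prof[OF assms] K(2) by simp
  with K(1) show ?thesis by (rule that)
qed

lemma beta_optimal:
  assumes "p \<ge> 1"
  obtains K where "optimal_energy p (boundary_data t) K" "beta_fun p t = ereal K"
proof -
  have v: "prof p 0 1 (\<lambda>x. -1 + ((t+1)*x^2 + 0*x^3)) (\<lambda>x. 0 + (2*(t+1)*x + 3*0*x^2)) (\<lambda>x. 0 + (2*(t+1) + 6*0*x))"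
    by (intro prof_add prof_const prof_cubic) (use assms in auto)
  have fin: "en 0 1 (\<lambda>x. -1 + ((t+1)*x^2 + 0*x^3)) (\<lambda>x. 0 + (2*(t+1) + 6*0*x)) < \<infinity>"
    by (intro en_finite continuous_intros)
  show ?thesis
    by (rule optimal_cost[OF _ v _ fin, of "boundary_data t"])
       (auto simp: boundary_data_def intro!: that simp: beta_fun_prof[OF assms])
qed

text \<open>Multiplication by \<open>- s\<close> moves the well \<open>s\<close> to -1, where the
  normalised profiles start. It sends a boundary value c to \<open>- c * s\<close>, which is the
  argument of \<beta> in the limit functional.\<close>

lemma sign_flip_dist:
  fixes s x c :: real
  assumes "s = 1 \<or> s = -1"
  shows "\<bar>(- s) * x - (- 1)\<bar> = \<bar>x - s\<bar>" "\<bar>(- s) * x - (- c * s)\<bar> = \<bar>x - c\<bar>" "\<bar>(- s) * x - 0\<bar> = \<bar>x\<bar>" "\<bar>(- s) * x - 1\<bar> = \<bar>x - (- s)\<bar>"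
  using assms by auto

section \<open>Blown-up sequences of bounded energy: number of jumps and sharp lower bound\<close>

locale rescaled_sequence =
  fixes a b p C :: real and u :: "real \<Rightarrow> real" and e :: "nat \<Rightarrow> real" and W W1 W2 :: "nat \<Rightarrow> real \<Rightarrow> real"
  assumes ab: "a < b" and p: "p \<ge> 1" and C: "C \<ge> 0" and e_pos: "\<And>n. e n > 0" and e_lim: "e \<longlonglongrightarrow> 0"
    and prof: "\<And>n. prof p (a / e n) (b / e n) (W n) (W1 n) (W2 n)"
    and energy: "\<And>n. en (a / e n) (b / e n) (W n) (W2 n) \<le> ennreal C"
    and conv: "(\<lambda>n. \<integral>\<^sup>+ x\<in>{a<..<b}. ennreal (\<bar>W n (x / e n) - u x\<bar> powr p) \<partial>lborel) \<longlonglongrightarrow> 0"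
begin


lemma e_small: "r > 0 \<Longrightarrow> \<forall>\<^sub>F n in sequentially. e n < r"
  using e_lim order_tendstoD(2) by blast

lemma scale_le: "x / e n \<le> y / e n \<longleftrightarrow> x \<le> y" "x / e n < y / e n \<longleftrightarrow> x < y"
  using e_pos[of n] by (auto simp: divide_le_cancel divide_less_cancel)

lemma scaled_distance:
  assumes xy: "a \<le> x" "x < y" "y \<le> b" and AE: "AE z in lborel. z \<in> {x<..<y} \<longrightarrow> u z = t"
  shows "Lp_dist p (x / e n) (y / e n) (W n) (\<lambda>_. t)
    \<le> ennreal (1 / e n) * (Lp_dist p a b (\<lambda>x. W n (x / e n)) u)"
proof -
  have P: "prof p (x / e n) (y / e n) (W n) (W1 n) (W2 n)"
    using prof_restrict[OF prof[of n]] xy by (simp add: scale_le)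
  have "Lp_dist p ((1/e n)*x+0) ((1/e n)*y+0) (W n) (\<lambda>_. t)
     = ennreal (1/e n) * (Lp_dist p x y (\<lambda>z. W n ((1/e n)*z+0)) (\<lambda>_. t))"
    using e_pos[of n] dist_density_measurable[OF P, of t] by (intro nn_interval_affine) auto
  also have "Lp_dist p x y (\<lambda>z. W n ((1/e n)*z+0)) (\<lambda>_. t)
     = Lp_dist p x y (\<lambda>z. W n (z / e n)) u"
    by (rule nn_integral_cong_AE) (use AE in eventually_elim, auto simp: indicator_def)
  also have "\<dots> \<le> Lp_dist p a b (\<lambda>x. W n (x / e n)) u"
    by (rule nn_interval_mono) (use xy in auto)
  finally show ?thesis by (simp add: mult_left_mono)
qed

text \<open>After the blow-up the window has length (y - x)/\<open>e n\<close>, while energy plus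
  distance is at most C + o(1/\<open>e n\<close>); the average over unit cells tends to zero and
  \<open>good_point\<close> applies. The margin 2 at each end leaves room for the unit-length
  corrections between cut points.\<close>

lemma good_point_window:
  assumes xy: "a \<le> x" "x < y" "y \<le> b" and AE: "AE z in lborel. z \<in> {x<..<y} \<longrightarrow> u z = t" and \<kappa>: "\<kappa> > 0"
  shows "\<forall>\<^sub>F n in sequentially. \<exists>g. x / e n + 2 \<le> g \<and> g \<le> y / e n - 2 \<and> \<bar>W n g - t\<bar> \<le> \<kappa> \<and> \<bar>W1 n g\<bar> \<le> \<kappa>"
proof -
  define \<eta> where "\<eta> = min (\<kappa>^2/4) ((\<kappa>/12) powr p / 3)"
  have \<eta>: "\<eta> > 0" using \<kappa> by (simp add: \<eta>_def)
  define l where "l = y - x"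
  have l: "l > 0" using xy by (simp add: l_def)
  have "\<forall>\<^sub>F n in sequentially. (Lp_dist p a b (\<lambda>x. W n (x / e n)) u) < ennreal (\<eta> * l / 4)"
    using order_tendstoD(2)[OF conv, of "ennreal (\<eta> * l / 4)"] \<eta> l by simp
  moreover have "\<forall>\<^sub>F n in sequentially. e n < l / 10" using l by (intro e_small) auto
  \<comment> \<open>Guarantees C < \<eta> l/(4 \<open>e n\<close>). The rescaled distance is at most
    \<eta> l/(4 \<open>e n\<close>) as well, so the sum stays below \<eta> l/(2 \<open>e n\<close>)
    \<le> K \<eta>.\<close>
  moreover have "\<forall>\<^sub>F n in sequentially. e n < \<eta> * l / (4 * C + 4)" using l \<eta> C by (intro e_small) auto
  ultimately show ?thesis
  proof eventually_elim
    case (elim n)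
    have en0: "e n > 0" by (rule e_pos)
    \<comment> \<open>The number of unit cells left after removing 2 at each end. The floor costs at
      most one more, and l/\<open>e n\<close> > 10 keeps at least half of the window.\<close>
    define K where "K = nat \<lfloor>l / e n - 4\<rfloor>"
    have le10: "l / e n > 10" using elim(2) en0 l by (simp add: field_simps)
    have K1: "real K \<le> l / e n - 4" "real K \<ge> l / e n - 5"
      using le10 by (simp_all add: K_def) linarith+
    have K2: "real K \<ge> l / (2 * e n)"
    proof -
      have "l / (2 * e n) = (l / e n) / 2" by simp
      then show ?thesis using K1 le10 by linarith
    qed
    have K\<eta>: "real K * \<eta> \<ge> (l / (2 * e n)) * \<eta>" using K2 \<eta> by (intro mult_right_mono) auto
    have P: "prof p (x / e n) (y / e n) (W n) (W1 n) (W2 n)"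
      using prof_restrict[OF prof[of n]] xy by (simp add: scale_le)
    have range: "x / e n \<le> x / e n + 2" "x / e n + 2 + real K \<le> y / e n - 2"
    proof -
      have "l / e n = y / e n - x / e n" by (simp add: l_def diff_divide_distrib)
      then show "x / e n \<le> x / e n + 2" "x / e n + 2 + real K \<le> y / e n - 2" using K1 by linarith+
    qed
    let ?D = "\<integral>\<^sup>+ z\<in>{x/e n + 2<..<x/e n + 2 + real K}. ennreal (\<bar>W n z - t\<bar> powr p) \<partial>lborel"
    have "?D \<le> Lp_dist p (x / e n) (y / e n) (W n) (\<lambda>_. t)"
      by (rule nn_interval_mono) (use range in auto)
    also have "\<dots> \<le> ennreal (1 / e n) * (Lp_dist p a b (\<lambda>x. W n (x / e n)) u)"
      by (rule scaled_distance[OF xy AE])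
    also have "\<dots> \<le> ennreal (1 / e n) * ennreal (\<eta> * l / 4)" using elim(1) by (intro mult_left_mono) auto
    also have "\<dots> = ennreal (\<eta> * l / (4 * e n))" using en0 by (simp add: ennreal_mult'[symmetric] mult.commute)
    finally have D: "?D \<le> ennreal (\<eta> * l / (4 * e n))" .
    have "en (x/e n + 2) (x/e n + 2 + real K) (W n) (W2 n) \<le> en (a / e n) (b / e n) (W n) (W2 n)"
      using range xy scale_le(1)[of a n x] scale_le(1)[of y n b] by (intro en_mono) linarith+
    also have "\<dots> \<le> ennreal C" by (rule energy)
    finally have "en (x/e n + 2) (x/e n + 2 + real K) (W n) (W2 n) + ?D \<le> ennreal C + ennreal (\<eta> * l / (4 * e n))"
      using D by (intro add_mono)
    also have "\<dots> = ennreal (C + \<eta> * l / (4 * e n))" using C \<eta> l en0 by (simp add: ennreal_plus)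
    also have "\<dots> < ennreal (real K * \<eta>)"
    proof (rule ennreal_lessI)
      have "C * (4 * e n) < \<eta> * l"
      proof -
        have "C * (4 * e n) \<le> (4*C+4) * e n" using en0 by (simp add: algebra_simps)
        also have "\<dots> < \<eta> * l" using elim(3) C by (simp add: field_simps)
        finally show ?thesis .
      qed
      then have "C < \<eta> * l / (4 * e n)" using en0 by (simp add: pos_less_divide_eq)
      moreover have "(l / (2 * e n)) * \<eta> = 2 * (\<eta> * l / (4 * e n))" by simp
      ultimately show "C + \<eta> * l / (4 * e n) < real K * \<eta>" using K\<eta> by linarith
      have "0 < (l / (2 * e n)) * \<eta>" using l en0 \<eta> by simp
      then show "0 < real K * \<eta>" using K\<eta> by linarith
    qed
    also have "ennreal (real K * \<eta>) = of_nat K * ennreal \<eta>" by (simp add: ennreal_mult' ennreal_of_nat_eq_real_of_nat)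
    finally have small: "en (x/e n + 2) (x/e n + 2 + real K) (W n) (W2 n) + ?D < of_nat K * ennreal (min (\<kappa>^2/4) ((\<kappa>/12) powr p / 3))"
      unfolding \<eta>_def .
    obtain g where "x / e n + 2 \<le> g" "g \<le> x / e n + 2 + real K" "\<bar>W n g - t\<bar> \<le> \<kappa>" "\<bar>W1 n g\<bar> \<le> \<kappa>"
      by (rule good_point[OF P p range(1) _ \<kappa> small]) (use range in linarith)
    then show ?case using range by (intro exI[of _ g]) auto
  qed
qed

text \<open>For large \<open>n\<close> the profile changes sign between consecutive points of the
  alternation and hence has a zero there; blown up, these points are at least 2 apart, so
  \<open>zero_costs\<close> applies to each gap.\<close>

lemma alternation_energy:
  assumes E: "\<And>x. x \<in> E \<Longrightarrow> x \<in> {a<..<b} \<and> u x \<in> {1,-1} \<and> (\<lambda>n. W n (x / e n)) \<longlonglongrightarrow> u x"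
    and "alternation u E N t g"
  shows "\<forall>\<^sub>F n in sequentially. ennreal (real N / 100) \<le> en (a / e n) (g / e n) (W n) (W2 n)"
  using assms(2)
proof induction
  case (alternation_Suc N t g h)
  have gE: "g \<in> E" "u g = t" using alternation_end[OF alternation_Suc(1)] .
  note g = E[OF gE(1)] and h = E[OF alternation_Suc(2)]
  have t: "t \<in> {1,-1}" using g gE by simp
  have "\<forall>\<^sub>F n in sequentially. dist (W n (g / e n)) t < 1" "\<forall>\<^sub>F n in sequentially. dist (W n (h / e n)) (-t) < 1"
    using g h gE alternation_Suc(4) tendstoD[of _ _ sequentially 1] by auto
  moreover have "\<forall>\<^sub>F n in sequentially. e n < (h - g) / 2" using alternation_Suc(3) by (intro e_small) auto
  ultimately show ?case using alternation_Suc.IH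
  proof eventually_elim
    case (elim n)
    have P: "prof p (g / e n) (h / e n) (W n) (W1 n) (W2 n)"
      using prof_restrict[OF prof[of n]] g h alternation_Suc(3) by (simp add: scale_le)
    have le: "g / e n + 2 \<le> h / e n"
    proof -
      have "2 \<le> (h - g) / e n" using elim(3) e_pos[of n] by (simp add: pos_le_divide_eq)
      then show ?thesis by (simp add: diff_divide_distrib)
    qed
    have cont: "continuous_on {g / e n..h / e n} (W n)" using prof_continuous(1)[OF P] .
    have "\<exists>z. g / e n \<le> z \<and> z \<le> h / e n \<and> W n z = 0"
    proof (cases "t = 1")
      case True
      then show ?thesis using elim(1,2) IVT2'[of "W n" "h / e n" 0 "g / e n"] cont le by (auto simp: dist_real_def)
    next
      case False
      then have "t = -1" using t by auto
      then show ?thesis using elim(1,2) IVT'[of "W n" "g / e n" 0 "h / e n"] cont le by (auto simp: dist_real_def)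
    qed
    then obtain z where "z \<in> {g / e n..h / e n}" "W n z = 0" by auto
    from zero_costs[OF P p this le] have z: "ennreal (1/100) \<le> en (g / e n) (h / e n) (W n) (W2 n)" .
    have "en (a / e n) (h / e n) (W n) (W2 n) = en (a / e n) (g / e n) (W n) (W2 n) + en (g / e n) (h / e n) (W n) (W2 n)"
      using g h alternation_Suc(3) prof_restrict[OF prof[of n], of "a / e n" "h / e n"] by (intro en_split) (auto simp: scale_le)
    moreover have "ennreal (real (Suc N) / 100) = ennreal (real N / 100) + ennreal (1/100)"
      by (subst ennreal_plus[symmetric]) (auto simp: add_divide_distrib)
    ultimately show ?case using add_mono[OF elim(4) z] by simp
  qed
qed simp

lemma alternation_bounded:
  assumes E: "\<And>x. x \<in> E \<Longrightarrow> x \<in> {a<..<b} \<and> u x \<in> {1,-1} \<and> (\<lambda>n. W n (x / e n)) \<longlonglongrightarrow> u x"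
    and A: "alternation u E N t g"
  shows "real N \<le> 100 * C"
proof -
  have "\<forall>\<^sub>F n in sequentially. ennreal (real N / 100) \<le> en (a / e n) (g / e n) (W n) (W2 n)"
    using alternation_energy[OF assms] .
  then obtain n where n: "ennreal (real N / 100) \<le> en (a / e n) (g / e n) (W n) (W2 n)"
    by (auto simp: eventually_sequentially)
  also have "\<dots> \<le> en (a / e n) (b / e n) (W n) (W2 n)"
    using E[OF alternation_end(1)[OF A]] by (intro en_mono) (auto simp: scale_le)
  also have "\<dots> \<le> ennreal C" by (rule energy)
  finally show ?thesis using C by (simp add: ennreal_le_iff)
qed


lemma small_eta:
  assumes "\<delta> > 0"
  obtains \<eta> where "0 < \<eta>" "\<eta> \<le> 1" "\<eta> * (99 * C + 396) \<le> \<delta>"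
proof (rule that[of "min 1 (\<delta> / (99 * C + 396))"])
  have "min 1 (\<delta> / (99 * C + 396)) * (99 * C + 396) \<le> (\<delta> / (99 * C + 396)) * (99 * C + 396)"
    using C by (intro mult_right_mono) auto
  also have "\<dots> = \<delta>" using C by simp
  finally show "min 1 (\<delta> / (99 * C + 396)) * (99 * C + 396) \<le> \<delta>" .
qed (use assms C in auto)

text \<open>The cost is collected from the left: the boundary layer at \<open>a\<close>, then one
  jump per step, always cut at a point almost at rest in the current well. The tolerances \<kappa>
  and \<delta> are generalised in the induction, because the next transition dictates how close to
  rest the previous cut has to be and takes half of the error.\<close>

lemma sharp_energy:
  assumes S: "steps u s a N t y" and yb: "y \<le> b"
    and K: "optimal_energy p jump_data K" and B: "optimal_energy p (boundary_data (- a0 * s)) B"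
    and bdry: "(\<lambda>n. W n (a / e n)) \<longlonglongrightarrow> a0" and \<kappa>: "\<kappa> > 0" and \<delta>: "\<delta> > 0"
  shows "\<forall>\<^sub>F n in sequentially. \<exists>g. a / e n + 2 \<le> g \<and> g \<le> y / e n - 2 \<and> \<bar>W n g - t\<bar> \<le> \<kappa> \<and> \<bar>W1 n g\<bar> \<le> \<kappa> \<and>
     ennreal (B + K * real N) \<le> en (a / e n) g (W n) (W2 n) + ennreal \<delta>"
proof -
  have sub_energy: "en c d (W n) (W2 n) \<le> ennreal C" if "a / e n \<le> c" "d \<le> b / e n" for c d n
    using en_mono[OF that] energy[of n] order_trans by blast
  have s: "s = 1 \<or> s = -1" using steps_basic(2)[OF S] by auto
  show ?thesis
    using S yb \<kappa> \<delta>
  proof (induction arbitrary: \<kappa> \<delta>)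
    case (steps_one y)
    obtain \<eta> where \<eta>: "0 < \<eta>" "\<eta> \<le> 1" "\<eta> * (99 * C + 396) \<le> \<delta>" by (rule small_eta[OF steps_one.prems(3)])
    define \<kappa>' where "\<kappa>' = min \<kappa> (\<eta>/13)"
    have \<kappa>': "\<kappa>' > 0" "\<kappa>' \<le> \<kappa>" "\<kappa>' \<le> \<eta>/13" using steps_one \<eta> by (auto simp: \<kappa>'_def)
    have "\<forall>\<^sub>F n in sequentially. \<exists>g. a / e n + 2 \<le> g \<and> g \<le> y / e n - 2 \<and> \<bar>W n g - s\<bar> \<le> \<kappa>' \<and> \<bar>W1 n g\<bar> \<le> \<kappa>'"
      by (rule good_point_window) (use steps_one \<kappa>' in auto)
    moreover have "\<forall>\<^sub>F n in sequentially. dist (W n (a / e n)) a0 < \<eta>/13"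
      using \<eta> by (intro tendstoD bdry) auto
    ultimately show ?case
    proof eventually_elim
      case (elim n)
      then obtain g where g: "a / e n + 2 \<le> g" "g \<le> y / e n - 2" "\<bar>W n g - s\<bar> \<le> \<kappa>'" "\<bar>W1 n g\<bar> \<le> \<kappa>'" by auto
      have gb: "g \<le> b / e n" using g steps_one(4) scale_le(1)[of y n b] by linarith
      have P: "prof p (a / e n) g (W n) (W1 n) (W2 n)"
        by (rule prof_restrict[OF prof[of n]]) (use g gb in linarith)+
      \<comment> \<open>\<open>boundary_data\<close> starts at rest and ends at the boundary value,
        whereas here the boundary is on the left; hence the reflection.\<close>
      note P' = prof_reflect[OF P]
      have eq: "en (- g) (- (a / e n)) (\<lambda>x. W n (- x)) (\<lambda>x. W2 n (- x)) = en (a / e n) g (W n) (W2 n)"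
        by (rule en_reflect[OF P])
      have near: "\<bar>(- s) * W n (- (- g)) - (- 1)\<bar> \<le> \<eta>/13" "\<bar>(- s) * (- W1 n (- (- g))) - 0\<bar> \<le> \<eta>/13"
        "\<bar>(- s) * W n (- (- (a / e n))) - (- a0 * s)\<bar> \<le> \<eta>/13"
        unfolding sign_flip_dist[OF s] using g(3,4) elim(2) \<kappa>' by (simp_all add: dist_real_def)
      have "ennreal B \<le> en (- g) (- (a / e n)) (\<lambda>x. W n (- x)) (\<lambda>x. W2 n (- x)) + ennreal (\<eta> * (99 * C + 396))"
      proof (rule lower_bound_perturbed[where Q = "boundary_data (- a0 * s)", OF B P' p _ \<eta>(1,2) _ _ near])
        show "- g + 1 < - (a / e n)" using g by simp
        show "en (- g) (- (a / e n)) (\<lambda>x. W n (- x)) (\<lambda>x. W2 n (- x)) \<le> ennreal C"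
          unfolding eq by (rule sub_energy) (use gb in auto)
        show "boundary_data (- a0 * s) (- 1) 0 (- a0 * s) (- s * - W1 n (- (- (a / e n))))"
          by (simp add: boundary_data_def)
      qed (use s C \<eta> in auto)
      also have "\<dots> \<le> en (a / e n) g (W n) (W2 n) + ennreal \<delta>"
        unfolding eq using \<eta> by (intro add_left_mono ennreal_leI)
      finally show ?case using g \<kappa>' by (intro exI[of _ g]) auto
    qed
  next
    case (steps_snoc N t y z)
    obtain \<eta> where \<eta>: "0 < \<eta>" "\<eta> \<le> 1" "\<eta> * (99 * C + 396) \<le> \<delta>/2" by (rule small_eta[OF half_gt_zero[OF steps_snoc.prems(3)]])
    define \<kappa>' where "\<kappa>' = min \<kappa> (\<eta>/13)"
    have \<kappa>': "\<kappa>' > 0" "\<kappa>' \<le> \<kappa>" "\<kappa>' \<le> \<eta>/13" using steps_snoc \<eta> by (auto simp: \<kappa>'_def)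
    have t: "t = 1 \<or> t = -1" and ay: "a < y" using steps_basic[OF steps_snoc(1)] by auto
    have "\<forall>\<^sub>F n in sequentially. \<exists>g. y / e n + 2 \<le> g \<and> g \<le> z / e n - 2 \<and> \<bar>W n g - (- t)\<bar> \<le> \<kappa>' \<and> \<bar>W1 n g\<bar> \<le> \<kappa>'"
      by (rule good_point_window) (use steps_snoc \<kappa>' ay in auto)
    moreover have "\<forall>\<^sub>F n in sequentially. \<exists>g. a / e n + 2 \<le> g \<and> g \<le> y / e n - 2 \<and> \<bar>W n g - t\<bar> \<le> \<kappa>' \<and> \<bar>W1 n g\<bar> \<le> \<kappa>' \<and>
       ennreal (B + K * real N) \<le> en (a / e n) g (W n) (W2 n) + ennreal (\<delta>/2)"
      by (rule steps_snoc.IH) (use steps_snoc.hyps steps_snoc.prems \<kappa>' in auto)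
    ultimately show ?case
    proof eventually_elim
      case (elim n)
      obtain h where h: "y / e n + 2 \<le> h" "h \<le> z / e n - 2" "\<bar>W n h - (- t)\<bar> \<le> \<kappa>'" "\<bar>W1 n h\<bar> \<le> \<kappa>'" using elim(1) by auto
      obtain g where g: "a / e n + 2 \<le> g" "g \<le> y / e n - 2" "\<bar>W n g - t\<bar> \<le> \<kappa>'" "\<bar>W1 n g\<bar> \<le> \<kappa>'"
        "ennreal (B + K * real N) \<le> en (a / e n) g (W n) (W2 n) + ennreal (\<delta>/2)" using elim(2) by auto
      have hb: "h \<le> b / e n" using h steps_snoc.prems(1) scale_le(1)[of z n b] by linarith
      have P: "prof p g h (W n) (W1 n) (W2 n)"
        by (rule prof_restrict[OF prof[of n]]) (use g h hb in linarith)+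
      \<comment> \<open>The factor \<open>- t\<close> turns the jump from \<open>t\<close> to
        \<open>- t\<close> into the normalised one from -1 to 1.\<close>
      have near: "\<bar>(- t) * W n g - (- 1)\<bar> \<le> \<eta>/13" "\<bar>(- t) * W1 n g - 0\<bar> \<le> \<eta>/13"
        "\<bar>(- t) * W n h - 1\<bar> \<le> \<eta>/13" "\<bar>(- t) * W1 n h - 0\<bar> \<le> \<eta>/13"
        unfolding sign_flip_dist[OF t] using g(3,4) h(3,4) \<kappa>' by simp_all
      have "ennreal K \<le> en g h (W n) (W2 n) + ennreal (\<eta> * (99 * C + 396))"
      proof (rule lower_bound_perturbed[where Q = jump_data, OF K P p _ \<eta>(1,2) _ _ near])
        show "g + 1 < h" using g h by simp
        show "en g h (W n) (W2 n) \<le> ennreal C" by (rule sub_energy) (use g hb in auto)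
        show "jump_data (- 1) 0 1 0" by (simp add: jump_data_def)
      qed (use t C \<eta> in auto)
      also have "\<dots> \<le> en g h (W n) (W2 n) + ennreal (\<delta>/2)"
        using \<eta> by (intro add_left_mono ennreal_leI)
      finally have K': "ennreal K \<le> en g h (W n) (W2 n) + ennreal (\<delta>/2)" .
      have "B + K * real (Suc N) = (B + K * real N) + K" by (simp add: algebra_simps)
      then have "ennreal (B + K * real (Suc N)) = ennreal (B + K * real N) + ennreal K"
        using optimal_energyD(1)[OF B] optimal_energyD(1)[OF K] by (simp add: ennreal_plus)
      also have "\<dots> \<le> (en (a / e n) g (W n) (W2 n) + ennreal (\<delta>/2)) + (en g h (W n) (W2 n) + ennreal (\<delta>/2))"
        using g K' by (intro add_mono)
      also have "\<dots> = (en (a / e n) g (W n) (W2 n) + en g h (W n) (W2 n)) + (ennreal (\<delta>/2) + ennreal (\<delta>/2))"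
        by (simp add: ac_simps)
      also have "ennreal (\<delta>/2) + ennreal (\<delta>/2) = ennreal \<delta>" using steps_snoc.prems by (simp add: ennreal_plus[symmetric])
      also have "en (a / e n) g (W n) (W2 n) + en g h (W n) (W2 n) = en (a / e n) h (W n) (W2 n)"
        by (rule en_split[OF prof_restrict[OF prof[of n]], symmetric]) (use g h hb in linarith)+
      finally show ?case using h g \<kappa>' by (intro exI[of _ h]) auto
    qed
  qed
qed

text \<open>The boundary layer at \<open>b\<close>, which already has the orientation of
  \<open>boundary_data\<close>, is added to the energy collected up to a cut in the last
  piece.\<close>

lemma sharp_lower_bound:
  assumes S: "steps u s a N t b"
    and K: "optimal_energy p jump_data K" and B: "optimal_energy p (boundary_data (- a0 * s)) B"
    and B': "optimal_energy p (boundary_data (- b0 * t)) B'"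
    and bdry: "(\<lambda>n. W n (a / e n)) \<longlonglongrightarrow> a0" "(\<lambda>n. W n (b / e n)) \<longlonglongrightarrow> b0"
  shows "B + K * real N + B' \<le> C"
proof (rule field_le_epsilon)
  fix \<delta> :: real assume \<delta>: "\<delta> > 0"
  obtain \<eta> where \<eta>: "0 < \<eta>" "\<eta> \<le> 1" and \<eta>3: "\<eta> * (99 * C + 396) \<le> \<delta>/2"
    by (rule small_eta[OF half_gt_zero[OF \<delta>]])
  have t: "t = 1 \<or> t = -1" using steps_basic[OF S] by auto
  have "\<forall>\<^sub>F n in sequentially. \<exists>g. a / e n + 2 \<le> g \<and> g \<le> b / e n - 2 \<and> \<bar>W n g - t\<bar> \<le> \<eta>/13 \<and> \<bar>W1 n g\<bar> \<le> \<eta>/13 \<and>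
     ennreal (B + K * real N) \<le> en (a / e n) g (W n) (W2 n) + ennreal (\<delta>/2)"
    by (rule sharp_energy[OF S _ K B bdry(1)]) (use \<delta> \<eta> in auto)
  moreover have "\<forall>\<^sub>F n in sequentially. dist (W n (b / e n)) b0 < \<eta>/13"
    using \<eta> by (intro tendstoD bdry) auto
  ultimately have "\<forall>\<^sub>F n in sequentially. B + K * real N + B' \<le> C + \<delta>"
  proof eventually_elim
    case (elim n)
    then obtain g where g: "a / e n + 2 \<le> g" "g \<le> b / e n - 2" "\<bar>W n g - t\<bar> \<le> \<eta>/13" "\<bar>W1 n g\<bar> \<le> \<eta>/13"
        "ennreal (B + K * real N) \<le> en (a / e n) g (W n) (W2 n) + ennreal (\<delta>/2)" by auto
    have P: "prof p g (b / e n) (W n) (W1 n) (W2 n)"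
      by (rule prof_restrict[OF prof[of n]]) (use g in linarith)+
    have near: "\<bar>(- t) * W n g - (- 1)\<bar> \<le> \<eta>/13" "\<bar>(- t) * W1 n g - 0\<bar> \<le> \<eta>/13"
      "\<bar>(- t) * W n (b / e n) - (- b0 * t)\<bar> \<le> \<eta>/13"
      unfolding sign_flip_dist[OF t] using g(3,4) elim(2) by (simp_all add: dist_real_def)
    have "ennreal B' \<le> en g (b / e n) (W n) (W2 n) + ennreal (\<eta> * (99 * C + 396))"
    proof (rule lower_bound_perturbed[where Q = "boundary_data (- b0 * t)", OF B' P p _ \<eta> _ _ near])
      show "g + 1 < b / e n" using g by simp
      show "boundary_data (- b0 * t) (- 1) 0 (- b0 * t) (- t * W1 n (b / e n))" by (simp add: boundary_data_def)
      have "en g (b / e n) (W n) (W2 n) \<le> en (a / e n) (b / e n) (W n) (W2 n)" using g by (intro en_mono) auto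
      then show "en g (b / e n) (W n) (W2 n) \<le> ennreal C" using energy[of n] order_trans by blast
    qed (use t C \<eta> in auto)
    also have "\<dots> \<le> en g (b / e n) (W n) (W2 n) + ennreal (\<delta>/2)"
      using \<eta>3 by (intro add_left_mono ennreal_leI)
    finally have B'_le: "ennreal B' \<le> en g (b / e n) (W n) (W2 n) + ennreal (\<delta>/2)" .
    have "ennreal (B + K * real N + B') = ennreal (B + K * real N) + ennreal B'"
      by (rule ennreal_plus) (use optimal_energyD(1)[OF B] optimal_energyD(1)[OF K] optimal_energyD(1)[OF B'] in auto)
    also have "\<dots> \<le> (en (a / e n) g (W n) (W2 n) + ennreal (\<delta>/2)) + (en g (b / e n) (W n) (W2 n) + ennreal (\<delta>/2))"
      using g B'_le by (intro add_mono)
    also have "\<dots> = (en (a / e n) g (W n) (W2 n) + en g (b / e n) (W n) (W2 n)) + (ennreal (\<delta>/2) + ennreal (\<delta>/2))"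
      by (simp add: ac_simps)
    also have "ennreal (\<delta>/2) + ennreal (\<delta>/2) = ennreal \<delta>" using \<delta> by (simp add: ennreal_plus[symmetric])
    also have "en (a / e n) g (W n) (W2 n) + en g (b / e n) (W n) (W2 n) = en (a / e n) (b / e n) (W n) (W2 n)"
      by (rule en_split[OF prof[of n], symmetric]) (use g in linarith)+
    also have "\<dots> + ennreal \<delta> \<le> ennreal C + ennreal \<delta>" using energy[of n] by (intro add_right_mono)
    also have "\<dots> = ennreal (C + \<delta>)" using C \<delta> by (simp add: ennreal_plus)
    finally show ?case using C \<delta> by (simp add: ennreal_le_iff)
  qed
  then show "B + K * real N + B' \<le> C + \<delta>" by (simp add: eventually_sequentially) blast
qed

end

section \<open>Compactness and the liminf inequality\<close>

lemma rescale_prof: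
  assumes P: "prof p a b w w1 w2" and e: "e > 0"
  shows "prof p (a/e) (b/e) (\<lambda>x. w (e*x)) (\<lambda>x. e * w1 (e*x)) (\<lambda>x. e^2 * w2 (e*x))"
    "en (a/e) (b/e) (\<lambda>x. w (e*x)) (\<lambda>x. e^2 * w2 (e*x))
      = eps_energy a b e w w2"
proof -
  have P0: "prof p (e*(a/e)+0) (e*(b/e)+0) w w1 w2" using P e by simp
  show "prof p (a/e) (b/e) (\<lambda>x. w (e*x)) (\<lambda>x. e * w1 (e*x)) (\<lambda>x. e^2 * w2 (e*x))"
    using prof_affine[OF P0 e] by simp
  let ?F = "\<lambda>x. ennreal ((w x ^ 2 - 1) ^ 2 / e + e ^ 3 * (w2 x) ^ 2)"
  have m: "(\<lambda>x. ?F x * indicator {a<..<b} x) \<in> borel_measurable lborel"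
    by (rule measurable_density2[OF prof_measurable[OF P], of "\<lambda>x y. (x^2-1)^2 / e + e^3 * y^2"]) measurable
  have m': "(\<lambda>x. ?F (e*x) * indicator {a/e<..<b/e} x) \<in> borel_measurable lborel"
  proof -
    note [measurable] = m[simplified]
    have "(\<lambda>x. (\<lambda>x. ?F x * indicator {a<..<b} x) (e*x)) \<in> borel_measurable borel" by measurable
    moreover have "(\<lambda>x. (\<lambda>x. ?F x * indicator {a<..<b} x) (e*x)) = (\<lambda>x. ?F (e*x) * indicator {a/e<..<b/e} x)"
      using e by (auto simp: fun_eq_iff indicator_def field_simps)
    ultimately show ?thesis by simp
  qed
  have "(\<integral>\<^sup>+ x\<in>{a<..<b}. ?F x \<partial>lborel) = ennreal e * (\<integral>\<^sup>+ x\<in>{a/e<..<b/e}. ?F (e*x+0) \<partial>lborel)"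
    using nn_interval_affine[of ?F e "a/e" 0 "b/e"] m e by simp
  also have "\<dots> = (\<integral>\<^sup>+ x. ennreal e * (?F (e*x) * indicator {a/e<..<b/e} x) \<partial>lborel)"
    using m' by (subst nn_integral_cmult) auto
  also have "\<dots> = en (a/e) (b/e) (\<lambda>x. w (e*x)) (\<lambda>x. e^2 * w2 (e*x))" unfolding en_def
  proof (rule nn_integral_cong)
    fix x
    \<comment> \<open>The Jacobian \<open>e\<close> cancels the 1/e of the potential and completes
      e^3 to (e^2)^2 in the bending term, so no power of \<open>e\<close> is left in front.\<close>
    have "e * ((w (e*x) ^ 2 - 1) ^ 2 / e + e ^ 3 * (w2 (e*x)) ^ 2) = (w (e*x) ^ 2 - 1) ^ 2 + (e^2 * w2 (e*x))^2"
      using e by (simp add: field_simps power2_eq_square power3_eq_cube)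
    then have "ennreal e * ?F (e*x) = ennreal ((w (e*x) ^ 2 - 1) ^ 2 + (e^2 * w2 (e*x))^2)"
      using e by (simp add: ennreal_mult'[symmetric])
    then show "ennreal e * (?F (e*x) * indicator {a/e<..<b/e} x) =
       ennreal ((w (e*x) ^ 2 - 1) ^ 2 + (e^2 * w2 (e*x))^2) * indicator {a/e<..<b/e} x"
      by (simp add: mult.assoc[symmetric])
  qed
  finally show "en (a/e) (b/e) (\<lambda>x. w (e*x)) (\<lambda>x. e^2 * w2 (e*x)) = (\<integral>\<^sup>+ x\<in>{a<..<b}. ?F x \<partial>lborel)" ..
qed

lemma Lp_conv_AE_subseq:
  assumes "\<And>n. Lp p a b (us n)" "Lp p a b u" "p \<ge> 1" "Lp_conv p a b us u"
  obtains r :: "nat \<Rightarrow> nat" where "strict_mono r" "AE x in lborel. x \<in> {a<..<b} \<longrightarrow> (\<lambda>n. us (r n) x) \<longlonglongrightarrow> u x"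
proof -
  let ?h = "\<lambda>n x. indicator {a<..<b} x * (\<bar>us n x - u x\<bar> powr p)"
  have L: "Lp p a b (\<lambda>x. us n x - u x)" for n
    using Lp_add[OF assms(1)[of n] Lp_cmult[OF assms(2), of "-1"] assms(3)] by simp
  have eq: "ennreal (norm (?h n x)) = ennreal (\<bar>us n x - u x\<bar> powr p) * indicator {a<..<b} x" for n x
    by (auto simp: indicator_def)
  have int: "integrable lborel (?h n)" for n
  proof -
    have "(\<lambda>x. (\<lambda>y. \<bar>y\<bar> powr p) (indicator {a<..<b} x * (us n x - u x)) * indicator {a<..<b} x) \<in> borel_measurable lborel"
      using L[of n] by (auto simp: Lp_def set_borel_measurable_def)
    also have "(\<lambda>x. (\<lambda>y. \<bar>y\<bar> powr p) (indicator {a<..<b} x * (us n x - u x)) * indicator {a<..<b} x) = ?h n"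
      by (auto simp: indicator_def fun_eq_iff)
    finally have "?h n \<in> borel_measurable lborel" .
    moreover have "(\<integral>\<^sup>+ x. ennreal (norm (?h n x)) \<partial>lborel) < \<infinity>" unfolding eq using L[of n] by (simp add: Lp_def)
    ultimately show ?thesis by (simp only: integrable_iff_bounded)
  qed
  have "(\<lambda>n. ennreal (\<integral>x. norm (?h n x) \<partial>lborel)) \<longlonglongrightarrow> ennreal 0"
    using assms(4) int unfolding Lp_conv_def
    by (simp add: nn_integral_eq_integral[symmetric] eq integrable_norm del: real_norm_def)
  then have "(\<lambda>n. (\<integral>x. norm (?h n x) \<partial>lborel)) \<longlonglongrightarrow> 0"
    by (subst (asm) tendsto_ennreal_iff) auto
  from tendsto_L1_AE_subseq[OF int this] obtain r :: "nat \<Rightarrow> nat" where r: "strict_mono r"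
    "AE x in lborel. (\<lambda>n. ?h (r n) x) \<longlonglongrightarrow> 0" by auto
  have "AE x in lborel. x \<in> {a<..<b} \<longrightarrow> (\<lambda>n. us (r n) x) \<longlonglongrightarrow> u x"
    using r(2)
  proof eventually_elim
    case (elim x)
    show ?case
    proof
      assume "x \<in> {a<..<b}"
      then have "(\<lambda>n. \<bar>us (r n) x - u x\<bar> powr p) \<longlonglongrightarrow> 0" using elim by simp
      then have "(\<lambda>n. (\<bar>us (r n) x - u x\<bar> powr p) powr (1/p)) \<longlonglongrightarrow> 0"
        by (rule tendsto_zero_powrI[OF _ tendsto_const]) (use assms(3) in auto)
      moreover have "(\<bar>y\<bar> powr p) powr (1/p) = \<bar>y\<bar>" for y :: real using assms(3) by (simp add: powr_powr)
      ultimately have "(\<lambda>n. \<bar>us (r n) x - u x\<bar>) \<longlonglongrightarrow> 0" by simp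
      then show "(\<lambda>n. us (r n) x) \<longlonglongrightarrow> u x" by (simp add: tendsto_rabs_zero_iff LIM_zero_iff)
    qed
  qed
  then show ?thesis using that r(1) by blast
qed

text \<open>Bounded energy forces the limit into the domain where \<open>G_lim\<close> is finite:
  Fatou gives the values 1 and -1, the cap on alternations gives finitely many pieces. The sharp
  bound then holds with the same level \<open>C\<close>. Phrased for a fixed level, the result can
  be applied to subsequences of low energy.\<close>

lemma liminf_inequality:
  assumes ab: "a < b" and p: "p \<ge> 1" and C: "C \<ge> 0" and epos: "\<And>n. e n > 0" and epslim: "e \<longlonglongrightarrow> 0"
    and u: "Lp p a b u" and conv: "Lp_conv p a b us u"
    and W: "\<And>n. W2rep p a b (us n) (v n) (dv n) (ddv n)"
    and lim: "\<And>n. (v n \<longlongrightarrow> A n) (at_right a)" "\<And>n. (v n \<longlongrightarrow> B n) (at_left b)"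
    and energy: "\<And>n. eps_energy a b (e n) (us n) (ddv n) \<le> ennreal C"
    and bdry: "A \<longlonglongrightarrow> a0" "B \<longlonglongrightarrow> b0"
  shows "G_lim p a b a0 b0 u \<le> ereal C"
proof -
  have us: "Lp p a b (us n)" for n using W[of n] by (simp add: W2rep_def)
  obtain r where r: "strict_mono r" "AE x in lborel. x \<in> {a<..<b} \<longrightarrow> (\<lambda>n. us (r n) x) \<longlonglongrightarrow> u x"
    using Lp_conv_AE_subseq[OF us u p conv] by blast
  have "\<exists>w w1. prof p a b w w1 (ddv n) \<and> (\<forall>x\<in>{a<..<b}. w x = v n x)" for n
    by (rule prof_of_W2rep[OF W[of n] p ab]) blast
  then obtain w w1 where P: "\<And>n. prof p a b (w n) (w1 n) (ddv n)" and wv: "\<And>n x. x \<in> {a<..<b} \<Longrightarrow> w n x = v n x"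
    by metis
  have wa: "w n a = A n" "w n b = B n" for n
    using limit_agree_right[OF lim(1) wv prof_continuous(1)[OF P] ab] limit_agree_left[OF lim(2) wv prof_continuous(1)[OF P] ab]
    by auto
  have AEw: "AE x in lborel. x \<in> {a<..<b} \<longrightarrow> us n x = w n x" for n
  proof -
    have "AE x in lborel. x \<in> {a<..<b} \<longrightarrow> us n x = v n x" using W[of n] by (simp add: W2rep_def)
    then show ?thesis by eventually_elim (use wv in auto)
  qed
  let ?W = "\<lambda>n x. w n (e n * x)" and ?W1 = "\<lambda>n x. e n * w1 n (e n * x)" and ?W2 = "\<lambda>n x. (e n)^2 * ddv n (e n * x)"
  have en: "eps_energy a b (e n) (w n) (ddv n) \<le> ennreal C" for n
  proof -
    have "eps_energy a b (e n) (w n) (ddv n)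
       = eps_energy a b (e n) (us n) (ddv n)"
      by (rule nn_integral_cong_AE) (use AEw[of n] in eventually_elim, auto simp: indicator_def)
    then show ?thesis using energy[of n] by simp
  qed
  have Wx: "?W n (x / e n) = w n x" for n x using epos[of n] by simp
  have subseq: "(\<lambda>n. X (r n)) \<longlonglongrightarrow> l" if "X \<longlonglongrightarrow> l" for X :: "nat \<Rightarrow> 'z::topological_space" and l
    using LIMSEQ_subseq_LIMSEQ[OF that r(1)] by (simp add: o_def)
  \<comment> \<open>The subsequence \<open>r\<close> converges pointwise almost everywhere; the sign
    changes in \<open>alternation_energy\<close> are read off from these pointwise limits.\<close>
  interpret rescaled_sequence a b p C u "\<lambda>n. e (r n)" "\<lambda>n. ?W (r n)" "\<lambda>n. ?W1 (r n)" "\<lambda>n. ?W2 (r n)"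
  proof
    show "(\<lambda>n. \<integral>\<^sup>+ x\<in>{a<..<b}. ennreal (\<bar>?W (r n) (x / e (r n)) - u x\<bar> powr p) \<partial>lborel) \<longlonglongrightarrow> 0"
    proof -
      have "Lp_dist p a b (w n) u
         = Lp_dist p a b (us n) u" for n
        by (rule nn_integral_cong_AE) (use AEw[of n] in eventually_elim, auto simp: indicator_def)
      then show ?thesis unfolding Wx using conv subseq[of "\<lambda>n. \<integral>\<^sup>+ x\<in>{a<..<b}. ennreal (\<bar>us n x - u x\<bar> powr p) \<partial>lborel" 0]
        by (simp add: Lp_conv_def)
    qed
  qed (use ab p C epos subseq[OF epslim] rescale_prof[OF P epos] en in auto)
  have AEr: "AE x in lborel. x \<in> {a<..<b} \<longrightarrow> (\<lambda>n. w (r n) x) \<longlonglongrightarrow> u x"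
  proof -
    have "AE x in lborel. \<forall>n. x \<in> {a<..<b} \<longrightarrow> us n x = w n x" using AEw by (subst AE_all_countable) auto
    then show ?thesis using r(2) by eventually_elim auto
  qed
  have u1: "AE x in lborel. x \<in> {a<..<b} \<longrightarrow> u x \<in> {1,-1}"
  proof -
    let ?g = "\<lambda>n x. ennreal ((w (r n) x ^ 2 - 1) ^ 2) * indicator {a<..<b} x"
    let ?gu = "\<lambda>x. ennreal ((u x ^ 2 - 1) ^ 2) * indicator {a<..<b} x"
    have m: "?g n \<in> borel_measurable lborel" for n using potE_measurable[OF P] .
    have mu: "?gu \<in> borel_measurable lborel"
      by (rule measurable_density1[of _ _ u "\<lambda>x. (x^2-1)^2"]) (use u in \<open>auto simp: Lp_def\<close>)
    \<comment> \<open>The potential carries the factor 1/e in the energy, so its integral is at most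
      e C and vanishes in the limit.\<close>
    have small: "(\<integral>\<^sup>+ x. ?g n x \<partial>lborel) \<le> ennreal (e (r n) * C)" for n
    proof -
      let ?e = "e (r n)"
      have "(\<integral>\<^sup>+ x. ?g n x \<partial>lborel) \<le> (\<integral>\<^sup>+ x. ennreal ?e * (ennreal ((w (r n) x ^ 2 - 1) ^ 2 / ?e + ?e ^ 3 * (ddv (r n) x) ^ 2) * indicator {a<..<b} x) \<partial>lborel)"
        using epos[of "r n"] by (intro nn_integral_mono)
          (auto simp: indicator_def ennreal_mult'[symmetric] distrib_left intro!: ennreal_leI)
      also have "\<dots> = ennreal ?e * (eps_energy a b ?e (w (r n)) (ddv (r n)))"
        by (intro nn_integral_cmult measurable_density2[OF prof_measurable[OF P], of "\<lambda>x y. (x^2-1)^2 / ?e + ?e^3 * y^2"]) measurable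
      also have "\<dots> \<le> ennreal ?e * ennreal C" using en by (intro mult_left_mono) auto
      finally show ?thesis using epos[of "r n"] C by (simp add: ennreal_mult')
    qed
    have "(\<lambda>n. ennreal (e (r n) * C)) \<longlonglongrightarrow> ennreal (0 * C)"
      by (intro tendsto_ennrealI tendsto_mult tendsto_const subseq[OF epslim])
    then have "(\<lambda>n. \<integral>\<^sup>+ x. ?g n x \<partial>lborel) \<longlonglongrightarrow> 0"
      by (intro tendsto_sandwich[where f = "\<lambda>_. 0" and g = "\<lambda>n. \<integral>\<^sup>+ x. ?g n x \<partial>lborel" and h = "\<lambda>n. ennreal (e (r n) * C)"])
         (use small in auto)
    then have "liminf (\<lambda>n. \<integral>\<^sup>+ x. ?g n x \<partial>lborel) = 0" by (intro lim_imp_Liminf) auto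
    then have "(\<integral>\<^sup>+ x. liminf (\<lambda>n. ?g n x) \<partial>lborel) = 0"
      using nn_integral_liminf[of ?g lborel] m by simp
    moreover have "(\<integral>\<^sup>+ x. ?gu x \<partial>lborel) = (\<integral>\<^sup>+ x. liminf (\<lambda>n. ?g n x) \<partial>lborel)"
    proof (rule nn_integral_cong_AE, use AEr in eventually_elim)
      fix x assume x: "x \<in> {a<..<b} \<longrightarrow> (\<lambda>n. w (r n) x) \<longlonglongrightarrow> u x"
      have "(\<lambda>n. ?g n x) \<longlonglongrightarrow> ?gu x"
      proof (cases "x \<in> {a<..<b}")
        case True
        then have "(\<lambda>n. ennreal ((w (r n) x ^ 2 - 1) ^ 2)) \<longlonglongrightarrow> ennreal ((u x ^ 2 - 1) ^ 2)"
          using x by (intro tendsto_ennrealI tendsto_power tendsto_diff tendsto_const) auto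
        then show ?thesis using True by simp
      qed simp
      then show "?gu x = liminf (\<lambda>n. ?g n x)" by (intro lim_imp_Liminf[symmetric]) auto
    qed
    ultimately have "AE x in lborel. ?gu x = 0" using mu by (simp add: nn_integral_0_iff_AE)
    then show ?thesis
    proof eventually_elim
      case (elim x)
      show ?case
      proof
        assume "x \<in> {a<..<b}"
        then have "(u x ^ 2 - 1)^2 = 0" using elim by (simp add: ennreal_eq_0_iff)
        then show "u x \<in> {1,-1}" by (simp add: power2_eq_1_iff)
      qed
    qed
  qed
  define E where "E = {x \<in> {a<..<b}. u x \<in> {1,-1} \<and> (\<lambda>n. w (r n) x) \<longlonglongrightarrow> u x}"
  have AE_E: "AE x in lborel. x \<in> {a<..<b} \<longrightarrow> x \<in> E"
    using u1 AEr by eventually_elim (auto simp: E_def)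
  obtain N where N: "100 * C < real N" using reals_Archimedean2 by blast
  have "\<not> alternation u E N t g" for t g
    using alternation_bounded[of E N t g] N unfolding Wx by (auto simp: E_def)
  then have "\<exists>s M t. steps u s a M t b"
    by (intro steps_exist[of E u a b b N]) (use AE_E ab in \<open>auto simp: E_def\<close>)
  then obtain s M t where S: "steps u s a M t b" by blast
  obtain K where K: "optimal_energy p jump_data K" "alpha_const p = ereal (K/2)" by (rule alpha_optimal[OF p])
  obtain B1 where B1: "optimal_energy p (boundary_data (- a0 * s)) B1" "beta_fun p (- a0 * s) = ereal B1"
    by (rule beta_optimal[OF p])
  obtain B2 where B2: "optimal_energy p (boundary_data (- b0 * t)) B2" "beta_fun p (- b0 * t) = ereal B2"
    by (rule beta_optimal[OF p])
  have "B1 + K * real M + B2 \<le> C"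
    by (rule sharp_lower_bound[OF S K(1) B1(1) B2(1)])
      (use subseq[OF bdry(1)] subseq[OF bdry(2)] in \<open>auto simp: Wx wa simp del: times_divide_eq_right\<close>)
  moreover have "sgn s = s" "sgn t = t" using steps_basic(2,3)[OF S] by auto
  ultimately show ?thesis
    using steps_BPV[OF S u] B1(2) B2(2) K(2) by (simp add: G_lim_def steps_essVar[OF S] algebra_simps)
qed

subsection \<open>Recovery sequences\<close>

definition lpdist :: "real \<Rightarrow> real \<Rightarrow> real \<Rightarrow> (real \<Rightarrow> real) \<Rightarrow> real \<Rightarrow> ennreal" where
  "lpdist p c d w t = Lp_dist p c d w (\<lambda>_. t)"

lemma lpdist_bound:
  assumes "c \<le> d" "\<And>x. c < x \<Longrightarrow> x < d \<Longrightarrow> \<bar>w x - t\<bar> \<le> M" "p \<ge> 1"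
  shows "lpdist p c d w t \<le> ennreal (M powr p * (d - c))"
proof -
  have "lpdist p c d w t \<le> (\<integral>\<^sup>+ x\<in>{c<..<d}. ennreal (M powr p) \<partial>lborel)"
    unfolding lpdist_def using assms by (intro nn_interval_mono) (auto intro!: ennreal_leI powr_mono2)
  then show ?thesis using assms by (simp add: nn_interval_const ennreal_mult')
qed

lemma lpdist_join:
  assumes "prof p c m w w1 w2" "prof p m d v v1 v2" "w m = v m" "w1 m = v1 m"
  shows "lpdist p c d (\<lambda>x. if x \<le> m then w x else v x) t = lpdist p c m w t + lpdist p m d v t"
proof -
  let ?g = "\<lambda>x. ennreal (\<bar>(if x \<le> m then w x else v x) - t\<bar> powr p)"
  have "lpdist p c d (\<lambda>x. if x \<le> m then w x else v x) t = (\<integral>\<^sup>+ x\<in>{c<..<m}. ?g x \<partial>lborel) + (\<integral>\<^sup>+ x\<in>{m<..<d}. ?g x \<partial>lborel)"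
    unfolding lpdist_def using profD(1)[OF assms(1)] profD(1)[OF assms(2)]
    by (intro nn_interval_split dist_density_measurable[OF prof_join[OF assms]]) auto
  also have "(\<integral>\<^sup>+ x\<in>{c<..<m}. ?g x \<partial>lborel) = lpdist p c m w t"
    unfolding lpdist_def by (rule nn_integral_cong) (auto simp: indicator_def)
  also have "(\<integral>\<^sup>+ x\<in>{m<..<d}. ?g x \<partial>lborel) = lpdist p m d v t"
    unfolding lpdist_def by (rule nn_integral_cong) (auto simp: indicator_def)
  finally show ?thesis .
qed

lemma lpdist_shift:
  assumes "prof p (c+k) (d+k) w w1 w2"
  shows "lpdist p c d (\<lambda>x. w (x+k)) t = lpdist p (c+k) (d+k) w t"
  unfolding lpdist_def
  using nn_interval_affine[of "\<lambda>x. ennreal (\<bar>w x - t\<bar> powr p)" 1 c k d] dist_density_measurable[OF assms]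
  by simp

lemma lpdist_reflect: "prof p c d w w1 w2 \<Longrightarrow> lpdist p (-d) (-c) (\<lambda>x. w (-x)) t = lpdist p c d w t"
  unfolding lpdist_def by (rule nn_interval_reflect[OF dist_density_measurable])

lemma lpdist_const: "lpdist p c d (\<lambda>x. t) t = 0"
  by (simp add: lpdist_def)

lemma lpdist_sign:
  assumes "s = 1 \<or> s = -1"
  shows "lpdist p c d (\<lambda>x. s * w x) (s * t) = lpdist p c d w t"
proof -
  have "\<bar>s * x - s * t\<bar> = \<bar>x - t\<bar>" for x using assms by auto
  then show ?thesis unfolding lpdist_def by simp
qed

lemma prof_bounded:
  assumes "prof p c d w w1 w2"
  obtains M where "M \<ge> 0" "\<And>x. x \<in> {c..d} \<Longrightarrow> \<bar>w x - t\<bar> \<le> M"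
proof -
  have "compact ((\<lambda>x. w x - t) ` {c..d})"
    by (intro compact_continuous_image continuous_intros prof_continuous[OF assms]) auto
  then have "bounded ((\<lambda>x. w x - t) ` {c..d})" by (rule compact_imp_bounded)
  then obtain M where M: "\<And>x. x \<in> {c..d} \<Longrightarrow> \<bar>w x - t\<bar> \<le> M" unfolding bounded_iff by fastforce
  moreover have "M \<ge> 0" using M[of c] profD(1)[OF assms] by auto
  ultimately show ?thesis using that by blast
qed

section \<open>Transition layers and boundary layers\<close>

lemma prof_shift:
  assumes "prof p (c+k) (d+k) w w1 w2"
  shows "prof p c d (\<lambda>x. w (x+k)) (\<lambda>x. w1 (x+k)) (\<lambda>x. w2 (x+k))"
  using prof_affine[of p 1 c k d w w1 w2] assms by simp

text \<open>The transition is placed right after \<open>c\<close> and prolonged by the well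
  \<open>s\<close>, which adds neither energy nor distance. The bounds are therefore those of the
  fixed profile, whatever the length of \<open>{c..d}\<close>.\<close>

lemma jump_piece:
  assumes P: "prof p 0 L \<phi> \<phi>1 \<phi>2" and J: "jump_data (\<phi> 0) (\<phi>1 0) (\<phi> L) (\<phi>1 L)" and p: "p \<ge> 1"
    and s: "s = 1 \<or> s = -1" and cd: "c + L < d"
  shows "\<exists>w w1 w2. prof p c d w w1 w2 \<and> w c = - s \<and> w1 c = 0 \<and> w d = s \<and> w1 d = 0 \<and>
     en c d w w2 \<le> en 0 L \<phi> \<phi>2 \<and> lpdist p c d w s \<le> lpdist p 0 L \<phi> 1"
proof -
  have L: "L > 0" using profD(1)[OF P] .
  have P0: "prof p (c + (-c)) (c + L + (-c)) \<phi> \<phi>1 \<phi>2" using P by simp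
  note P1 = prof_cmult[OF prof_shift[OF P0], of s]
  have P2: "prof p (c+L) d (\<lambda>x. s) (\<lambda>x. 0) (\<lambda>x. 0)" using cd p by (rule prof_const)
  have m: "s * \<phi> (c + L + -c) = s" "s * \<phi>1 (c + L + -c) = 0" using J by (auto simp: jump_data_def)
  have s2: "s^2 = 1" using s by auto
  have e: "en c (c + L) (\<lambda>x. s * \<phi> (x + -c)) (\<lambda>x. s * \<phi>2 (x + -c)) = en 0 L \<phi> \<phi>2"
    unfolding en_sign[OF s2] using en_shift[OF P0] by simp
  have d: "lpdist p c (c + L) (\<lambda>x. s * \<phi> (x + -c)) s = lpdist p 0 L \<phi> 1"
    using lpdist_sign[OF s, of p c "c+L" "\<lambda>x. \<phi> (x + -c)" 1] lpdist_shift[OF P0] by simp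
  show ?thesis
    by (rule exI, rule exI, rule exI, rule conjI, rule prof_join[OF P1 P2 m])
      (use en_join[OF P1 P2 m] lpdist_join[OF P1 P2 m] e d en_const[OF s2] J L cd in \<open>auto simp: lpdist_const jump_data_def\<close>)
qed

text \<open>The prescribed boundary values only converge, so profiles are needed for every target
  near \<open>T\<close>. Uniformity of length, energy and distance over these targets lets one
  choice serve all large \<open>n\<close>.\<close>

definition boundary_family :: "real \<Rightarrow> real \<Rightarrow> real \<Rightarrow> real \<Rightarrow> real \<Rightarrow> real \<Rightarrow> bool" where
  "boundary_family p T E L D \<rho> \<longleftrightarrow> L > 0 \<and> D \<ge> 0 \<and> \<rho> > 0 \<and> (\<forall>T'. \<bar>T' - T\<bar> \<le> \<rho> \<longrightarrow> (\<exists>v v1 v2.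
     prof p 0 L v v1 v2 \<and> v 0 = -1 \<and> v1 0 = 0 \<and> v L = T' \<and> en 0 L v v2 \<le> ennreal E \<and> lpdist p 0 L v (-1) \<le> ennreal D))"

lemma boundary_profile:
  assumes P: "prof p 0 L \<phi> \<phi>1 \<phi>2" and J: "boundary_data T (\<phi> 0) (\<phi>1 0) (\<phi> L) (\<phi>1 L)" and p: "p \<ge> 1"
    and E: "en 0 L \<phi> \<phi>2 \<le> ennreal E" "E \<ge> 0" and \<delta>: "\<delta> > 0"
  shows "\<exists>L' D \<rho>. boundary_family p T (E + \<delta>) L' D \<rho>"
proof -
  have L: "L > 0" using profD(1)[OF P] .
  \<comment> \<open>\<open>L\<close> may be shorter than the unit interval on which
    \<open>adjust_right\<close> works; two units at rest in the well -1 are put in front at no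
    cost.\<close>
  let ?c = "-2 :: real"
  have P0: "prof p ?c 0 (\<lambda>x. -1) (\<lambda>x. 0) (\<lambda>x. 0)" using p by (intro prof_const) auto
  have m: "-1 = \<phi> 0" "0 = \<phi>1 0" using J by (auto simp: boundary_data_def)
  let ?w = "\<lambda>x. if x \<le> 0 then -1 else \<phi> x" and ?w1 = "\<lambda>x. if x \<le> 0 then 0 else \<phi>1 x" and ?w2 = "\<lambda>x. if x \<le> 0 then 0 else \<phi>2 x"
  note Pw = prof_join[OF P0 P m]
  have Ew: "en ?c L ?w ?w2 \<le> ennreal E" using en_join[OF P0 P m] en_const[of "-1" ?c 0] E by simp
  obtain M where M: "M \<ge> 0" "\<And>x. x \<in> {?c..L} \<Longrightarrow> \<bar>?w x - (-1)\<bar> \<le> M" using prof_bounded[OF Pw] by blast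
  \<comment> \<open>Chosen so that (1 + 9 \<eta>) E + 36 \<eta> \<le> E + \<delta>.\<close>
  define \<eta> where "\<eta> = min 1 (\<delta> / (9 * E + 36))"
  have "\<eta> * (9 * E + 36) \<le> \<delta> / (9 * E + 36) * (9 * E + 36)" unfolding \<eta>_def using E by (intro mult_right_mono) auto
  then have \<eta>: "0 < \<eta>" "\<eta> \<le> 1" "\<eta> * (9 * E + 36) \<le> \<delta>" using \<delta> E by (auto simp: \<eta>_def)
  have main: "\<exists>v v1 v2. prof p 0 (L+2) v v1 v2 \<and> v 0 = -1 \<and> v1 0 = 0 \<and> v (L+2) = T' \<and>
     en 0 (L+2) v v2 \<le> ennreal (E + \<delta>) \<and> lpdist p 0 (L+2) v (-1) \<le> ennreal ((M+1) powr p * (L+2))"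
    if T': "\<bar>T' - T\<bar> \<le> \<eta>/13" for T'
  proof -
    have b: "\<bar>T' - T\<bar> \<le> \<eta>/13" "\<bar>0\<bar> \<le> \<eta>/13" using T' \<eta> by auto
    obtain v v1 v2 where v: "prof p ?c L v v1 v2" "v ?c = ?w ?c" "v1 ?c = ?w1 ?c" "v L = ?w L + (T' - T)" "v1 L = ?w1 L + 0"
      "en ?c L v v2 \<le> ennreal (1 + 9*\<eta>) * en ?c L ?w ?w2 + ennreal (36*\<eta>)" "\<And>x. ?c \<le> x \<Longrightarrow> x \<le> L \<Longrightarrow> \<bar>v x - ?w x\<bar> \<le> \<eta>"
      by (rule adjust_right[OF Pw p _ \<eta>(1,2) b]) (use L in auto)
    have "en ?c L v v2 \<le> ennreal (1 + 9*\<eta>) * ennreal E + ennreal (36*\<eta>)"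
      using v(6) Ew by (meson add_right_mono mult_left_mono order_trans zero_le)
    also have "\<dots> = ennreal ((1 + 9*\<eta>) * E + 36*\<eta>)" using E \<eta> by (simp add: ennreal_mult' ennreal_plus)
    also have "\<dots> \<le> ennreal (E + \<delta>)" using \<eta>(3) by (intro ennreal_leI) (simp add: algebra_simps)
    finally have ev: "en ?c L v v2 \<le> ennreal (E + \<delta>)" .
    have dv: "lpdist p ?c L v (-1) \<le> ennreal ((M+1) powr p * (L - ?c))"
    proof (rule lpdist_bound[OF _ _ p])
      fix x assume "?c < x" "x < L"
      then show "\<bar>v x - (-1)\<bar> \<le> M + 1" using M(2)[of x] v(7)[of x] \<eta> by auto
    qed (use L in auto)
    have P2: "prof p (0 + ?c) ((L+2) + ?c) v v1 v2" using v(1) by simp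
    show ?thesis
      by (rule exI, rule exI, rule exI, rule conjI, rule prof_shift[OF P2])
        (use en_shift[OF P2] lpdist_shift[OF P2] ev dv v(2-4) J L in \<open>auto simp: boundary_data_def\<close>)
  qed
  have "boundary_family p T (E + \<delta>) (L+2) ((M+1) powr p * (L+2)) (\<eta>/13)"
    unfolding boundary_family_def using main L \<eta> M by auto
  then show ?thesis by blast
qed

text \<open>The layer sits against \<open>d\<close>, preceded by the well \<open>t\<close>; the
  factor \<open>- t\<close> undoes the normalisation to the well -1.\<close>

lemma right_piece:
  assumes P: "prof p 0 L v v1 v2" and v: "v 0 = -1" "v1 0 = 0" and p: "p \<ge> 1"
    and t: "t = 1 \<or> t = -1" and cd: "c + L < d"
  shows "\<exists>w w1 w2. prof p c d w w1 w2 \<and> w c = t \<and> w1 c = 0 \<and> w d = - t * v L \<and>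
     en c d w w2 \<le> en 0 L v v2 \<and> lpdist p c d w t \<le> lpdist p 0 L v (-1)"
proof -
  have L: "L > 0" using profD(1)[OF P] .
  let ?k = "L - d"
  have P0: "prof p ((d - L) + ?k) (d + ?k) v v1 v2" using P by simp
  note P1 = prof_cmult[OF prof_shift[OF P0], of "- t"]
  have P2: "prof p c (d - L) (\<lambda>x. t) (\<lambda>x. 0) (\<lambda>x. 0)" using cd p by (intro prof_const) auto
  have m: "t = - t * v (d - L + ?k)" "0 = - t * v1 (d - L + ?k)" using v by auto
  have t2: "(- t)^2 = 1" "t^2 = 1" using t by auto
  have t': "- t = 1 \<or> - t = -1" using t by auto
  have e: "en (d - L) d (\<lambda>x. - t * v (x + ?k)) (\<lambda>x. - t * v2 (x + ?k)) = en 0 L v v2"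
    unfolding en_sign[OF t2(1)] using en_shift[OF P0] by simp
  have d: "lpdist p (d - L) d (\<lambda>x. - t * v (x + ?k)) t = lpdist p 0 L v (-1)"
    using lpdist_sign[OF t', of p "d - L" d "\<lambda>x. v (x + ?k)" "-1"] lpdist_shift[OF P0] by simp
  show ?thesis
    by (rule exI, rule exI, rule exI, rule conjI, rule prof_join[OF P2 P1 m])
      (use en_join[OF P2 P1 m] lpdist_join[OF P2 P1 m] e d en_const[OF t2(2)] L cd in \<open>auto simp: lpdist_const\<close>)
qed

lemma left_piece:
  assumes P: "prof p 0 L v v1 v2" and v: "v 0 = -1" "v1 0 = 0" and p: "p \<ge> 1"
    and t: "t = 1 \<or> t = -1" and cd: "c + L < d"
  shows "\<exists>w w1 w2. prof p c d w w1 w2 \<and> w d = t \<and> w1 d = 0 \<and> w c = - t * v L \<and>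
     en c d w w2 \<le> en 0 L v v2 \<and> lpdist p c d w t \<le> lpdist p 0 L v (-1)"
proof -
  obtain w w1 w2 where w: "prof p (-d) (-c) w w1 w2" "w (-d) = t" "w1 (-d) = 0" "w (-c) = - t * v L"
     "en (-d) (-c) w w2 \<le> en 0 L v v2" "lpdist p (-d) (-c) w t \<le> lpdist p 0 L v (-1)"
    using right_piece[OF P v p t, of "-d" "-c"] cd by auto
  show ?thesis
    by (rule exI[of _ "\<lambda>x. w (-x)"], rule exI[of _ "\<lambda>x. - w1 (-x)"], rule exI[of _ "\<lambda>x. w2 (-x)"])
      (use w prof_reflect[OF w(1)] en_reflect[OF w(1)] lpdist_reflect[OF w(1)] in auto)
qed

lemma unscaled_distance:
  assumes P: "prof p (x / e) (y / e) w w1 w2" and e: "e > 0" and AE: "AE z in lborel. z \<in> {x<..<y} \<longrightarrow> u z = t"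
  shows "Lp_dist p x y (\<lambda>z. w (z / e)) u = ennreal e * lpdist p (x / e) (y / e) w t"
proof -
  have "Lp_dist p x y (\<lambda>z. w (z / e)) u = (Lp_dist p x y (\<lambda>z. w ((1/e)*z+0)) (\<lambda>_. t))"
    by (rule nn_integral_cong_AE) (use AE in eventually_elim, auto simp: indicator_def)
  then have "ennreal e * lpdist p (x / e) (y / e) w t = ennreal e * (ennreal (1/e) * (Lp_dist p x y (\<lambda>z. w (z / e)) u))"
    using nn_interval_affine[of "\<lambda>x. ennreal (\<bar>w x - t\<bar> powr p)" "1/e" x 0 y] dist_density_measurable[OF P, of t] e
    by (simp add: lpdist_def)
  also have "\<dots> = Lp_dist p x y (\<lambda>z. w (z / e)) u"
    using e by (simp add: mult.assoc[symmetric] ennreal_mult'[symmetric])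
  finally show ?thesis by simp
qed

lemma unscaled_distance_join:
  assumes P: "prof p (x / e) (y / e) w w1 w2" and e: "e > 0" and u: "set_borel_measurable lborel {x<..<y} u"
    and m: "x \<le> m" "m \<le> y"
  shows "Lp_dist p x y (\<lambda>z. w (z / e)) u =
    (Lp_dist p x m (\<lambda>z. w (z / e)) u) + (Lp_dist p m y (\<lambda>z. w (z / e)) u)"
proof -
  have "set_borel_measurable lborel {(1/e)*x+0<..<(1/e)*y+0} w" using prof_measurable(1)[OF P] by simp
  from set_borel_measurable_affine[OF this] e have "set_borel_measurable lborel {x<..<y} (\<lambda>z. w (z / e))" by simp
  then have "(\<lambda>z. ennreal (\<bar>w (z / e) - u z\<bar> powr p) * indicator {x<..<y} z) \<in> borel_measurable lborel"
    by (rule measurable_density2[OF _ u, of _ "\<lambda>a b. \<bar>a - b\<bar> powr p"]) measurable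
  then show ?thesis by (rule nn_interval_split[OF _ m])
qed

text \<open>Cutting the last constant piece at its midpoint reserves room for the boundary layer at
  the right end, even when there is no jump and both layers share one piece.\<close>

lemma steps_cut:
  assumes "steps u s x N t y"
  obtains m where "x < m" "m < y" "steps u s x N t m" "AE r in lborel. r \<in> {m<..<y} \<longrightarrow> u r = t"
  using assms
proof cases
  case steps_one
  show ?thesis
  proof (rule that[of "(x+y)/2"])
    show "AE r in lborel. r \<in> {(x+y)/2<..<y} \<longrightarrow> u r = t"
      using AE_interval_mono[OF steps_one(5), of "(x+y)/2" y] steps_one by auto
    show "steps u s x N t ((x+y)/2)"
      unfolding steps_one(1,2) using steps_one AE_interval_mono[OF steps_one(5), of x "(x+y)/2"]
      by (intro steps.steps_one) auto
  qed (use steps_one in auto)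
next
  case (steps_snoc N' t' y')
  have xy: "x < y'" using steps_basic(1)[OF steps_snoc(3)] .
  show ?thesis
  proof (rule that[of "(y'+y)/2"])
    show "AE r in lborel. r \<in> {(y'+y)/2<..<y} \<longrightarrow> u r = t" using AE_interval_mono[OF steps_snoc(5), of "(y'+y)/2" y] steps_snoc by auto
    show "steps u s x N t ((y'+y)/2)"
      unfolding steps_snoc(1,2) using steps_snoc AE_interval_mono[OF steps_snoc(5), of y' "(y'+y)/2"]
      by (intro steps.steps_snoc) auto
  qed (use steps_snoc xy in auto)
qed

lemma join_recovery:
  assumes w: "prof p (x / e) (y / e) w w1 w2" and v: "prof p (y / e) (z / e) v v1 v2"
    and m: "w (y / e) = v (y / e)" "w1 (y / e) = v1 (y / e)" and e: "e > 0"
    and u: "set_borel_measurable lborel {x<..<z} u" "AE r in lborel. r \<in> {y<..<z} \<longrightarrow> u r = t"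
    and E: "en (x / e) (y / e) w w2 \<le> ennreal E1" "en (y / e) (z / e) v v2 \<le> ennreal E2" "E1 \<ge> 0" "E2 \<ge> 0"
    and D: "Lp_dist p x y (\<lambda>r. w (r / e)) u \<le> ennreal (e * D1)" "lpdist p (y / e) (z / e) v t \<le> ennreal D2" "D1 \<ge> 0" "D2 \<ge> 0"
  shows "\<exists>f f1 f2. prof p (x / e) (z / e) f f1 f2 \<and> f (x / e) = w (x / e) \<and> f (z / e) = v (z / e) \<and> f1 (z / e) = v1 (z / e) \<and>
    en (x / e) (z / e) f f2 \<le> ennreal (E1 + E2) \<and> Lp_dist p x z (\<lambda>r. f (r / e)) u \<le> ennreal (e * (D1 + D2))"
proof -
  let ?f = "\<lambda>r. if r \<le> y / e then w r else v r" and ?f1 = "\<lambda>r. if r \<le> y / e then w1 r else v1 r"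
    and ?f2 = "\<lambda>r. if r \<le> y / e then w2 r else v2 r"
  note P = prof_join[OF w v m]
  have lt: "x / e < y / e" "y / e < z / e" using profD(1)[OF w] profD(1)[OF v] .
  then have xyz: "x \<le> y" "y \<le> z" using e by (auto simp: divide_less_cancel)
  have "en (x / e) (z / e) ?f ?f2 = en (x / e) (y / e) w w2 + en (y / e) (z / e) v v2" by (rule en_join[OF w v m])
  also have "\<dots> \<le> ennreal (E1 + E2)" using add_mono[OF E(1,2)] E(3,4) by (simp add: ennreal_plus)
  finally have en: "en (x / e) (z / e) ?f ?f2 \<le> ennreal (E1 + E2)" .
  have "Lp_dist p x z (\<lambda>r. ?f (r / e)) u = Lp_dist p x y (\<lambda>r. ?f (r / e)) u + Lp_dist p y z (\<lambda>r. ?f (r / e)) u"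
    by (rule unscaled_distance_join[OF P e u(1) xyz])
  also have "Lp_dist p x y (\<lambda>r. ?f (r / e)) u = Lp_dist p x y (\<lambda>r. w (r / e)) u"
    using e by (intro nn_integral_cong) (auto simp: indicator_def divide_le_cancel)
  also have "Lp_dist p y z (\<lambda>r. ?f (r / e)) u = Lp_dist p y z (\<lambda>r. v (r / e)) u"
    using e by (intro nn_integral_cong) (auto simp: indicator_def divide_le_cancel)
  also have "Lp_dist p y z (\<lambda>r. v (r / e)) u = ennreal e * lpdist p (y / e) (z / e) v t"
    by (rule unscaled_distance[OF v e u(2)])
  also have "Lp_dist p x y (\<lambda>r. w (r / e)) u + ennreal e * lpdist p (y / e) (z / e) v t \<le> ennreal (e * D1) + ennreal e * ennreal D2"
    using D(1,2) by (intro add_mono mult_left_mono) auto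
  also have "\<dots> = ennreal (e * (D1 + D2))"
    using e D(3,4) by (simp add: ennreal_mult'[symmetric] ennreal_plus[symmetric] distrib_left)
  finally have d: "Lp_dist p x z (\<lambda>r. ?f (r / e)) u \<le> ennreal (e * (D1 + D2))" .
  show ?thesis
    by (rule exI[of _ ?f], rule exI[of _ ?f1], rule exI[of _ ?f2], intro conjI P en d) (use lt m in auto)
qed

text \<open>The quantities \<open>E\<close> and \<open>D\<close> do not depend on \<open>e\<close>, so the distance to \<open>u\<close> vanishes as \<open>e \<rightarrow> 0\<close>.\<close>

definition recovers :: "real \<Rightarrow> real \<Rightarrow> real \<Rightarrow> real \<Rightarrow> real \<Rightarrow> real \<Rightarrow> (real \<Rightarrow> real) \<Rightarrow> real \<Rightarrow> real \<Rightarrow> bool" where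
  "recovers p a y e A t u E D \<longleftrightarrow> (\<exists>w w1 w2. prof p (a / e) (y / e) w w1 w2 \<and> w (a / e) = A \<and> w (y / e) = t \<and>
     w1 (y / e) = 0 \<and> en (a / e) (y / e) w w2 \<le> ennreal E \<and> Lp_dist p a y (\<lambda>z. w (z / e)) u \<le> ennreal (e * D))"

lemma eventually_fits:
  fixes e :: "nat \<Rightarrow> real"
  assumes "\<And>n. e n > 0" "e \<longlonglongrightarrow> 0" "x < y" "L > 0"
  shows "\<forall>\<^sub>F n in sequentially. x / e n + L < y / e n"
proof -
  have "\<forall>\<^sub>F n in sequentially. e n < (y - x) / L" using order_tendstoD(2)[OF assms(2)] assms(3,4) by simp
  then show ?thesis
  proof eventually_elim
    case (elim n)
    then have "L < (y - x) / e n" using assms(1)[of n] assms(4) by (simp add: field_simps)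
    then show ?case by (simp add: diff_divide_distrib)
  qed
qed

text \<open>Every layer occupies a length independent of \<open>n\<close> in the blown-up variable,
  hence contributes a distance of order \<open>e n\<close> in the original one. Each transition is
  placed immediately to the right of the jump, so the value at the junction is the one before the
  jump.\<close>

lemma recovery_steps:
  assumes S: "steps u s a N t y" and "y \<le> b" and p: "p \<ge> 1" and e_pos: "\<And>n. e n > 0" and e_lim: "e \<longlonglongrightarrow> 0"
    and u: "set_borel_measurable lborel {a<..<b} u" and A: "A \<longlonglongrightarrow> a0"
    and \<phi>: "prof p 0 L \<phi> \<phi>1 \<phi>2" "jump_data (\<phi> 0) (\<phi>1 0) (\<phi> L) (\<phi>1 L)" "en 0 L \<phi> \<phi>2 \<le> ennreal EK" "EK \<ge> 0"
    and F: "boundary_family p (- a0 * s) EB L' D \<rho>" "EB \<ge> 0"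
  shows "\<exists>D'\<ge>0. \<forall>\<^sub>F n in sequentially. recovers p a y (e n) (A n) t u (EB + EK * real N) D'"
  using S \<open>y \<le> b\<close>
proof induction
  case (steps_one y)
  note F' = F(1)[unfolded boundary_family_def]
  have s: "s = 1 \<or> s = -1" using steps_one by auto
  have "\<forall>\<^sub>F n in sequentially. a / e n + L' < y / e n"
    by (rule eventually_fits) (use e_pos e_lim steps_one F' in auto)
  moreover have "\<forall>\<^sub>F n in sequentially. dist (A n) a0 < \<rho>" using F' by (intro tendstoD[OF A]) auto
  ultimately have "\<forall>\<^sub>F n in sequentially. recovers p a y (e n) (A n) s u (EB + EK * real 0) D"
  proof eventually_elim
    case (elim n)
    have "\<bar>- s * A n - - a0 * s\<bar> \<le> \<rho>" unfolding sign_flip_dist[OF s] using elim(2) by (simp add: dist_real_def)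
    then obtain v v1 v2 where v: "prof p 0 L' v v1 v2" "v 0 = -1" "v1 0 = 0" "v L' = - s * A n"
     "en 0 L' v v2 \<le> ennreal EB" "lpdist p 0 L' v (-1) \<le> ennreal D" using F' by blast
    obtain w w1 w2 where w: "prof p (a / e n) (y / e n) w w1 w2" "w (y / e n) = s" "w1 (y / e n) = 0" "w (a / e n) = - s * v L'"
      "en (a / e n) (y / e n) w w2 \<le> en 0 L' v v2" "lpdist p (a / e n) (y / e n) w s \<le> lpdist p 0 L' v (-1)"
      using left_piece[OF v(1-3) p s elim(1)] by blast
    have "Lp_dist p a y (\<lambda>z. w (z / e n)) u = ennreal (e n) * lpdist p (a / e n) (y / e n) w s"
      by (rule unscaled_distance[OF w(1) e_pos steps_one(3)])
    also have "\<dots> \<le> ennreal (e n) * ennreal D" using w(6) v(6) by (intro mult_left_mono) (auto intro: order_trans)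
    also have "\<dots> = ennreal (e n * D)" using e_pos[of n] F' by (simp add: ennreal_mult')
    finally have d: "Lp_dist p a y (\<lambda>z. w (z / e n)) u \<le> ennreal (e n * D)" .
    have "w (a / e n) = A n" using w(4) v(4) s by auto
    then show ?case unfolding recovers_def using w d order_trans[OF w(5) v(5)] by auto
  qed
  then show ?case using F' by blast
next
  case (steps_snoc N t y z)
  obtain D1 where D1: "D1 \<ge> 0" "\<forall>\<^sub>F n in sequentially. recovers p a y (e n) (A n) t u (EB + EK * real N) D1"
    using steps_snoc.IH steps_snoc.prems steps_snoc.hyps by auto
  have t: "- t = 1 \<or> - t = -1" and ay: "a < y" using steps_basic[OF steps_snoc(1)] by auto
  have L: "L > 0" using profD(1)[OF \<phi>(1)] .
  obtain M where M: "M \<ge> 0" "\<And>x. x \<in> {0..L} \<Longrightarrow> \<bar>\<phi> x - 1\<bar> \<le> M" using prof_bounded[OF \<phi>(1)] by blast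
  define D2 where "D2 = M powr p * L"
  have D2: "D2 \<ge> 0" "lpdist p 0 L \<phi> 1 \<le> ennreal D2"
    using lpdist_bound[of 0 L \<phi> 1 M p] M L p by (auto simp: D2_def)
  have uz: "set_borel_measurable lborel {a<..<z} u"
    by (rule set_borel_measurable_mono[OF u]) (use steps_snoc.prems in auto)
  have "\<forall>\<^sub>F n in sequentially. y / e n + L < z / e n"
    by (rule eventually_fits) (use e_pos e_lim steps_snoc.hyps L in auto)
  with D1(2) have "\<forall>\<^sub>F n in sequentially. recovers p a z (e n) (A n) (- t) u (EB + EK * real (Suc N)) (D1 + D2)"
  proof eventually_elim
    case (elim n)
    obtain w w1 w2 where w: "prof p (a / e n) (y / e n) w w1 w2" "w (a / e n) = A n"
     "w (y / e n) = t" "w1 (y / e n) = 0" "en (a / e n) (y / e n) w w2 \<le> ennreal (EB + EK * real N)"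
     "Lp_dist p a y (\<lambda>z. w (z / e n)) u \<le> ennreal (e n * D1)" using elim(1) unfolding recovers_def by blast
    obtain v v1 v2 where v: "prof p (y / e n) (z / e n) v v1 v2" "v (y / e n) = - (- t)" "v1 (y / e n) = 0"
      "v (z / e n) = - t" "v1 (z / e n) = 0"
      "en (y / e n) (z / e n) v v2 \<le> en 0 L \<phi> \<phi>2" "lpdist p (y / e n) (z / e n) v (- t) \<le> lpdist p 0 L \<phi> 1"
      using jump_piece[OF \<phi>(1,2) p t elim(2)] by blast
    have m: "w (y / e n) = v (y / e n)" "w1 (y / e n) = v1 (y / e n)" using w v by auto
    have E: "EB + EK * real N \<ge> 0" "EB + EK * real N + EK = EB + EK * real (Suc N)"
      using F(2) \<phi>(4) by (auto simp: algebra_simps)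
    show ?case unfolding recovers_def
      using join_recovery[OF w(1) v(1) m e_pos uz steps_snoc.hyps(3) w(5) order_trans[OF v(6) \<phi>(3)] E(1) \<phi>(4)
        w(6) order_trans[OF v(7) D2(2)] D1(1) D2(1), unfolded E(2) w(2) v(4,5)] .
  qed
  then show ?case using D1(1) D2(1) by (intro exI[of _ "D1 + D2"]) auto
qed

lemma recovery_profiles:
  assumes S: "steps u s a N t b" and p: "p \<ge> 1" and e_pos: "\<And>n. e n > 0" and e_lim: "e \<longlonglongrightarrow> 0"
    and u: "set_borel_measurable lborel {a<..<b} u" and A: "A \<longlonglongrightarrow> a0" and B: "B \<longlonglongrightarrow> b0"
    and K: "optimal_energy p jump_data K" and B1: "optimal_energy p (boundary_data (- a0 * s)) B1"
    and B2: "optimal_energy p (boundary_data (- b0 * t)) B2" and \<delta>: "\<delta> > 0"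
  shows "\<exists>D\<ge>0. \<forall>\<^sub>F n in sequentially. \<exists>w w1 w2. prof p (a / e n) (b / e n) w w1 w2 \<and> w (a / e n) = A n \<and> w (b / e n) = B n \<and>
     en (a / e n) (b / e n) w w2 \<le> ennreal (B1 + K * real N + B2 + \<delta>) \<and>
     Lp_dist p a b (\<lambda>z. w (z / e n)) u \<le> ennreal (e n * D)"
proof -
  \<comment> \<open>Each of the N jumps takes one share; each of the two boundary layers takes two,
    one for near optimality and one for moving the end value.\<close>
  define \<delta>' where "\<delta>' = \<delta> / (real N + 4)"
  have \<delta>': "\<delta>' > 0" using \<delta> by (simp add: \<delta>'_def)
  have nonneg: "K \<ge> 0" "B1 \<ge> 0" "B2 \<ge> 0" using K B1 B2 optimal_energyD(1) by auto
  obtain L \<phi> \<phi>1 \<phi>2 where \<phi>: "prof p 0 L \<phi> \<phi>1 \<phi>2" "jump_data (\<phi> 0) (\<phi>1 0) (\<phi> L) (\<phi>1 L)" "en 0 L \<phi> \<phi>2 \<le> ennreal (K + \<delta>')"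
    using optimal_energyD(3)[OF K \<delta>'] by blast
  have family: "\<exists>L D \<rho>. boundary_family p T (R + 2 * \<delta>') L D \<rho>" if R: "optimal_energy p (boundary_data T) R" for T R
  proof -
    obtain L \<psi> \<psi>1 \<psi>2 where \<psi>: "prof p 0 L \<psi> \<psi>1 \<psi>2" "boundary_data T (\<psi> 0) (\<psi>1 0) (\<psi> L) (\<psi>1 L)" "en 0 L \<psi> \<psi>2 \<le> ennreal (R + \<delta>')"
      using optimal_energyD(3)[OF R \<delta>'] by blast
    have eq: "R + \<delta>' + \<delta>' = R + 2 * \<delta>'" by simp
    have "0 \<le> R + \<delta>'" using optimal_energyD(1)[OF R] \<delta>' by auto
    from boundary_profile[OF \<psi>(1,2) p \<psi>(3) this \<delta>'] show ?thesis unfolding eq .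
  qed
  obtain L1 D1 \<rho>1 where b1: "boundary_family p (- a0 * s) (B1 + 2 * \<delta>') L1 D1 \<rho>1" using family[OF B1] by blast
  obtain L2 D2 \<rho>2 where "boundary_family p (- b0 * t) (B2 + 2 * \<delta>') L2 D2 \<rho>2" using family[OF B2] by blast
  note b2 = this[unfolded boundary_family_def]
  obtain m where m: "a < m" "m < b" "steps u s a N t m" "AE r in lborel. r \<in> {m<..<b} \<longrightarrow> u r = t"
    by (rule steps_cut[OF S])
  have t: "t = 1 \<or> t = -1" using steps_basic[OF S] by auto
  let ?E = "(B1 + 2 * \<delta>') + (K + \<delta>') * real N"
  have E: "?E \<ge> 0" "B2 + 2 * \<delta>' \<ge> 0" using nonneg \<delta>' by auto
  have "?E + (B2 + 2 * \<delta>') = B1 + K * real N + B2 + \<delta>' * (real N + 4)" by (simp add: algebra_simps)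
  also have "\<delta>' * (real N + 4) = \<delta>" by (simp add: \<delta>'_def)
  finally have sum: "?E + (B2 + 2 * \<delta>') = B1 + K * real N + B2 + \<delta>" .
  obtain D where D: "D \<ge> 0" "\<forall>\<^sub>F n in sequentially. recovers p a m (e n) (A n) t u ?E D"
    using recovery_steps[OF m(3) less_imp_le[OF m(2)] p e_pos e_lim u A \<phi> _ b1] nonneg \<delta>' by auto
  have "\<forall>\<^sub>F n in sequentially. m / e n + L2 < b / e n"
    by (rule eventually_fits) (use e_pos e_lim m b2 in auto)
  moreover have "\<forall>\<^sub>F n in sequentially. dist (B n) b0 < \<rho>2" using b2 by (intro tendstoD[OF B]) auto
  ultimately have "\<forall>\<^sub>F n in sequentially. \<exists>w w1 w2. prof p (a / e n) (b / e n) w w1 w2 \<and> w (a / e n) = A n \<and> w (b / e n) = B n \<and>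
     en (a / e n) (b / e n) w w2 \<le> ennreal (B1 + K * real N + B2 + \<delta>) \<and>
     Lp_dist p a b (\<lambda>z. w (z / e n)) u \<le> ennreal (e n * (D + D2))"
    using D(2)
  proof eventually_elim
    case (elim n)
    obtain w w1 w2 where w: "prof p (a / e n) (m / e n) w w1 w2" "w (a / e n) = A n"
     "w (m / e n) = t" "w1 (m / e n) = 0" "en (a / e n) (m / e n) w w2 \<le> ennreal ?E"
     "Lp_dist p a m (\<lambda>z. w (z / e n)) u \<le> ennreal (e n * D)" using elim(3) unfolding recovers_def by blast
    have "\<bar>- t * B n - - b0 * t\<bar> \<le> \<rho>2" unfolding sign_flip_dist[OF t] using elim(2) by (simp add: dist_real_def)
    then obtain \<psi> \<psi>1 \<psi>2 where \<psi>: "prof p 0 L2 \<psi> \<psi>1 \<psi>2" "\<psi> 0 = -1" "\<psi>1 0 = 0" "\<psi> L2 = - t * B n"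
     "en 0 L2 \<psi> \<psi>2 \<le> ennreal (B2 + 2 * \<delta>')" "lpdist p 0 L2 \<psi> (-1) \<le> ennreal D2" using b2 by blast
    obtain v v1 v2 where v: "prof p (m / e n) (b / e n) v v1 v2" "v (m / e n) = t" "v1 (m / e n) = 0"
      "v (b / e n) = - t * \<psi> L2"
      "en (m / e n) (b / e n) v v2 \<le> en 0 L2 \<psi> \<psi>2" "lpdist p (m / e n) (b / e n) v t \<le> lpdist p 0 L2 \<psi> (-1)"
      using right_piece[OF \<psi>(1-3) p t elim(1)] by blast
    have mm: "w (m / e n) = v (m / e n)" "w1 (m / e n) = v1 (m / e n)" using w v by auto
    have vB: "v (b / e n) = B n" using v(4) \<psi>(4) t by auto
    have "D2 \<ge> 0" using b2 by simp
    from join_recovery[OF w(1) v(1) mm e_pos u m(4) w(5) order_trans[OF v(5) \<psi>(5)] E w(6) order_trans[OF v(6) \<psi>(6)] D(1) this]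
    show ?case unfolding sum w(2) vB by blast
  qed
  then show ?thesis using D(1) b2 by (intro exI[of _ "D + D2"]) auto
qed

section \<open>Return to \<open>G_eps\<close>, diagonal sequence and conclusion\<close>

lemma G_eps_le:
  assumes "W2rep p a b u v dv ddv" "(v \<longlongrightarrow> A) (at_right a)" "(v \<longlongrightarrow> B) (at_left b)"
  shows "G_eps p a b e A B u \<le> enn2ereal (eps_energy a b e u ddv)"
proof -
  have "\<exists>v dv ddv. W2rep p a b u v dv ddv \<and> (v \<longlongrightarrow> A) (at_right a) \<and> (v \<longlongrightarrow> B) (at_left b)" using assms by blast
  then show ?thesis unfolding G_eps_def using assms by (auto intro!: Inf_lower)
qed

lemma G_eps_less_representation:
  assumes lt: "G_eps p a b e A B u < ereal C" and "C \<ge> 0"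
  obtains v dv ddv where "W2rep p a b u v dv ddv" "(v \<longlongrightarrow> A) (at_right a)" "(v \<longlongrightarrow> B) (at_left b)"
    "eps_energy a b e u ddv \<le> ennreal C"
proof -
  have ex: "\<exists>v dv ddv. W2rep p a b u v dv ddv \<and> (v \<longlongrightarrow> A) (at_right a) \<and> (v \<longlongrightarrow> B) (at_left b)"
    using lt unfolding G_eps_def by (auto split: if_splits)
  obtain v dv ddv where v: "W2rep p a b u v dv ddv" "(v \<longlongrightarrow> A) (at_right a)" "(v \<longlongrightarrow> B) (at_left b)"
    "enn2ereal (eps_energy a b e u ddv) < ereal C"
    using lt unfolding G_eps_def if_P[OF ex] Inf_less_iff by blast
  from v(4) have "enn2ereal (eps_energy a b e u ddv) \<le> enn2ereal (ennreal C)"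
    using assms(2) by (simp add: enn2ereal_ennreal)
  then have "eps_energy a b e u ddv \<le> ennreal C" by (simp add: less_eq_ennreal.rep_eq)
  with v(1-3) show ?thesis by (rule that)
qed

lemma G_eps_scaled:
  assumes P: "prof p (a / e) (b / e) w w1 w2" and e: "e > 0" and p: "p \<ge> 1"
  shows "Lp p a b (\<lambda>x. w (x / e))"
    "G_eps p a b e (w (a / e)) (w (b / e)) (\<lambda>x. w (x / e)) \<le> enn2ereal (en (a / e) (b / e) w w2)"
proof -
  have P0: "prof p ((1/e)*a+0) ((1/e)*b+0) w w1 w2" using P by simp
  have P1: "prof p a b (\<lambda>x. w (x / e)) (\<lambda>x. (1/e) * w1 (x / e)) (\<lambda>x. (1/e)^2 * w2 (x / e))"
    using prof_affine[OF P0] e by simp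
  note W = W2rep_of_prof[OF P1 p]
  show "Lp p a b (\<lambda>x. w (x / e))" using W(1) by (simp add: W2rep_def)
  have "en (a/e) (b/e) (\<lambda>x. w ((e*x)/e)) (\<lambda>x. e^2 * ((1/e)^2 * w2 ((e*x)/e))) = en (a / e) (b / e) w w2"
    by (rule en_cong) (use e in \<open>auto simp: power_divide\<close>)
  then show "G_eps p a b e (w (a / e)) (w (b / e)) (\<lambda>x. w (x / e)) \<le> enn2ereal (en (a / e) (b / e) w w2)"
    using G_eps_le[OF W(1-3), of e] rescale_prof(2)[OF P1 e] by simp
qed

text \<open>\<open>f n\<close> is the largest level k \<le> n whose threshold \<open>N k\<close> has
  been passed: it grows slowly enough for \<open>P (f n) n\<close> to be solvable and still tends to
  infinity.\<close>

lemma diagonal_choice: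
  fixes P :: "nat \<Rightarrow> nat \<Rightarrow> 'a \<Rightarrow> bool"
  assumes "\<And>k. \<forall>\<^sub>F n in sequentially. \<exists>x. P k n x"
  obtains X f where "filterlim f at_top sequentially" "\<forall>\<^sub>F n in sequentially. P (f n) n (X n)"
proof -
  obtain N where N: "\<And>k n. n \<ge> N k \<Longrightarrow> \<exists>x. P k n x"
    using assms unfolding eventually_sequentially by metis
  define f where "f n = Max {k. k \<le> n \<and> N k \<le> n}" for n
  have fin: "finite {k. k \<le> n \<and> N k \<le> n}" for n by (rule finite_subset[of _ "{..n}"]) auto
  have f_ge: "k \<le> f n" if "k \<le> n" "N k \<le> n" for k n unfolding f_def using that fin by (intro Max_ge) auto
  have f_N: "N (f n) \<le> n" if "N 0 \<le> n" for n
  proof -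
    have "f n \<in> {k. k \<le> n \<and> N k \<le> n}" unfolding f_def using that fin[of n] by (intro Max_in) auto
    then show ?thesis by simp
  qed
  have "filterlim f at_top sequentially"
    unfolding filterlim_at_top eventually_sequentially
  proof
    fix k show "\<exists>M. \<forall>n\<ge>M. k \<le> f n" by (rule exI[of _ "max k (N k)"]) (auto intro: f_ge)
  qed
  moreover have "\<forall>n. \<exists>x. N 0 \<le> n \<longrightarrow> P (f n) n x" using N f_N by blast
  then obtain X where "\<And>n. N 0 \<le> n \<Longrightarrow> P (f n) n (X n)" by metis
  then have "\<forall>\<^sub>F n in sequentially. P (f n) n (X n)" unfolding eventually_sequentially by blast
  ultimately show ?thesis using that by blast
qed

lemma limsup_inequality:
  assumes ab: "a < b" and p: "p \<ge> 1" and e_pos: "\<And>n. e n > 0" and e_lim: "e \<longlonglongrightarrow> 0"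
    and u: "Lp p a b u" and A: "A \<longlonglongrightarrow> a0" and B: "B \<longlonglongrightarrow> b0"
  shows "\<exists>us. (\<forall>n. Lp p a b (us n)) \<and> Lp_conv p a b us u \<and> limsup (\<lambda>n. G_eps p a b (e n) (A n) (B n) (us n)) \<le> G_lim p a b a0 b0 u"
proof (cases "BPV p a b u")
  case False
  \<comment> \<open>The limit functional is infinite here, so the constant sequence
    suffices.\<close>
  then show ?thesis using u by (intro exI[of _ "\<lambda>_. u"]) (simp add: G_lim_def Lp_conv_def)
next
  case True
  obtain s N t where S: "steps u s a N t b" using BPV_steps[OF True ab] by blast
  obtain K where K: "optimal_energy p jump_data K" "alpha_const p = ereal (K/2)" by (rule alpha_optimal[OF p])
  obtain B1 where B1: "optimal_energy p (boundary_data (- a0 * s)) B1" "beta_fun p (- a0 * s) = ereal B1"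
    by (rule beta_optimal[OF p])
  obtain B2 where B2: "optimal_energy p (boundary_data (- b0 * t)) B2" "beta_fun p (- b0 * t) = ereal B2"
    by (rule beta_optimal[OF p])
  have nonneg: "K \<ge> 0" "B1 \<ge> 0" "B2 \<ge> 0" using K(1) B1(1) B2(1) optimal_energyD(1) by auto
  define G where "G = B1 + K * real N + B2"
  have "sgn s = s" "sgn t = t" using steps_basic(2,3)[OF S] by auto
  then have G: "G_lim p a b a0 b0 u = ereal G"
    using True B1(2) B2(2) K(2) by (simp add: G_lim_def steps_essVar[OF S] G_def algebra_simps)
  have G0: "G \<ge> 0" using nonneg by (simp add: G_def)
  \<comment> \<open>Level \<open>k\<close> allows an error 1/(k+1) in energy and in distance. The
    constant \<open>D\<close> depends on \<open>k\<close> through the chosen profiles, so \<delta>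
    and \<open>e n\<close> cannot simply be sent to zero together; \<open>diagonal_choice\<close>
    couples them.\<close>
  define P where "P k n x \<longleftrightarrow> Lp p a b x \<and> G_eps p a b (e n) (A n) (B n) x \<le> ereal (G + 1 / real (Suc k)) \<and>
     Lp_dist p a b x u \<le> ennreal (1 / real (Suc k))" for k n x
  have "\<forall>\<^sub>F n in sequentially. \<exists>x. P k n x" for k
  proof -
    let ?\<delta> = "1 / real (Suc k)"
    obtain D where D: "D \<ge> 0" "\<forall>\<^sub>F n in sequentially. \<exists>w w1 w2. prof p (a / e n) (b / e n) w w1 w2 \<and> w (a / e n) = A n \<and> w (b / e n) = B n \<and>
       en (a / e n) (b / e n) w w2 \<le> ennreal (G + ?\<delta>) \<and>
       Lp_dist p a b (\<lambda>z. w (z / e n)) u \<le> ennreal (e n * D)"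
      using recovery_profiles[OF S p e_pos e_lim _ A B K(1) B1(1) B2(1), of ?\<delta>] u unfolding G_def Lp_def by auto
    have "\<forall>\<^sub>F n in sequentially. e n < ?\<delta> / (D + 1)" using order_tendstoD(2)[OF e_lim] D(1) by simp
    with D(2) show ?thesis
    proof eventually_elim
      case (elim n)
      then obtain w w1 w2 where w: "prof p (a / e n) (b / e n) w w1 w2" "w (a / e n) = A n" "w (b / e n) = B n"
        "en (a / e n) (b / e n) w w2 \<le> ennreal (G + ?\<delta>)"
        "(Lp_dist p a b (\<lambda>z. w (z / e n)) u) \<le> ennreal (e n * D)" by blast
      have "e n * D \<le> e n * (D + 1)" using e_pos[of n] by simp
      also have "\<dots> \<le> ?\<delta>"
      proof -
        have "0 < D + 1" using D(1) by simp
        from iffD1[OF pos_less_divide_eq[OF this] elim(2)] show ?thesis by (rule less_imp_le)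
      qed
      finally have "Lp_dist p a b (\<lambda>z. w (z / e n)) u \<le> ennreal ?\<delta>"
        using w(5) by (meson ennreal_leI order_trans)
      moreover have "G_eps p a b (e n) (A n) (B n) (\<lambda>x. w (x / e n)) \<le> ereal (G + ?\<delta>)"
      proof -
        have "G_eps p a b (e n) (A n) (B n) (\<lambda>x. w (x / e n)) \<le> enn2ereal (en (a / e n) (b / e n) w w2)"
          using G_eps_scaled(2)[OF w(1) e_pos p] w(2,3) by simp
        also have "\<dots> \<le> enn2ereal (ennreal (G + ?\<delta>))" using w(4) by (simp add: less_eq_ennreal.rep_eq)
        also have "\<dots> = ereal (G + ?\<delta>)" using G0 by (simp add: enn2ereal_ennreal)
        finally show ?thesis .
      qed
      ultimately show ?case using G_eps_scaled(1)[OF w(1) e_pos p] by (auto simp: P_def)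
    qed
  qed
  then obtain X f where f: "filterlim f at_top sequentially" "\<forall>\<^sub>F n in sequentially. P (f n) n (X n)"
    using diagonal_choice[of P] by metis
  \<comment> \<open>At the finitely many indices without a suitable choice, \<open>u\<close> itself
    keeps the sequence in L^p.\<close>
  define us where "us n = (if P (f n) n (X n) then X n else u)" for n
  have us: "\<forall>n. Lp p a b (us n)" using u by (auto simp: us_def P_def)
  have P_us: "\<forall>\<^sub>F n in sequentially. P (f n) n (us n)" using f(2) by eventually_elim (simp add: us_def)
  have small: "(\<lambda>n. 1 / real (Suc (f n))) \<longlonglongrightarrow> 0"
    by (rule filterlim_compose[OF LIMSEQ_Suc[OF lim_1_over_n] f(1)])
  have "Lp_conv p a b us u"
    unfolding Lp_conv_def
  proof (rule tendsto_sandwich[where f = "\<lambda>_. 0" and h = "\<lambda>n. ennreal (1 / real (Suc (f n)))"])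
    show "\<forall>\<^sub>F n in sequentially. (Lp_dist p a b (us n) u) \<le> ennreal (1 / real (Suc (f n)))"
      using P_us by eventually_elim (simp add: P_def)
    show "(\<lambda>n. ennreal (1 / real (Suc (f n)))) \<longlonglongrightarrow> 0" using tendsto_ennrealI[OF small] by simp
  qed auto
  moreover have "limsup (\<lambda>n. G_eps p a b (e n) (A n) (B n) (us n)) \<le> ereal G"
  proof -
    have "limsup (\<lambda>n. G_eps p a b (e n) (A n) (B n) (us n)) \<le> limsup (\<lambda>n. ereal (G + 1 / real (Suc (f n))))"
      by (rule Limsup_mono) (use P_us in eventually_elim, simp add: P_def)
    also have "\<dots> = ereal (G + 0)"
      by (intro lim_imp_Limsup tendsto_intros small) auto
    finally show ?thesis by simp
  qed
  ultimately show ?thesis using us G by auto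
qed

theorem theorem1p1:
  fixes a b p a0 b0 :: real
    and aeps beps :: "real \<Rightarrow> real"
    and eps :: "nat \<Rightarrow> real"
  assumes "a < b"
    and "1 \<le> p" and "p \<le> 4"
    and "(aeps \<longlongrightarrow> a0) (at_right 0)"
    and "(beps \<longlongrightarrow> b0) (at_right 0)"
    and "\<forall>n. eps n > 0"
    and "eps \<longlonglongrightarrow> 0"
  shows "Gamma_conv_Lp p a b
           (\<lambda>n. G_eps p a b (eps n) (aeps (eps n)) (beps (eps n)))
           (G_lim p a b a0 b0)"
proof -
  have "filterlim eps (at_right 0) sequentially"
    unfolding filterlim_at using assms(6,7) by (auto intro!: always_eventually simp: less_imp_neq[symmetric])
  then have A: "(\<lambda>n. aeps (eps n)) \<longlonglongrightarrow> a0" and B: "(\<lambda>n. beps (eps n)) \<longlonglongrightarrow> b0"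
    using filterlim_compose[OF assms(4)] filterlim_compose[OF assms(5)] by auto
  let ?F = "\<lambda>n. G_eps p a b (eps n) (aeps (eps n)) (beps (eps n))"
  have liminf: "G_lim p a b a0 b0 u \<le> liminf (\<lambda>n. ?F n (us n))"
    if u: "Lp p a b u" "Lp_conv p a b us u" for u us
    unfolding le_Liminf_iff
  proof (intro allI impI)
    fix y assume y: "y < G_lim p a b a0 b0 u"
    \<comment> \<open>This settles negative levels \<open>y\<close>; the remaining case supplies the
      \<open>C \<ge> 0\<close> demanded by \<open>liminf_inequality\<close>.\<close>
    have Fnn: "0 \<le> ?F n x" for n x
      unfolding G_eps_def by (auto intro!: Inf_greatest)
    show "\<forall>\<^sub>F n in sequentially. y < ?F n (us n)"
    proof (cases "y < 0")
      case True
      then show ?thesis using Fnn by (auto intro: always_eventually less_le_trans)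
    next
      case False
      \<comment> \<open>A real level strictly between is needed: energies at most \<open>y\<close>
        infinitely often give a subsequence strictly below \<open>C\<close>, for which
        \<open>liminf_inequality\<close> contradicts the second inequality.\<close>
      obtain C where C: "y < ereal C" "ereal C < G_lim p a b a0 b0 u" using ereal_dense2[OF y] by auto
      have C0: "C \<ge> 0" using C False by (cases y) auto
      show ?thesis
      proof (rule ccontr)
        assume "\<not> ?thesis"
        then have "\<exists>\<^sub>F n in sequentially. ?F n (us n) \<le> y" by (simp add: frequently_def not_le)
        then have "\<exists>\<^sub>\<infinity>n. ?F n (us n) \<le> y" by (simp add: cofinite_eq_sequentially)
        then have inf: "infinite {n. ?F n (us n) \<le> y}" by (simp add: INFM_iff_infinite)
        define r where "r = enumerate {n. ?F n (us n) \<le> y}"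
        have r: "strict_mono r" "\<And>n. ?F (r n) (us (r n)) \<le> y"
          using enumerate_in_set[OF inf] strict_mono_enumerate[OF inf] by (auto simp: r_def)
        define Q where "Q n v dv ddv \<longleftrightarrow> W2rep p a b (us (r n)) v dv ddv \<and> (v \<longlongrightarrow> aeps (eps (r n))) (at_right a) \<and>
          (v \<longlongrightarrow> beps (eps (r n))) (at_left b) \<and> eps_energy a b (eps (r n)) (us (r n)) ddv \<le> ennreal C"
          for n v dv ddv
        have "?F (r n) (us (r n)) < ereal C" for n using r(2)[of n] C(1) by (rule le_less_trans)
        from G_eps_less_representation[OF this C0] have "\<forall>n. \<exists>v dv ddv. Q n v dv ddv" unfolding Q_def by blast
        from choice[OF this] obtain v where "\<forall>n. \<exists>dv ddv. Q n (v n) dv ddv" ..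
        from choice[OF this] obtain dv where "\<forall>n. \<exists>ddv. Q n (v n) (dv n) ddv" ..
        from choice[OF this] obtain ddv where "\<forall>n. Q n (v n) (dv n) (ddv n)" ..
        then have W: "\<And>n. W2rep p a b (us (r n)) (v n) (dv n) (ddv n)"
           "\<And>n. (v n \<longlongrightarrow> aeps (eps (r n))) (at_right a)" "\<And>n. (v n \<longlongrightarrow> beps (eps (r n))) (at_left b)"
          "\<And>n. eps_energy a b (eps (r n)) (us (r n)) (ddv n) \<le> ennreal C"
          unfolding Q_def by blast+
        have sub: "(\<lambda>n. X (r n)) \<longlonglongrightarrow> l" if "X \<longlonglongrightarrow> l" for X :: "nat \<Rightarrow> 'z::topological_space" and l
          using LIMSEQ_subseq_LIMSEQ[OF that r(1)] by (simp add: o_def)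
        have "Lp_conv p a b (\<lambda>n. us (r n)) u" using sub u(2) unfolding Lp_conv_def by blast
        from liminf_inequality[OF assms(1,2) C0 _ sub[OF assms(7)] u(1) this W(1-4) sub[OF A] sub[OF B]]
        have "G_lim p a b a0 b0 u \<le> ereal C" using assms(6) by simp
        then show False using C(2) by simp
      qed
    qed
  qed
  show ?thesis
    unfolding Gamma_conv_Lp_def
    using liminf limsup_inequality[OF assms(1,2) _ assms(7) _ A B] assms(6) by simp
qed

end
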